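(* For $\omega\in2^{\mathbb N\times\mathbb N}$ consider: (1) $\omega$ is computably random; (2) $\omega$ is e.c.u. random; (3) $\omega$ is Doob random. Then (1) $\Rightarrow$ (2) $\Rightarrow$ (3), and both implications are strict: there is an e.c.u. random $\omega$ that is not computably random, and there is a Doob random $\omega$ that is not e.c.u. random.
   Context: $2^{\mathbb N\times\mathbb N}$ carries the uniform (fair-coin product) measure and is identified with $(2^{\mathbb N})^{\mathbb N}$ via rows $\omega_m=(\omega_{m,0},\omega_{m,1},\dots)$. For $\omega\in(2^{\mathbb N})^{\mathbb N}$: $\omega_{<n}=(\omega_0,\dots,\omega_{n-1})$, $\omega_{\ge n}=(\omega_n,\omega_{n+1},\dots)$, $\omega_{<n}{}^\frown\xi=(\omega_0,\dots,\omega_{n-1},\xi_0,\xi_1,\dots)$, $\mathbb E_n(g)(\omega)=\int g(\omega_{<n}{}^\frown\xi)\,d\mathbb P(\xi)$. A martingale is $(M_n)$ with $M_n(\omega)$ a.s. depending only on $n,\omega_{<n}$ and $\mathbb E_mM_n=M_m$ for $m\le n$; computable if $M_n(\omega)$ is uniformly computable from $n$ and $\omega_{<n}$. $\omega$ is Doob random if $(M_n(\omega))$ converges to a real number for every nonnegative computable martingale. $\omega$ is computably random if $\bigoplus_n\omega_n\in2^{\mathbb N}$ is computably random (no computable nonnegative martingale $d:2^{<\mathbb N}\to\mathbb R$ with $d(\sigma)=\frac12(d(\sigma0)+d(\sigma1))$ has $\limsup_n d(\alpha_{<n})=\infty$). $\alpha$ is computably random uniformly relative to $\beta$ if there is no total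 computable map $\gamma\mapsto$ (name of a nonnegative martingale $d^\gamma$ on $2^{\mathbb N}$) with $\limsup_nd^\beta(\alpha_{<n})=\infty$. $\omega$ is e.c.u. random if for some $n$, $\omega_{\ge n}$ is computably random uniformly relative to $\omega_{<n}$ (sequences of sequences and finite tuples identified with $2^{\mathbb N}$ via join). *)

theory Defs
  imports "HOL-Probability.Probability" "HOL-Library.Nat_Bijection"
begin

type_synonym cantor = "nat \<Rightarrow> bool"

text \<open>
  Partial recursive functionals with an oracle in Cantor space, in the usual unary presentation
  over the pairing function. One derivation is used for all oracles, so the functionals are
  uniform in the oracle.
\<close>

inductive partial_recursive :: "(cantor \<Rightarrow> nat \<Rightarrow> nat option) \<Rightarrow> bool" where
  zero: "partial_recursive (\<lambda>\<gamma> x. Some 0)"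
| succ: "partial_recursive (\<lambda>\<gamma> x. Some (Suc x))"
| left: "partial_recursive (\<lambda>\<gamma> x. Some (fst (prod_decode x)))"
| right: "partial_recursive (\<lambda>\<gamma> x. Some (snd (prod_decode x)))"
| orac: "partial_recursive (\<lambda>\<gamma> x. Some (of_bool (\<gamma> x)))"
| pair: "partial_recursive f \<Longrightarrow> partial_recursive g \<Longrightarrow>
    partial_recursive (\<lambda>\<gamma> x.
      Option.bind (f \<gamma> x) (\<lambda>y. Option.bind (g \<gamma> x) (\<lambda>z. Some (prod_encode (y, z)))))"
| comp: "partial_recursive f \<Longrightarrow> partial_recursive g \<Longrightarrow>
    partial_recursive (\<lambda>\<gamma> x. Option.bind (g \<gamma> x) (f \<gamma>))"
| prec: "partial_recursive f \<Longrightarrow> partial_recursive g \<Longrightarrow>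
    partial_recursive (\<lambda>\<gamma> x.
      rec_nat (f \<gamma> (fst (prod_decode x)))
        (\<lambda>m r. Option.bind r
          (\<lambda>y. g \<gamma> (prod_encode (fst (prod_decode x), prod_encode (m, y)))))
        (snd (prod_decode x)))"
| mu: "partial_recursive f \<Longrightarrow>
    partial_recursive (\<lambda>\<gamma> x.
      if \<exists>n. f \<gamma> (prod_encode (x, n)) = Some 0 \<and> (\<forall>m<n. f \<gamma> (prod_encode (x, m)) \<noteq> None)
      then Some (LEAST n. f \<gamma> (prod_encode (x, n)) = Some 0)
      else None)"

definition computable_functional :: "(cantor \<Rightarrow> nat \<Rightarrow> nat) \<Rightarrow> bool" where
  "computable_functional F \<longleftrightarrow>
     (\<exists>\<Phi>. partial_recursive \<Phi> \<and> (\<forall>\<gamma> x. \<Phi> \<gamma> x = Some (F \<gamma> x)))"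

text \<open>The empty oracle adds no power, so this is plain computability.\<close>

definition computable :: "(nat \<Rightarrow> nat) \<Rightarrow> bool" where
  "computable f \<longleftrightarrow>
     (\<exists>\<Phi>. partial_recursive \<Phi> \<and> (\<forall>x. \<Phi> (\<lambda>_. False) x = Some (f x)))"

text \<open>A name of a real gives, for each \<open>k\<close>, (the code of) an integer numerator of a dyadic
  rational \<open>a / 2 ^ k\<close> within \<open>1 / 2 ^ k\<close> of it.\<close>

definition real_name :: "(nat \<Rightarrow> nat) \<Rightarrow> real \<Rightarrow> bool" where
  "real_name p x \<longleftrightarrow> (\<forall>k. \<bar>of_int (int_decode (p k)) / 2 ^ k - x\<bar> \<le> 1 / 2 ^ k)"

definition string_code :: "bool list \<Rightarrow> nat" where
  "string_code \<sigma> = list_encode (map of_bool \<sigma>)"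

definition initial_segment :: "cantor \<Rightarrow> nat \<Rightarrow> bool list" where
  "initial_segment \<alpha> n = map \<alpha> [0..<n]"

definition nonneg_martingale :: "(bool list \<Rightarrow> real) \<Rightarrow> bool" where
  "nonneg_martingale d \<longleftrightarrow>
     (\<forall>\<sigma>. 0 \<le> d \<sigma>) \<and> (\<forall>\<sigma>. d \<sigma> = (d (\<sigma> @ [False]) + d (\<sigma> @ [True])) / 2)"

definition martingale_name :: "(nat \<Rightarrow> nat) \<Rightarrow> (bool list \<Rightarrow> real) \<Rightarrow> bool" where
  "martingale_name p d \<longleftrightarrow>
     (\<forall>\<sigma>. real_name (\<lambda>k. p (prod_encode (string_code \<sigma>, k))) (d \<sigma>))"

definition succeeds_on :: "(bool list \<Rightarrow> real) \<Rightarrow> cantor \<Rightarrow> bool" where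
  "succeeds_on d \<alpha> \<longleftrightarrow> limsup (\<lambda>n. ereal (d (initial_segment \<alpha> n))) = \<infinity>"

definition computably_random :: "cantor \<Rightarrow> bool" where
  "computably_random \<alpha> \<longleftrightarrow>
     \<not> (\<exists>d p. nonneg_martingale d \<and> computable p \<and> martingale_name p d \<and> succeeds_on d \<alpha>)"

definition computably_random_uniformly_rel :: "cantor \<Rightarrow> cantor \<Rightarrow> bool" where
  "computably_random_uniformly_rel \<alpha> \<beta> \<longleftrightarrow>
     \<not> (\<exists>F d. computable_functional F \<and>
          (\<forall>\<gamma>. nonneg_martingale (d \<gamma>) \<and> martingale_name (F \<gamma>) (d \<gamma>)) \<and>
          succeeds_on (d \<beta>) \<alpha>)"

text \<open>\<open>\<omega> m\<close> is the \<open>m\<close>-th row of \<open>\<omega>\<close>.\<close>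

type_synonym cantor_seq = "nat \<Rightarrow> cantor"

definition join :: "cantor_seq \<Rightarrow> cantor" where
  "join \<omega> k = (case prod_decode k of (m, i) \<Rightarrow> \<omega> m i)"

text \<open>The join of the first \<open>n\<close> rows, interleaved; for \<open>n > 0\<close> this identifies \<open>n\<close>-tuples
  bijectively with Cantor space, and the empty tuple is sent to the zero sequence.\<close>

definition tuple_join :: "nat \<Rightarrow> cantor_seq \<Rightarrow> cantor" where
  "tuple_join n \<omega> k \<longleftrightarrow> 0 < n \<and> \<omega> (k mod n) (k div n)"

definition tail_from :: "nat \<Rightarrow> cantor_seq \<Rightarrow> cantor_seq" where
  "tail_from n \<omega> = (\<lambda>m. \<omega> (n + m))"

definition splice :: "nat \<Rightarrow> cantor_seq \<Rightarrow> cantor_seq \<Rightarrow> cantor_seq" where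
  "splice n \<omega> \<xi> = (\<lambda>m. if m < n then \<omega> m else \<xi> (m - n))"

definition computably_random_seq :: "cantor_seq \<Rightarrow> bool" where
  "computably_random_seq \<omega> \<longleftrightarrow> computably_random (join \<omega>)"

definition ecu_random :: "cantor_seq \<Rightarrow> bool" where
  "ecu_random \<omega> \<longleftrightarrow>
     (\<exists>n. computably_random_uniformly_rel (join (tail_from n \<omega>)) (tuple_join n \<omega>))"

definition cantor_measure :: "cantor measure" where
  "cantor_measure = (\<Pi>\<^sub>M i\<in>UNIV. measure_pmf (bernoulli_pmf (1 / 2)))"

definition uniform_seq_measure :: "cantor_seq measure" where
  "uniform_seq_measure = (\<Pi>\<^sub>M m\<in>UNIV. cantor_measure)"

definition cond_expect :: "nat \<Rightarrow> (cantor_seq \<Rightarrow> real) \<Rightarrow> cantor_seq \<Rightarrow> real" where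
  "cond_expect n g \<omega> = (\<integral>\<xi>. g (splice n \<omega> \<xi>) \<partial>uniform_seq_measure)"

definition doob_martingale :: "(nat \<Rightarrow> cantor_seq \<Rightarrow> real) \<Rightarrow> bool" where
  "doob_martingale M \<longleftrightarrow>
     (\<forall>n. integrable uniform_seq_measure (M n)) \<and>
     (\<forall>n. \<exists>g. (\<forall>\<omega> \<omega>'. (\<forall>i<n. \<omega> i = \<omega>' i) \<longrightarrow> g \<omega> = g \<omega>') \<and>
        (AE \<omega> in uniform_seq_measure. M n \<omega> = g \<omega>)) \<and>
     (\<forall>m n. m \<le> n \<longrightarrow>
        (AE \<omega> in uniform_seq_measure. cond_expect m (M n) \<omega> = M m \<omega>))"

text \<open>The oracle is \<open>\<omega>\<^sub><\<^sub>n\<close> only, so \<open>M n\<close> depends only on the first \<open>n\<close> rows everywhere, and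
  \<open>M n\<close> is continuous; for such \<open>M\<close> the almost sure identities above hold everywhere.\<close>

definition computable_doob_martingale :: "(nat \<Rightarrow> cantor_seq \<Rightarrow> real) \<Rightarrow> bool" where
  "computable_doob_martingale M \<longleftrightarrow> doob_martingale M \<and>
     (\<exists>F. computable_functional F \<and>
        (\<forall>n \<omega>. real_name (\<lambda>k. F (tuple_join n \<omega>) (prod_encode (n, k))) (M n \<omega>)))"

definition doob_random :: "cantor_seq \<Rightarrow> bool" where
  "doob_random \<omega> \<longleftrightarrow>
     (\<forall>M. computable_doob_martingale M \<and> (\<forall>n \<xi>. 0 \<le> M n \<xi>) \<longrightarrow> convergent (\<lambda>n. M n \<omega>))"

end

theory Submission imports Defs begin

text \<open>
  The first implication is the case \<open>n = 0\<close>.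

  Suppose a computable nonnegative Doob martingale \<open>M\<close> does not converge at \<open>\<omega>\<close>. Trading in \<open>M\<close> (buying low
  and selling high, or cashing in halves if \<open>M\<close> is unbounded) gives a computable martingale \<open>N\<close> that
  dominates an unbounded nondecreasing function of a stage count; the stage count never decreases and
  tends to infinity along \<open>\<omega>\<close>. It is locally constant, so the averages of \<open>N (n + L)\<close> over the cylinder of the first \<open>L\<close> bits
  of the join of the rows from \<open>n\<close> on also tend to infinity. These averages form a martingale on strings;
  it is computable uniformly in the first \<open>n\<close> rows, since by compactness a computable functional has a
  computable modulus of continuity.

  For the strictness of the second implication, there are only countably many such \<open>N\<close>, and choosing the
  rows one after the other keeps them all bounded along \<open>\<omega>\<close>; by continuity the rows may be taken
  eventually zero, which an opponent who knows where the zeros start can exploit. For the first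
  implication, put a row of zeros in front of a sequence that is random relative to the zero oracle.
\<close>

section \<open>Computable functionals\<close>

text \<open>That \<open>N m\<close> is large at \<omega> for some \<open>m\<close> does not bound
  the mean of \<open>N (n + L)\<close> over a cylinder, since later moves may undo the gain. Hence
  the lower bound by a function of the stage: a stage reached by \<omega> is reached by every
  sequence that shares enough bits with it, and it is never lost. The stage must therefore be a
  computable natural number, so a trade cannot be triggered by comparing reals, which is
  undecidable; it reads an integer approximation of the price, and the thresholds leave room for the
  error.

  Uniform relative randomness speaks of families that are martingales for every oracle, so a
  strategy has to stay solvent at every sequence and not only at \<omega>. This works because
  \<open>M 0\<close> reads no row and is a constant, and because the almost sure identities for
  \<open>M\<close> extend to all points by continuity. The strategy itself may depend on \<omega>,
  being finite information.\<close>

abbreviation pr :: "nat \<Rightarrow> nat \<Rightarrow> nat" where "pr a b \<equiv> prod_encode (a, b)"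
abbreviation p1 :: "nat \<Rightarrow> nat" where "p1 x \<equiv> fst (prod_decode x)"
abbreviation p2 :: "nat \<Rightarrow> nat" where "p2 x \<equiv> snd (prod_decode x)"

abbreviation cf :: "(cantor \<Rightarrow> nat \<Rightarrow> nat) \<Rightarrow> bool" where "cf \<equiv> computable_functional"

section \<open>Closure properties of total computable functionals\<close>

named_theorems cf_intros

lemma cf_iff: "cf F \<longleftrightarrow> partial_recursive (\<lambda>\<gamma> x. Some (F \<gamma> x))"
proof
  assume "cf F"
  then obtain \<Phi> where "partial_recursive \<Phi>" "\<And>\<gamma> x. \<Phi> \<gamma> x = Some (F \<gamma> x)"
    unfolding computable_functional_def by blast
  moreover from this(2) have "\<Phi> = (\<lambda>\<gamma> x. Some (F \<gamma> x))" by blast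
  ultimately show "partial_recursive (\<lambda>\<gamma> x. Some (F \<gamma> x))" by simp
qed (auto simp: computable_functional_def)

lemma cf_comp: "cf f \<Longrightarrow> cf g \<Longrightarrow> cf (\<lambda>\<gamma> x. f \<gamma> (g \<gamma> x))"
  unfolding cf_iff by (drule (1) partial_recursive.comp) simp

lemma cf_pair [cf_intros]: "cf f \<Longrightarrow> cf g \<Longrightarrow> cf (\<lambda>\<gamma> x. pr (f \<gamma> x) (g \<gamma> x))"
  unfolding cf_iff by (drule (1) partial_recursive.pair) simp

lemma cf_Suc [cf_intros]: "cf f \<Longrightarrow> cf (\<lambda>\<gamma> x. Suc (f \<gamma> x))"
  by (rule cf_comp[where f = "\<lambda>\<gamma> x. Suc x"]) (simp_all add: cf_iff partial_recursive.succ)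

lemma cf_p1 [cf_intros]: "cf f \<Longrightarrow> cf (\<lambda>\<gamma> x. p1 (f \<gamma> x))"
  by (rule cf_comp[where f = "\<lambda>\<gamma> x. p1 x"]) (simp_all add: cf_iff partial_recursive.left)

lemma cf_p2 [cf_intros]: "cf f \<Longrightarrow> cf (\<lambda>\<gamma> x. p2 (f \<gamma> x))"
  by (rule cf_comp[where f = "\<lambda>\<gamma> x. p2 x"]) (simp_all add: cf_iff partial_recursive.right)

lemma cf_oracle [cf_intros]: "cf f \<Longrightarrow> cf (\<lambda>\<gamma> x. of_bool (\<gamma> (f \<gamma> x)))"
  by (rule cf_comp[where f = "\<lambda>\<gamma> x. of_bool (\<gamma> x)"]) (simp_all add: cf_iff partial_recursive.orac)

text \<open>The inductive definition has no identity clause; pairing the two projections supplies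
  it.\<close>

lemma cf_id [cf_intros]: "cf (\<lambda>\<gamma> x. x)"
  using cf_pair[of "\<lambda>\<gamma> x. p1 x" "\<lambda>\<gamma> x. p2 x"]
  by (simp add: cf_iff partial_recursive.left partial_recursive.right)

lemma cf_const [cf_intros]: "cf (\<lambda>\<gamma> x. c)"
  by (induction c) (auto simp: cf_iff partial_recursive.zero dest: cf_Suc[unfolded cf_iff])

lemma cf_rec0:
  assumes "cf f" "cf g"
  shows "cf (\<lambda>\<gamma> x. rec_nat (f \<gamma> (p1 x)) (\<lambda>m r. g \<gamma> (pr (p1 x) (pr m r))) (p2 x))"
proof -
  have "rec_nat (Some (f \<gamma> a)) (\<lambda>m r. Option.bind r (\<lambda>y. Some (g \<gamma> (pr a (pr m y))))) n
    = Some (rec_nat (f \<gamma> a) (\<lambda>m r. g \<gamma> (pr a (pr m r))) n)" for \<gamma> a n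
    by (induction n) auto
  with partial_recursive.prec[OF assms[unfolded cf_iff]] show ?thesis
    unfolding cf_iff by simp
qed

text \<open>Feeding the recursion clause the pair of the whole input and the depth keeps
  \<open>x\<close> available to \<open>f\<close> and \<open>g\<close>.\<close>

lemma cf_rec [cf_intros]:
  assumes "cf n" "cf f" "cf (\<lambda>\<gamma> z. g \<gamma> (p1 z) (p1 (p2 z)) (p2 (p2 z)))"
  shows "cf (\<lambda>\<gamma> x. rec_nat (f \<gamma> x) (g \<gamma> x) (n \<gamma> x))"
proof -
  have "cf (\<lambda>\<gamma> x. pr x (n \<gamma> x))" by (intro cf_intros assms)
  from cf_comp[OF cf_rec0[OF assms(2,3)] this] show ?thesis by simp
qed

lemma cf_Least:
  assumes "cf f" "\<And>\<gamma> x. \<exists>n. f \<gamma> (pr x n) = 0"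
  shows "cf (\<lambda>\<gamma> x. LEAST n. f \<gamma> (pr x n) = 0)"
  using partial_recursive.mu[OF assms(1)[unfolded cf_iff]] assms(2)
  unfolding cf_iff by simp

lemma cf_case_nat [cf_intros]:
  assumes "cf n" "cf f" "cf (\<lambda>\<gamma> z. g \<gamma> (p1 z) (p2 z))"
  shows "cf (\<lambda>\<gamma> x. case n \<gamma> x of 0 \<Rightarrow> f \<gamma> x | Suc m \<Rightarrow> g \<gamma> x m)"
proof -
  have "cf (\<lambda>\<gamma> z. pr (p1 z) (p1 (p2 z)))" by (intro cf_intros)
  from cf_comp[OF assms(3) this]
  have "cf (\<lambda>\<gamma> z. g \<gamma> (p1 z) (p1 (p2 z)))" by simp
  from cf_rec[OF assms(1,2), of "\<lambda>\<gamma> x m r. g \<gamma> x m"] this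
  have "cf (\<lambda>\<gamma> x. rec_nat (f \<gamma> x) (\<lambda>m r. g \<gamma> x m) (n \<gamma> x))" by simp
  moreover have "rec_nat a (\<lambda>m r. h m) k = (case k of 0 \<Rightarrow> a | Suc m \<Rightarrow> h m)" for a :: nat and h k
    by (cases k) auto
  ultimately show ?thesis by simp
qed

lemma cf_add [cf_intros]: assumes "cf f" "cf g" shows "cf (\<lambda>\<gamma> x. f \<gamma> x + g \<gamma> x)"
proof -
  have "cf (\<lambda>\<gamma> x. rec_nat (f \<gamma> x) (\<lambda>m r. Suc r) (g \<gamma> x))" by (intro cf_intros assms)
  moreover have "rec_nat a (\<lambda>m r. Suc r) b = a + b" for a b by (induction b) auto
  ultimately show ?thesis by simp
qed

lemma cf_diff [cf_intros]: assumes "cf f" "cf g" shows "cf (\<lambda>\<gamma> x. f \<gamma> x - g \<gamma> x)"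
proof -
  have "cf (\<lambda>\<gamma> x. rec_nat (f \<gamma> x) (\<lambda>m r. case r of 0 \<Rightarrow> 0 | Suc r \<Rightarrow> r) (g \<gamma> x))"
    by (intro cf_intros assms)
  moreover have "rec_nat a (\<lambda>m r. case r of 0 \<Rightarrow> 0 | Suc r \<Rightarrow> r) b = a - b" for a b :: nat
    by (induction b) (auto split: nat.splits)
  ultimately show ?thesis by simp
qed

lemma cf_mult [cf_intros]: assumes "cf f" "cf g" shows "cf (\<lambda>\<gamma> x. f \<gamma> x * g \<gamma> x)"
proof -
  have "cf (\<lambda>\<gamma> x. rec_nat 0 (\<lambda>m r. r + f \<gamma> x) (g \<gamma> x))"
    by (intro cf_intros assms cf_comp[OF assms(1)])
  moreover have "rec_nat 0 (\<lambda>m r. r + a) b = a * b" for a b :: nat by (induction b) auto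
  ultimately show ?thesis by simp
qed

lemma cf_power [cf_intros]: assumes "cf f" "cf g" shows "cf (\<lambda>\<gamma> x. f \<gamma> x ^ g \<gamma> x)"
proof -
  have "cf (\<lambda>\<gamma> x. rec_nat 1 (\<lambda>m r. r * f \<gamma> x) (g \<gamma> x))"
    by (intro cf_intros assms cf_comp[OF assms(1)])
  moreover have "rec_nat 1 (\<lambda>m r. r * a) b = a ^ b" for a b :: nat by (induction b) auto
  ultimately show ?thesis by simp
qed

lemma cf_eq0: assumes "cf f" shows "cf (\<lambda>\<gamma> x. of_bool (f \<gamma> x = 0))"
proof -
  have "cf (\<lambda>\<gamma> x. 1 - f \<gamma> x)" by (intro cf_intros assms)
  moreover have "1 - a = of_bool (a = 0)" for a :: nat by auto
  ultimately show ?thesis by simp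
qed

lemma cf_le [cf_intros]: assumes "cf f" "cf g" shows "cf (\<lambda>\<gamma> x. of_bool (f \<gamma> x \<le> g \<gamma> x))"
  using cf_eq0[OF cf_diff[OF assms]] by simp

lemma cf_less [cf_intros]: assumes "cf f" "cf g" shows "cf (\<lambda>\<gamma> x. of_bool (f \<gamma> x < g \<gamma> x))"
  using cf_le[OF cf_Suc[OF assms(1)] assms(2)] by (simp add: Suc_le_eq)

lemma cf_not [cf_intros]: assumes "cf (\<lambda>\<gamma> x. of_bool (P \<gamma> x))" shows "cf (\<lambda>\<gamma> x. of_bool (\<not> P \<gamma> x))"
  using cf_eq0[OF assms] by simp

lemma cf_conj [cf_intros]: assumes "cf (\<lambda>\<gamma> x. of_bool (P \<gamma> x))" "cf (\<lambda>\<gamma> x. of_bool (Q \<gamma> x))"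
  shows "cf (\<lambda>\<gamma> x. of_bool (P \<gamma> x \<and> Q \<gamma> x))"
  using cf_mult[OF assms] by (simp flip: of_bool_conj)

lemma cf_disj [cf_intros]: assumes "cf (\<lambda>\<gamma> x. of_bool (P \<gamma> x))" "cf (\<lambda>\<gamma> x. of_bool (Q \<gamma> x))"
  shows "cf (\<lambda>\<gamma> x. of_bool (P \<gamma> x \<or> Q \<gamma> x))"
  using cf_not[OF cf_conj[OF cf_not[OF assms(1)] cf_not[OF assms(2)]]] by simp

lemma cf_eq [cf_intros]: assumes "cf f" "cf g" shows "cf (\<lambda>\<gamma> x. of_bool (f \<gamma> x = g \<gamma> x))"
  using cf_conj[OF cf_le[OF assms] cf_le[OF assms(2,1)]] by (simp flip: eq_iff)

lemma cf_if [cf_intros]: assumes "cf (\<lambda>\<gamma> x. of_bool (P \<gamma> x))" "cf f" "cf g"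
  shows "cf (\<lambda>\<gamma> x. if P \<gamma> x then f \<gamma> x else g \<gamma> x)"
proof -
  have "cf (\<lambda>\<gamma> x. of_bool (P \<gamma> x) * f \<gamma> x + (1 - of_bool (P \<gamma> x)) * g \<gamma> x)"
    by (intro cf_intros assms)
  moreover have "of_bool P * a + (1 - of_bool P) * b = (if P then a else b)" for P and a b :: nat
    by simp
  ultimately show ?thesis by simp
qed

lemma cf_If [cf_intros]: assumes "cf (\<lambda>\<gamma> x. of_bool (P \<gamma> x))" "cf (\<lambda>\<gamma> x. of_bool (Q \<gamma> x))"
    "cf (\<lambda>\<gamma> x. of_bool (R \<gamma> x))"
  shows "cf (\<lambda>\<gamma> x. of_bool (if P \<gamma> x then Q \<gamma> x else R \<gamma> x))"
  using cf_if[OF assms] by (simp add: if_distrib)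

lemma cf_curry: assumes "cf (\<lambda>\<gamma> z. g \<gamma> (p1 z) (p2 z))" "cf a" "cf b"
  shows "cf (\<lambda>\<gamma> x. g \<gamma> (a \<gamma> x) (b \<gamma> x))"
  using cf_comp[OF assms(1) cf_pair[OF assms(2,3)]] by simp

lemma cf_sum [cf_intros]:
  assumes "cf n" "cf (\<lambda>\<gamma> z. f \<gamma> (p1 z) (p2 z))"
  shows "cf (\<lambda>\<gamma> x. \<Sum>i<n \<gamma> x. f \<gamma> x i)"
proof -
  have "cf (\<lambda>\<gamma> x. rec_nat 0 (\<lambda>m r. r + f \<gamma> x m) (n \<gamma> x))"
    by (intro cf_intros cf_curry[OF assms(2)] assms(1))
  moreover have "rec_nat 0 (\<lambda>m r. r + h m) k = (\<Sum>i<k. h i)" for h :: "nat \<Rightarrow> nat" and k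
    by (induction k) auto
  ultimately show ?thesis by simp
qed

lemma cf_ball [cf_intros]:
  assumes "cf n" "cf (\<lambda>\<gamma> z. of_bool (P \<gamma> (p1 z) (p2 z)))"
  shows "cf (\<lambda>\<gamma> x. of_bool (\<forall>i<n \<gamma> x. P \<gamma> x i))"
proof -
  have "cf (\<lambda>\<gamma> x. of_bool ((\<Sum>i<n \<gamma> x. of_bool (\<not> P \<gamma> x i)) = (0::nat)))"
    by (intro cf_intros assms)
  moreover have "((\<Sum>i<k. of_bool (\<not> Q i)) = (0::nat)) = (\<forall>i<k. Q i)" for Q :: "nat \<Rightarrow> bool" and k
    by auto
  ultimately show ?thesis by simp
qed

lemma cf_bex [cf_intros]:
  assumes "cf n" "cf (\<lambda>\<gamma> z. of_bool (P \<gamma> (p1 z) (p2 z)))"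
  shows "cf (\<lambda>\<gamma> x. of_bool (\<exists>i<n \<gamma> x. P \<gamma> x i))"
  using cf_not[OF cf_ball[OF assms(1) cf_not[OF assms(2)]]] by simp

lemma cf_Least_of_bool:
  assumes "cf (\<lambda>\<gamma> z. of_bool (P \<gamma> (p1 z) (p2 z)))" "\<And>\<gamma> x. \<exists>n. P \<gamma> x n"
  shows "cf (\<lambda>\<gamma> x. LEAST n. P \<gamma> x n)"
  using cf_Least[OF cf_not[OF assms(1)]] assms(2) by simp

text \<open>The quotient counts the positive multiples of \<open>b\<close> up to \<open>a\<close>,
  so division becomes a bounded sum of tests.\<close>

lemma card_multiples_le:
  fixes a b :: nat
  assumes b: "0 < b"
  shows "(\<Sum>i<a. of_bool (Suc i * b \<le> a)) = a div b"
proof -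
  have "{..<a} \<inter> {i. Suc i * b \<le> a} = {..<a div b}"
  proof (intro set_eqI iffI)
    fix i assume "i \<in> {..<a} \<inter> {i. Suc i * b \<le> a}"
    then show "i \<in> {..<a div b}" using b by (simp add: less_eq_div_iff_mult_less_eq flip: Suc_le_eq)
  next
    fix i assume *: "i \<in> {..<a div b}"
    then have "i < a" by (meson div_le_dividend lessThan_iff order_less_le_trans)
    with * b show "i \<in> {..<a} \<inter> {i. Suc i * b \<le> a}"
      by (simp add: less_eq_div_iff_mult_less_eq flip: Suc_le_eq)
  qed
  moreover have "(\<Sum>i<a. of_bool (Suc i * b \<le> a) :: nat) = card ({..<a} \<inter> {i. Suc i * b \<le> a})"
    by (simp only: sum_of_bool_eq finite_lessThan of_nat_id)
  ultimately show ?thesis by (simp only: card_lessThan)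
qed

lemma cf_div [cf_intros]: assumes "cf f" "cf g" shows "cf (\<lambda>\<gamma> x. f \<gamma> x div g \<gamma> x)"
proof -
  \<comment> \<open>The case split accounts for \<open>a div 0 = 0\<close>: with
    \<open>b = 0\<close> the sum would count every index.\<close>
  have "cf (\<lambda>\<gamma> x. if 0 < g \<gamma> x then \<Sum>i<f \<gamma> x. of_bool (Suc i * g \<gamma> x \<le> f \<gamma> x) else 0)"
    by (intro cf_intros assms cf_comp[OF assms(1)] cf_comp[OF assms(2)])
  moreover have "(if 0 < b then \<Sum>i<a. of_bool (Suc i * b \<le> a) else 0) = a div b" for a b :: nat
    using card_multiples_le[of b a] by (cases "0 < b") (simp_all only: if_True if_False, simp)
  ultimately show ?thesis by simp
qed

lemma cf_mod [cf_intros]: assumes "cf f" "cf g" shows "cf (\<lambda>\<gamma> x. f \<gamma> x mod g \<gamma> x)"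
proof -
  have "cf (\<lambda>\<gamma> x. f \<gamma> x - f \<gamma> x div g \<gamma> x * g \<gamma> x)"
    by (intro cf_intros assms)
  then show ?thesis by (simp add: minus_div_mult_eq_mod)
qed

lemma cf_even [cf_intros]: assumes "cf f" shows "cf (\<lambda>\<gamma> x. of_bool (even (f \<gamma> x)))"
proof -
  have "cf (\<lambda>\<gamma> x. of_bool (f \<gamma> x mod 2 = 0))" by (intro cf_intros assms)
  then show ?thesis by (simp add: even_iff_mod_2_eq_zero)
qed

section \<open>Reading strings from their codes\<close>

definition code_tl :: "nat \<Rightarrow> nat \<Rightarrow> nat" where
  "code_tl c i = rec_nat c (\<lambda>m r. p2 (r - 1)) i"

definition code_length :: "nat \<Rightarrow> nat" where
  "code_length c = (\<Sum>i<c. of_bool (code_tl c i \<noteq> 0))"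

definition code_nth :: "nat \<Rightarrow> nat \<Rightarrow> nat" where
  "code_nth c i = p1 (code_tl c i - 1)"

text \<open>The code 0 of the empty list is a fixed point of the tail operation, because
  \<open>0 - 1 = 0\<close> and \<open>prod_decode 0 = (0, 0)\<close>; this matches
  \<open>drop\<close> beyond the end of the list.\<close>

lemma code_tl_list_encode: "code_tl (list_encode xs) i = list_encode (drop i xs)"
proof (induction i)
  case (Suc i)
  have "prod_decode 0 = (0, 0)"
    using prod_encode_inverse[of "(0, 0)"] by (simp add: prod_encode_def)
  then have "p2 (list_encode ys - 1) = list_encode (tl ys)" for ys
    by (cases ys) simp_all
  with Suc show ?case by (simp add: code_tl_def drop_Suc drop_tl)
qed (simp add: code_tl_def)

text \<open>Bounds the number of tails that \<open>code_length\<close> has to inspect by the code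
  itself.\<close>

lemma length_le_list_encode: "length xs \<le> list_encode xs"
  by (induction xs) (auto intro: le_trans le_prod_encode_2)

lemma code_length_string [simp]: "code_length (string_code \<sigma>) = length \<sigma>"
proof -
  let ?xs = "map of_bool \<sigma> :: nat list"
  have nz: "list_encode ys \<noteq> 0 \<longleftrightarrow> ys \<noteq> []" for ys by (cases ys) auto
  have "code_length (string_code \<sigma>) = (\<Sum>i<list_encode ?xs. of_bool (i < length \<sigma>))"
    by (simp only: code_length_def string_code_def code_tl_list_encode nz) (simp add: not_le)
  also have "\<dots> = card ({..<list_encode ?xs} \<inter> {i. i < length \<sigma>})"
    by (subst sum_of_bool_eq) auto
  also have "{..<list_encode ?xs} \<inter> {i. i < length \<sigma>} = {..<length \<sigma>}"
    using length_le_list_encode[of ?xs] by auto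
  finally show ?thesis by simp
qed

lemma code_nth_string [simp]: "i < length \<sigma> \<Longrightarrow> code_nth (string_code \<sigma>) i = of_bool (\<sigma> ! i)"
  by (simp add: code_nth_def string_code_def code_tl_list_encode flip: Cons_nth_drop_Suc)

lemma cf_code_tl [cf_intros]: "cf f \<Longrightarrow> cf g \<Longrightarrow> cf (\<lambda>\<gamma> x. code_tl (f \<gamma> x) (g \<gamma> x))"
  unfolding code_tl_def by (intro cf_intros)
lemma cf_code_nth [cf_intros]: "cf f \<Longrightarrow> cf g \<Longrightarrow> cf (\<lambda>\<gamma> x. code_nth (f \<gamma> x) (g \<gamma> x))"
  unfolding code_nth_def by (intro cf_intros)
lemma cf_code_length [cf_intros]: assumes "cf f" shows "cf (\<lambda>\<gamma> x. code_length (f \<gamma> x))"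
  unfolding code_length_def by (intro cf_intros assms cf_comp[OF assms])

text \<open>Lets a functional run on an oracle assembled from \<gamma> and a parameter. The
  parameter \<open>p1 z\<close> is threaded through every call, since all subcomputations must see
  the same assembled oracle while their arguments change.\<close>

lemma partial_recursive_substitute:
  assumes "partial_recursive \<Phi>" "cf P"
  shows "partial_recursive (\<lambda>\<gamma> z. \<Phi> (\<lambda>i. P \<gamma> (pr (p1 z) i) \<noteq> 0) (p2 z))"
  using assms(1)
proof (induction rule: partial_recursive.induct)
  case zero
  show ?case by (rule partial_recursive.zero)
next
  case succ
  show ?case by (rule cf_iff[THEN iffD1]) (intro cf_intros)
next
  case left
  show ?case by (rule cf_iff[THEN iffD1]) (intro cf_intros)
next
  case right
  show ?case by (rule cf_iff[THEN iffD1]) (intro cf_intros)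
next
  case orac
  have "cf (\<lambda>\<gamma> z. of_bool (P \<gamma> z \<noteq> 0))" by (intro cf_intros assms)
  from this[unfolded cf_iff] show ?case by simp
next
  case (pair f g)
  from partial_recursive.pair[OF pair.IH] show ?case by simp
next
  case (comp f g)
  have "partial_recursive (\<lambda>\<gamma> z. Some (p1 z))" by (rule partial_recursive.left)
  from partial_recursive.pair[OF this comp.IH(2)]
  have "partial_recursive (\<lambda>\<gamma> z. Option.bind (g (\<lambda>i. P \<gamma> (pr (p1 z) i) \<noteq> 0) (p2 z)) (\<lambda>y. Some (pr (p1 z) y)))"
    by simp
  from partial_recursive.comp[OF comp.IH(1) this] show ?case
    by (simp add: bind_assoc)
next
  case (prec f g)
  let ?o = "\<lambda>\<gamma> y i. P \<gamma> (pr y i) \<noteq> 0"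
  \<comment> \<open>The recursion clause treats the pair of oracle parameter and argument as its own
    parameter; \<open>A\<close> re-associates ((y, a), r) to (y, (a, r)), and \<open>C\<close> goes
    the other way on the input.\<close>
  have A: "partial_recursive (\<lambda>\<gamma> w. Some (pr (p1 (p1 w)) (pr (p2 (p1 w)) (p2 w))))"
    by (rule cf_iff[THEN iffD1]) (intro cf_intros)
  have B: "partial_recursive (\<lambda>\<gamma> w. g (?o \<gamma> (p1 (p1 w))) (pr (p2 (p1 w)) (p2 w)))"
    using partial_recursive.comp[OF prec.IH(2) A] by simp
  have C: "partial_recursive (\<lambda>\<gamma> z. Some (pr (pr (p1 z) (p1 (p2 z))) (p2 (p2 z))))"
    by (rule cf_iff[THEN iffD1]) (intro cf_intros)
  from partial_recursive.comp[OF partial_recursive.prec[OF prec.IH(1) B] C]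
  show ?case by simp
next
  case (mu f)
  let ?o = "\<lambda>\<gamma> y i. P \<gamma> (pr y i) \<noteq> 0"
  have A: "partial_recursive (\<lambda>\<gamma> w. Some (pr (p1 (p1 w)) (pr (p2 (p1 w)) (p2 w))))"
    by (rule cf_iff[THEN iffD1]) (intro cf_intros)
  have B: "partial_recursive (\<lambda>\<gamma> w. f (?o \<gamma> (p1 (p1 w))) (pr (p2 (p1 w)) (p2 w)))"
    using partial_recursive.comp[OF mu.IH A] by simp
  from partial_recursive.mu[OF B] show ?case by (simp only: prod_encode_inverse fst_conv snd_conv)
qed

lemma cf_substitute:
  assumes "cf F" "cf P" "cf y" "cf x"
  shows "cf (\<lambda>\<gamma> z. F (\<lambda>i. P \<gamma> (pr (y \<gamma> z) i) \<noteq> 0) (x \<gamma> z))"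
proof -
  have "cf (\<lambda>\<gamma> z. F (\<lambda>i. P \<gamma> (pr (p1 z) i) \<noteq> 0) (p2 z))"
    using partial_recursive_substitute[OF assms(1)[unfolded cf_iff] assms(2)] unfolding cf_iff .
  from cf_comp[OF this cf_pair[OF assms(3,4)]] show ?thesis by simp
qed

section \<open>Finite use of the oracle\<close>

definition agree :: "nat \<Rightarrow> cantor \<Rightarrow> cantor \<Rightarrow> bool" where
  "agree l \<alpha> \<beta> \<longleftrightarrow> (\<forall>i<l. \<alpha> i = \<beta> i)"

lemma agree_mono: "agree l \<alpha> \<beta> \<Longrightarrow> k \<le> l \<Longrightarrow> agree k \<alpha> \<beta>"
  by (simp add: agree_def)

text \<open>A value \<open>Suc y\<close> of the approximation means that the computation has been seen to halt
  with output \<open>y\<close> while querying the oracle below \<open>l\<close> only.\<close>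

definition bounded_use :: "(cantor \<Rightarrow> nat \<Rightarrow> nat option) \<Rightarrow> (cantor \<Rightarrow> nat \<Rightarrow> nat) \<Rightarrow> bool" where
  "bounded_use \<Phi> \<Psi> \<longleftrightarrow> cf \<Psi> \<and>
    (\<forall>l x \<gamma> y. \<Psi> \<gamma> (pr l x) = Suc y \<longrightarrow> \<Phi> \<gamma> x = Some y) \<and>
    (\<forall>\<gamma> x y. \<Phi> \<gamma> x = Some y \<longrightarrow> (\<exists>L. \<forall>l\<ge>L. \<Psi> \<gamma> (pr l x) = Suc y)) \<and>
    (\<forall>l x \<gamma> \<gamma>'. agree l \<gamma> \<gamma>' \<longrightarrow> \<Psi> \<gamma> (pr l x) = \<Psi> \<gamma>' (pr l x))"

lemma bounded_useI:
  assumes "cf \<Psi>" "\<And>l x \<gamma> y. \<Psi> \<gamma> (pr l x) = Suc y \<Longrightarrow> \<Phi> \<gamma> x = Some y"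
    "\<And>\<gamma> x y. \<Phi> \<gamma> x = Some y \<Longrightarrow> \<exists>L. \<forall>l\<ge>L. \<Psi> \<gamma> (pr l x) = Suc y"
    "\<And>l x \<gamma> \<gamma>'. agree l \<gamma> \<gamma>' \<Longrightarrow> \<Psi> \<gamma> (pr l x) = \<Psi> \<gamma>' (pr l x)"
  shows "bounded_use \<Phi> \<Psi>"
  using assms unfolding bounded_use_def by blast

lemma bounded_useD:
  assumes "bounded_use \<Phi> \<Psi>"
  shows "cf \<Psi>" "\<Psi> \<gamma> (pr l x) = Suc y \<Longrightarrow> \<Phi> \<gamma> x = Some y"
    "\<Phi> \<gamma> x = Some y \<Longrightarrow> \<exists>L. \<forall>l\<ge>L. \<Psi> \<gamma> (pr l x) = Suc y"
    "agree l \<gamma> \<gamma>' \<Longrightarrow> \<Psi> \<gamma> (pr l x) = \<Psi> \<gamma>' (pr l x)"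
  using assms unfolding bounded_use_def by blast+

text \<open>Serves the clauses that never query the oracle: with the oracle fixed, the approximation
  depends on neither \<open>l\<close> nor \<gamma>.\<close>

lemma bounded_use_total:
  assumes "cf F" shows "\<exists>\<Psi>. bounded_use (\<lambda>\<gamma> x. Some (F (\<lambda>_. False) x)) \<Psi>"
proof -
  have "cf (\<lambda>\<gamma> z. F (\<lambda>i. False) (p2 z))"
    using cf_substitute[OF assms cf_const[of 0] cf_const[of 0] cf_p2[OF cf_id]] by simp
  then have "bounded_use (\<lambda>\<gamma> x. Some (F (\<lambda>_. False) x)) (\<lambda>\<gamma> z. Suc (F (\<lambda>_. False) (p2 z)))"
    by (intro bounded_useI) (auto intro!: cf_intros)
  then show ?thesis by blast
qed

text \<open>The budget \<open>l\<close> limits both the oracle queries and the length of each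
  mu-search; the remaining clauses terminate by themselves and need no step count. Success is asked
  for all large \<open>l\<close>, so that finitely many subcomputations can share one
  budget.\<close>

lemma bounded_use_exists: "partial_recursive \<Phi> \<Longrightarrow> \<exists>\<Psi>. bounded_use \<Phi> \<Psi>"
proof (induction rule: partial_recursive.induct)
  case zero
  show ?case using bounded_use_total[OF cf_const] by simp
next
  case succ
  show ?case using bounded_use_total[OF cf_Suc[OF cf_id]] by simp
next
  case left
  show ?case using bounded_use_total[OF cf_p1[OF cf_id]] by simp
next
  case right
  show ?case using bounded_use_total[OF cf_p2[OF cf_id]] by simp
next
  case orac
  have "bounded_use (\<lambda>\<gamma> x. Some (of_bool (\<gamma> x)))
    (\<lambda>\<gamma> z. if p2 z < p1 z then Suc (of_bool (\<gamma> (p2 z))) else 0)"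
  proof (rule bounded_useI, goal_cases)
    case 1 show ?case by (intro cf_intros)
  next
    case (3 \<gamma> x y) then show ?case by (intro exI[of _ "Suc x"]) auto
  qed (auto simp: agree_def split: if_splits)
  then show ?case by blast
next
  case (pair f g)
  then obtain \<Psi> \<Theta> where A: "bounded_use f \<Psi>" and B: "bounded_use g \<Theta>" by blast
  note [cf_intros] = bounded_useD(1)[OF A] bounded_useD(1)[OF B]
  let ?H = "\<lambda>\<gamma> z. if \<Psi> \<gamma> z = 0 \<or> \<Theta> \<gamma> z = 0 then 0 else Suc (pr (\<Psi> \<gamma> z - 1) (\<Theta> \<gamma> z - 1))"
  have "bounded_use (\<lambda>\<gamma> x. Option.bind (f \<gamma> x) (\<lambda>y. Option.bind (g \<gamma> x) (\<lambda>z. Some (pr y z)))) ?H"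
  proof (rule bounded_useI, goal_cases)
    case 1 show ?case by (intro cf_intros)
  next
    case (2 l x \<gamma> y)
    then obtain a b where "\<Psi> \<gamma> (pr l x) = Suc a" "\<Theta> \<gamma> (pr l x) = Suc b"
      by (cases "\<Psi> \<gamma> (pr l x)"; cases "\<Theta> \<gamma> (pr l x)") auto
    with 2 bounded_useD(2)[OF A this(1)] bounded_useD(2)[OF B this(2)] show ?case by auto
  next
    case (3 \<gamma> x y)
    then obtain a b where ab: "f \<gamma> x = Some a" "g \<gamma> x = Some b" "y = pr a b"
      by (auto simp: bind_eq_Some_conv)
    obtain L K where "\<forall>l\<ge>L. \<Psi> \<gamma> (pr l x) = Suc a" "\<forall>l\<ge>K. \<Theta> \<gamma> (pr l x) = Suc b"
      using bounded_useD(3)[OF A ab(1)] bounded_useD(3)[OF B ab(2)] by blast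
    with ab show ?case by (intro exI[of _ "max L K"]) auto
  next
    case (4 l x \<gamma> \<gamma>')
    then show ?case by (simp add: bounded_useD(4)[OF A 4] bounded_useD(4)[OF B 4])
  qed
  then show ?case by blast
next
  case (comp f g)
  then obtain \<Psi> \<Theta> where A: "bounded_use f \<Psi>" and B: "bounded_use g \<Theta>" by blast
  note [cf_intros] = bounded_useD(1)[OF A] bounded_useD(1)[OF B]
  let ?H = "\<lambda>\<gamma> z. if \<Theta> \<gamma> z = 0 then 0 else \<Psi> \<gamma> (pr (p1 z) (\<Theta> \<gamma> z - 1))"
  have "bounded_use (\<lambda>\<gamma> x. Option.bind (g \<gamma> x) (f \<gamma>)) ?H"
  proof (rule bounded_useI, goal_cases)
    case 1 show ?case by (intro cf_intros cf_comp[OF bounded_useD(1)[OF A]])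
  next
    case (2 l x \<gamma> y)
    then obtain b where b: "\<Theta> \<gamma> (pr l x) = Suc b"
      by (cases "\<Theta> \<gamma> (pr l x)") auto
    with 2 have "\<Psi> \<gamma> (pr l b) = Suc y" by simp
    with b show ?case using bounded_useD(2)[OF A] bounded_useD(2)[OF B] by fastforce
  next
    case (3 \<gamma> x y)
    then obtain b where b: "g \<gamma> x = Some b" "f \<gamma> b = Some y"
      by (auto simp: bind_eq_Some_conv)
    obtain L K where "\<forall>l\<ge>L. \<Psi> \<gamma> (pr l b) = Suc y" "\<forall>l\<ge>K. \<Theta> \<gamma> (pr l x) = Suc b"
      using bounded_useD(3)[OF A b(2)] bounded_useD(3)[OF B b(1)] by blast
    then show ?case by (intro exI[of _ "max L K"]) auto
  next
    case (4 l x \<gamma> \<gamma>')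
    then show ?case using bounded_useD(4)[OF A 4] bounded_useD(4)[OF B 4] by simp
  qed
  then show ?case by blast
next
  case (prec f g)
  then obtain \<Psi> \<Theta> where A: "bounded_use f \<Psi>" and B: "bounded_use g \<Theta>" by blast
  let ?R = "\<lambda>\<gamma> l a. rec_nat (\<Psi> \<gamma> (pr l a)) (\<lambda>m r. if r = 0 then 0 else \<Theta> \<gamma> (pr l (pr a (pr m (r - 1)))))"
  let ?F = "\<lambda>\<gamma> a. rec_nat (f \<gamma> a) (\<lambda>m r. Option.bind r (\<lambda>y. g \<gamma> (pr a (pr m y))))"
  let ?H = "\<lambda>\<gamma> z. ?R \<gamma> (p1 z) (p1 (p2 z)) (p2 (p2 z))"
  have R2: "?R \<gamma> l a n = Suc y \<Longrightarrow> ?F \<gamma> a n = Some y" for \<gamma> l a n y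
  proof (induction n arbitrary: y)
    case 0 then show ?case using bounded_useD(2)[OF A] by simp
  next
    case (Suc n)
    then obtain b where b: "?R \<gamma> l a n = Suc b"
      by (cases "?R \<gamma> l a n") auto
    with Suc.prems have "\<Theta> \<gamma> (pr l (pr a (pr n b))) = Suc y" by simp
    then show ?case using Suc.IH[OF b] bounded_useD(2)[OF B] by simp
  qed
  have R3: "?F \<gamma> a n = Some y \<Longrightarrow> \<exists>L. \<forall>l\<ge>L. ?R \<gamma> l a n = Suc y" for \<gamma> a n y
  proof (induction n arbitrary: y)
    case 0 then show ?case using bounded_useD(3)[OF A] by simp
  next
    case (Suc n)
    then obtain b where b: "?F \<gamma> a n = Some b" "g \<gamma> (pr a (pr n b)) = Some y"
      by (auto simp: bind_eq_Some_conv)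
    obtain L K where "\<forall>l\<ge>L. ?R \<gamma> l a n = Suc b" "\<forall>l\<ge>K. \<Theta> \<gamma> (pr l (pr a (pr n b))) = Suc y"
      using Suc.IH[OF b(1)] bounded_useD(3)[OF B b(2)] by blast
    then show ?case by (intro exI[of _ "max L K"]) auto
  qed
  have R4: "agree l \<gamma> \<gamma>' \<Longrightarrow> ?R \<gamma> l a n = ?R \<gamma>' l a n" for \<gamma> \<gamma>' l a n
    by (induction n) (simp_all add: bounded_useD(4)[OF A, of l \<gamma> \<gamma>'] bounded_useD(4)[OF B, of l \<gamma> \<gamma>'])
  have "bounded_use (\<lambda>\<gamma> x. ?F \<gamma> (p1 x) (p2 x)) ?H"
  proof (rule bounded_useI, goal_cases)
    case 1 show ?case
      by (intro cf_intros cf_comp[OF bounded_useD(1)[OF A]] cf_comp[OF bounded_useD(1)[OF B]])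
  next
    case (2 l x \<gamma> y)
    show ?case by (rule R2[of \<gamma> l]) (use 2 in \<open>simp only: prod_encode_inverse fst_conv snd_conv\<close>)
  next
    case (3 \<gamma> x y)
    then show ?case by (simp only: prod_encode_inverse fst_conv snd_conv R3)
  next
    case (4 l x \<gamma> \<gamma>')
    show ?case by (simp only: prod_encode_inverse fst_conv snd_conv R4[OF 4])
  qed
  then show ?case by blast
next
  case (mu f)
  then obtain \<Psi> where A: "bounded_use f \<Psi>" by blast
  \<comment> \<open>The bounded search stops when the budget is exhausted, at an approximation 0
    (not yet seen to halt), or at 1 (output 0). Only the last, found below \<open>l\<close>, counts
    as success in \<open>?H\<close>.\<close>
  let ?L = "\<lambda>\<gamma> l x. LEAST n. l \<le> n \<or> \<Psi> \<gamma> (pr l (pr x n)) \<le> 1"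
  let ?H = "\<lambda>\<gamma> z. if \<Psi> \<gamma> (pr (p1 z) (pr (p2 z) (?L \<gamma> (p1 z) (p2 z)))) = 1 \<and> ?L \<gamma> (p1 z) (p2 z) < p1 z
    then Suc (?L \<gamma> (p1 z) (p2 z)) else 0"
  let ?F = "\<lambda>\<gamma> x. if \<exists>n. f \<gamma> (pr x n) = Some 0 \<and> (\<forall>m<n. f \<gamma> (pr x m) \<noteq> None)
      then Some (LEAST n. f \<gamma> (pr x n) = Some 0) else None"
  have val: "f \<gamma> (pr x m) \<noteq> None \<and> f \<gamma> (pr x m) \<noteq> Some 0" if "m < ?L \<gamma> l x" for \<gamma> l x m
  proof -
    from not_less_Least[OF that] have "\<not> \<Psi> \<gamma> (pr l (pr x m)) \<le> 1" by blast
    then obtain y where "\<Psi> \<gamma> (pr l (pr x m)) = Suc (Suc y)"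
      by (metis One_nat_def le_Suc_eq le_zero_eq less_imp_le_nat not0_implies_Suc not_le)
    with bounded_useD(2)[OF A this] show ?thesis by simp
  qed
  have "bounded_use ?F ?H"
  proof (rule bounded_useI, goal_cases)
    case 1
    have "cf (\<lambda>\<gamma> z. ?L \<gamma> (p1 z) (p2 z))"
      by (rule cf_Least_of_bool) (intro cf_intros cf_comp[OF bounded_useD(1)[OF A]], blast)
    then show ?case by (intro cf_intros cf_comp[OF bounded_useD(1)[OF A]])
  next
    case (2 l x \<gamma> y)
    then have y: "y = ?L \<gamma> l x" "\<Psi> \<gamma> (pr l (pr x y)) = Suc 0" by (auto split: if_splits)
    from bounded_useD(2)[OF A y(2)] have f0: "f \<gamma> (pr x y) = Some 0" .
    moreover have "(LEAST n. f \<gamma> (pr x n) = Some 0) = y"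
      using f0 val[where \<gamma> = \<gamma> and l = l and x = x] y(1) by (intro Least_equality) (auto simp: not_less[symmetric])
    moreover have "\<forall>m<y. f \<gamma> (pr x m) \<noteq> None" using val[where \<gamma> = \<gamma> and l = l and x = x] y(1) by auto
    ultimately show ?case by auto
  next
    case (3 \<gamma> x y)
    then obtain n where n: "f \<gamma> (pr x n) = Some 0" "\<forall>m<n. f \<gamma> (pr x m) \<noteq> None"
      and y: "y = (LEAST n. f \<gamma> (pr x n) = Some 0)" by (auto split: if_splits)
    have fy: "f \<gamma> (pr x y) = Some 0" unfolding y by (rule LeastI, rule n)
    have lt: "m < y \<Longrightarrow> f \<gamma> (pr x m) \<noteq> Some 0" for m unfolding y by (rule not_less_Least)
    have "y \<le> n" unfolding y by (rule Least_le, rule n)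
    with n have def: "m < y \<Longrightarrow> f \<gamma> (pr x m) \<noteq> None" for m by auto
    have "\<forall>m\<in>{..y}. \<exists>L. \<forall>l\<ge>L. \<Psi> \<gamma> (pr l (pr x m)) = Suc (the (f \<gamma> (pr x m)))"
    proof
      fix m assume "m \<in> {..y}"
      then have "f \<gamma> (pr x m) = Some (the (f \<gamma> (pr x m)))" using def fy by (cases "m = y") auto
      from bounded_useD(3)[OF A this] show "\<exists>L. \<forall>l\<ge>L. \<Psi> \<gamma> (pr l (pr x m)) = Suc (the (f \<gamma> (pr x m)))" .
    qed
    then obtain L where L: "\<And>m l. m \<le> y \<Longrightarrow> l \<ge> L m \<Longrightarrow> \<Psi> \<gamma> (pr l (pr x m)) = Suc (the (f \<gamma> (pr x m)))"
      unfolding bchoice_iff by auto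
    \<comment> \<open>The sum exceeds the budget of each of the finitely many calls up to
      \<open>y\<close>, and \<open>Suc y\<close> keeps the search from running out before
      \<open>y\<close>.\<close>
    have "?H \<gamma> (pr l x) = Suc y" if l: "l \<ge> Suc y + (\<Sum>m\<le>y. L m)" for l
    proof -
      have LL: "m \<le> y \<Longrightarrow> L m \<le> l" for m
        using member_le_sum[of m "{..y}" L] l by simp
      have "?L \<gamma> l x = y"
      proof (rule Least_equality)
        show "l \<le> y \<or> \<Psi> \<gamma> (pr l (pr x y)) \<le> 1" using L[of y l] LL fy by simp
        fix m assume m: "l \<le> m \<or> \<Psi> \<gamma> (pr l (pr x m)) \<le> 1"
        show "y \<le> m"
        proof (rule ccontr)
          assume "\<not> y \<le> m"
          then have "m < y" by simp
          with m l L[of m l] LL have "the (f \<gamma> (pr x m)) = 0" by auto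
          with lt[OF \<open>m < y\<close>] def[OF \<open>m < y\<close>] show False by auto
        qed
      qed
      then show ?thesis using L[of y l] LL fy l by simp
    qed
    then show ?case by blast
  next
    case (4 l x \<gamma> \<gamma>')
    show ?case
      by (simp only: bounded_useD(4)[OF A 4] prod_encode_inverse fst_conv snd_conv)
  qed
  then show ?case by blast
qed

section \<open>The uniform measure on sequences of rows\<close>

abbreviation U :: "cantor_seq measure" where "U \<equiv> uniform_seq_measure"

lemma space_cantor_measure [simp]: "space cantor_measure = UNIV"
  by (simp add: cantor_measure_def space_PiM)

lemma space_U [simp]: "space U = UNIV"
  by (simp add: uniform_seq_measure_def space_PiM)

lemma prob_space_cantor_measure: "prob_space cantor_measure"
  unfolding cantor_measure_def by (intro prob_space_PiM measure_pmf.prob_space_axioms)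

lemma prob_space_U: "prob_space U"
  unfolding uniform_seq_measure_def by (intro prob_space_PiM prob_space_cantor_measure)

interpretation U: prob_space U by (rule prob_space_U)

lemma measurable_bit [measurable]: "(\<lambda>\<omega>. \<omega> m i) \<in> U \<rightarrow>\<^sub>M count_space UNIV"
proof -
  have 1: "(\<lambda>\<omega>. \<omega> m) \<in> U \<rightarrow>\<^sub>M cantor_measure"
    unfolding uniform_seq_measure_def by (intro measurable_component_singleton) simp
  have "(\<lambda>\<alpha>. \<alpha> i) \<in> cantor_measure \<rightarrow>\<^sub>M measure_pmf (bernoulli_pmf (1 / 2))"
    unfolding cantor_measure_def by (intro measurable_component_singleton) simp
  then have 2: "(\<lambda>\<alpha>. \<alpha> i) \<in> cantor_measure \<rightarrow>\<^sub>M count_space UNIV"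
    by (simp cong: measurable_cong_sets)
  show ?thesis using measurable_compose[OF 1 2] .
qed

text \<open>The product measure is determined by its values on finite cylinders, and the preimage of
  a cylinder is the cylinder of the preimages.\<close>

lemma distr_PiM_componentwise:
  fixes M :: "'i \<Rightarrow> 'a measure"
  assumes M: "\<And>i. prob_space (M i)"
    and f: "\<And>i. f i \<in> M i \<rightarrow>\<^sub>M M i" "\<And>i. distr (M i) (M i) (f i) = M i"
  shows "distr (PiM UNIV M) (PiM UNIV M) (\<lambda>\<omega> i. f i (\<omega> i)) = PiM UNIV M"
proof -
  interpret product_prob_space M UNIV
    by (simp add: product_prob_space_def product_prob_space_axioms_def product_sigma_finite_def
      M prob_space_imp_sigma_finite)
  have meas: "(\<lambda>\<omega> i. f i (\<omega> i)) \<in> PiM UNIV M \<rightarrow>\<^sub>M PiM UNIV M"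
    by (intro measurable_PiM_single' measurable_compose[OF measurable_component_singleton[of _ UNIV M] f(1)])
      (auto simp: space_PiM PiE_iff intro: measurable_space[OF f(1)])
  show ?thesis
  proof (rule PiM_eq)
    fix J F assume J: "finite J" "J \<subseteq> UNIV" "\<And>j. j \<in> J \<Longrightarrow> F j \<in> sets (M j)"
    let ?G = "\<lambda>j. f j -` F j \<inter> space (M j)"
    have G: "?G j \<in> sets (M j)" if "j \<in> J" for j using J(3)[OF that] f(1) by (rule measurable_sets[rotated])
    have "emeasure (distr (PiM UNIV M) (PiM UNIV M) (\<lambda>\<omega> i. f i (\<omega> i))) (prod_emb UNIV M J (Pi\<^sub>E J F))
      = emeasure (PiM UNIV M) ((\<lambda>\<omega> i. f i (\<omega> i)) -` prod_emb UNIV M J (Pi\<^sub>E J F) \<inter> space (PiM UNIV M))"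
      using J by (intro emeasure_distr meas sets_PiM_I) auto
    also have "(\<lambda>\<omega> i. f i (\<omega> i)) -` prod_emb UNIV M J (Pi\<^sub>E J F) \<inter> space (PiM UNIV M)
      = prod_emb UNIV M J (Pi\<^sub>E J ?G)"
      by (auto simp: prod_emb_def space_PiM PiE_iff restrict_def extensional_def
        intro: measurable_space[OF f(1)] split: if_splits)
    also have "emeasure (PiM UNIV M) \<dots> = (\<Prod>j\<in>J. emeasure (M j) (?G j))"
      using J G by (intro emeasure_PiM_emb) auto
    also have "\<dots> = (\<Prod>j\<in>J. emeasure (M j) (F j))"
    proof (rule prod.cong[OF refl])
      fix j assume j: "j \<in> J"
      show "emeasure (M j) (?G j) = emeasure (M j) (F j)"
        using emeasure_distr[OF f(1) J(3)[OF j]] f(2)[of j] by simp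
    qed
    finally show "emeasure (distr (PiM UNIV M) (PiM UNIV M) (\<lambda>\<omega> i. f i (\<omega> i))) (prod_emb UNIV M J (Pi\<^sub>E J F))
      = (\<Prod>j\<in>J. emeasure (M j) (F j))" .
  qed simp
qed

section \<open>Flipping and fixing bits\<close>

definition flip_at :: "nat \<Rightarrow> nat \<Rightarrow> cantor_seq \<Rightarrow> cantor_seq" where
  "flip_at m i \<omega> = (\<lambda>m' i'. if m' = m \<and> i' = i then \<not> \<omega> m' i' else \<omega> m' i')"

definition set_at :: "nat \<Rightarrow> nat \<Rightarrow> bool \<Rightarrow> cantor_seq \<Rightarrow> cantor_seq" where
  "set_at m i b \<omega> = (\<lambda>m' i'. if m' = m \<and> i' = i then b else \<omega> m' i')"

text \<open>This symmetry yields both the density of sets of full measure and the averaging identity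
  over one bit. The componentwise lemma is applied once within a row and once across the
  rows.\<close>

lemma distr_flip_at: "distr U U (flip_at m i) = U" and measurable_flip_at: "flip_at m i \<in> U \<rightarrow>\<^sub>M U"
proof -
  let ?B = "measure_pmf (bernoulli_pmf (1 / 2))"
  have pmf: "map_pmf Not (bernoulli_pmf (1 / 2)) = bernoulli_pmf (1 / 2)"
  proof (rule pmf_eqI)
    fix b
    have "pmf (map_pmf Not (bernoulli_pmf (1 / 2))) (\<not> \<not> b) = pmf (bernoulli_pmf (1 / 2)) (\<not> b)"
      by (rule pmf_map_inj') (auto simp: inj_def)
    then show "pmf (map_pmf Not (bernoulli_pmf (1 / 2))) b = pmf (bernoulli_pmf (1 / 2)) b"
      by (cases b) simp_all
  qed
  have "distr ?B ?B Not = distr ?B (count_space UNIV) Not" by (intro distr_cong) auto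
  also have "\<dots> = ?B" using pmf map_pmf_rep_eq[of Not "bernoulli_pmf (1 / 2)"] by simp
  finally have B: "distr ?B ?B Not = ?B" .
  let ?f = "\<lambda>i' b. if i' = i then \<not> b else b"
  have fi: "distr ?B ?B (?f i') = ?B" for i'
    using B by (cases "i' = i") (simp_all add: distr_id2)
  have C: "distr cantor_measure cantor_measure (\<lambda>\<alpha> i'. ?f i' (\<alpha> i')) = cantor_measure"
    unfolding cantor_measure_def
    by (rule distr_PiM_componentwise[of "\<lambda>_. ?B" ?f, OF measure_pmf.prob_space_axioms])
      (simp_all only: fi, simp)
  have Cm: "(\<lambda>\<alpha> i'. ?f i' (\<alpha> i')) \<in> cantor_measure \<rightarrow>\<^sub>M cantor_measure"
    unfolding cantor_measure_def
    by (intro measurable_PiM_single' measurable_compose[OF measurable_component_singleton[of _ _ "\<lambda>_. ?B"]])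
      (auto simp: space_PiM)
  let ?g = "\<lambda>m' \<alpha>. if m' = m then (\<lambda>i'. ?f i' (\<alpha> i')) else \<alpha>"
  have gm: "?g m' \<in> cantor_measure \<rightarrow>\<^sub>M cantor_measure" for m'
    using Cm by (cases "m' = m") simp_all
  have gd: "distr cantor_measure cantor_measure (?g m') = cantor_measure" for m'
    using C by (cases "m' = m") (simp_all add: distr_id2)
  have eq: "flip_at m i = (\<lambda>\<omega> m'. ?g m' (\<omega> m'))"
    by (auto simp: flip_at_def fun_eq_iff)
  show "distr U U (flip_at m i) = U"
    unfolding eq uniform_seq_measure_def
    by (rule distr_PiM_componentwise[of "\<lambda>_. cantor_measure" ?g, OF prob_space_cantor_measure gm gd])
  show "flip_at m i \<in> U \<rightarrow>\<^sub>M U"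
    unfolding eq uniform_seq_measure_def
    by (intro measurable_PiM_single' measurable_compose[OF measurable_component_singleton[of _ _ "\<lambda>_. cantor_measure"] gm])
      (auto simp: space_PiM)
qed

text \<open>Setting a bit either changes nothing or flips it, and flipping preserves null
  sets.\<close>

lemma AE_set_bit:
  assumes "AE \<omega> in U. P \<omega>" shows "AE \<omega> in U. P (set_at m i b \<omega>)"
proof -
  have "AE \<omega> in distr U U (flip_at m i). P \<omega>" using assms by (subst distr_flip_at)
  then have "AE \<omega> in U. P (flip_at m i \<omega>)" by (rule AE_distrD[OF measurable_flip_at])
  with assms show ?thesis
  proof eventually_elim
    case (elim \<omega>)
    have "set_at m i b \<omega> = \<omega> \<or> set_at m i b \<omega> = flip_at m i \<omega>"
      by (auto simp: set_at_def flip_at_def fun_eq_iff)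
    with elim show ?case by auto
  qed
qed

lemma AE_set_bits:
  assumes "finite S" "AE \<omega> in U. P \<omega>"
  shows "AE \<omega> in U. P (\<lambda>m i. if (m, i) \<in> S then \<tau> m i else \<omega> m i)"
  using assms
proof (induction S)
  case (insert x S)
  obtain a b where x: "x = (a, b)" by (cases x)
  from AE_set_bit[OF insert.IH[OF insert.prems], of a b "\<tau> a b"]
  show ?case
  proof eventually_elim
    case (elim \<omega>)
    have "(\<lambda>m i. if (m, i) \<in> S then \<tau> m i else set_at a b (\<tau> a b) \<omega> m i) =
      (\<lambda>m i. if (m, i) \<in> insert x S then \<tau> m i else \<omega> m i)"
      by (auto simp: fun_eq_iff set_at_def x)
    with elim show ?case by simp
  qed
qed simp

section \<open>Cylinders, uniform continuity and conditional expectation\<close>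

definition agree2 :: "nat \<Rightarrow> cantor_seq \<Rightarrow> cantor_seq \<Rightarrow> bool" where
  "agree2 l \<omega> \<omega>' \<longleftrightarrow> (\<forall>i<l. \<forall>j<l. \<omega> i j = \<omega>' i j)"

lemma agree2_mono: "agree2 l \<omega> \<omega>' \<Longrightarrow> k \<le> l \<Longrightarrow> agree2 k \<omega> \<omega>'"
  by (auto simp: agree2_def)

text \<open>Sets of full measure are dense: impose finitely many bits of \<tau> on almost every
  point.\<close>

lemma AE_imp_agree2:
  assumes "AE \<omega> in U. P \<omega>" shows "\<exists>\<omega>. P \<omega> \<and> agree2 l \<omega> \<tau>"
proof -
  from AE_set_bits[OF _ assms, of "{..<l} \<times> {..<l}" \<tau>]
  have "AE \<omega> in U. P (\<lambda>m i. if (m, i) \<in> {..<l} \<times> {..<l} then \<tau> m i else \<omega> m i)" by simp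
  then obtain \<omega> where "P (\<lambda>m i. if (m, i) \<in> {..<l} \<times> {..<l} then \<tau> m i else \<omega> m i)"
    using eventually_happens'[OF U.ae_filter_bot] by blast
  then show ?thesis by (rule_tac exI, rule_tac conjI, assumption) (simp add: agree2_def)
qed

text \<open>Uniform continuity on Cantor space, with squares of bits as basic neighbourhoods.
  Compactness provides it for computable functions, and boundedness, measurability and integrability
  all follow from it.\<close>

definition ucont :: "(cantor_seq \<Rightarrow> real) \<Rightarrow> bool" where
  "ucont f \<longleftrightarrow> (\<forall>e>0. \<exists>l. \<forall>\<omega> \<omega>'. agree2 l \<omega> \<omega>' \<longrightarrow> \<bar>f \<omega> - f \<omega>'\<bar> \<le> e)"

lemma ucontD: "ucont f \<Longrightarrow> 0 < e \<Longrightarrow> \<exists>l. \<forall>\<omega> \<omega>'. agree2 l \<omega> \<omega>' \<longrightarrow> \<bar>f \<omega> - f \<omega>'\<bar> \<le> e"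
  by (auto simp: ucont_def)

lemma ucont_const: "ucont (\<lambda>_. c)" by (auto simp: ucont_def)

lemma ucont_add: assumes "ucont f" "ucont g" shows "ucont (\<lambda>\<omega>. f \<omega> + g \<omega>)"
  unfolding ucont_def
proof (intro allI impI)
  fix e :: real assume "0 < e"
  then obtain k l where k: "\<And>\<omega> \<omega>'. agree2 k \<omega> \<omega>' \<Longrightarrow> \<bar>f \<omega> - f \<omega>'\<bar> \<le> e / 2"
    and l: "\<And>\<omega> \<omega>'. agree2 l \<omega> \<omega>' \<Longrightarrow> \<bar>g \<omega> - g \<omega>'\<bar> \<le> e / 2"
    using ucontD[OF assms(1), of "e / 2"] ucontD[OF assms(2), of "e / 2"] by auto
  show "\<exists>l. \<forall>\<omega> \<omega>'. agree2 l \<omega> \<omega>' \<longrightarrow> \<bar>f \<omega> + g \<omega> - (f \<omega>' + g \<omega>')\<bar> \<le> e"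
  proof (intro exI[of _ "max k l"] allI impI)
    fix \<omega> \<omega>' assume "agree2 (max k l) \<omega> \<omega>'"
    then have "agree2 k \<omega> \<omega>'" "agree2 l \<omega> \<omega>'" by (auto elim: agree2_mono)
    from k[OF this(1)] l[OF this(2)] show "\<bar>f \<omega> + g \<omega> - (f \<omega>' + g \<omega>')\<bar> \<le> e" by linarith
  qed
qed

text \<open>The factor \<open>s\<close> is locally constant, so continuity needs only that it is bounded.\<close>

lemma ucont_mult:
  assumes "\<And>\<omega> \<omega>'. agree2 k \<omega> \<omega>' \<Longrightarrow> s \<omega> = s \<omega>'" "\<And>\<omega>. \<bar>s \<omega>\<bar> \<le> c" "ucont f"
  shows "ucont (\<lambda>\<omega>. s \<omega> * f \<omega>)"
  unfolding ucont_def
proof (intro allI impI)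
  fix e :: real assume e: "0 < e"
  have c: "0 \<le> c" using assms(2)[of undefined] by linarith
  then have "0 < e / (c + 1)" using e by auto
  then obtain l where l: "\<And>\<omega> \<omega>'. agree2 l \<omega> \<omega>' \<Longrightarrow> \<bar>f \<omega> - f \<omega>'\<bar> \<le> e / (c + 1)"
    using ucontD[OF assms(3)] by blast
  show "\<exists>l. \<forall>\<omega> \<omega>'. agree2 l \<omega> \<omega>' \<longrightarrow> \<bar>s \<omega> * f \<omega> - s \<omega>' * f \<omega>'\<bar> \<le> e"
  proof (intro exI[of _ "max k l"] allI impI)
    fix \<omega> \<omega>' assume "agree2 (max k l) \<omega> \<omega>'"
    then have *: "agree2 k \<omega> \<omega>'" "agree2 l \<omega> \<omega>'" by (auto elim: agree2_mono)
    have "\<bar>s \<omega> * f \<omega> - s \<omega>' * f \<omega>'\<bar> = \<bar>s \<omega>\<bar> * \<bar>f \<omega> - f \<omega>'\<bar>"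
      using assms(1)[OF *(1)] by (simp add: abs_mult flip: right_diff_distrib)
    also have "\<dots> \<le> c * (e / (c + 1))" using assms(2) l[OF *(2)] c by (intro mult_mono) auto
    also have "\<dots> \<le> e" using c e by (simp add: field_simps)
    finally show "\<bar>s \<omega> * f \<omega> - s \<omega>' * f \<omega>'\<bar> \<le> e" .
  qed
qed

lemma ucont_cmult: "ucont f \<Longrightarrow> ucont (\<lambda>\<omega>. c * f \<omega>)"
  by (rule ucont_mult[where k = 0 and s = "\<lambda>_. c" and c = "\<bar>c\<bar>"]) auto

lemma ucont_diff: "ucont f \<Longrightarrow> ucont g \<Longrightarrow> ucont (\<lambda>\<omega>. f \<omega> - g \<omega>)"
  using ucont_add[of f "\<lambda>\<omega>. (-1) * g \<omega>"] ucont_cmult[of g "-1"] by simp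

lemma ucont_sum: "(\<And>i. i \<in> I \<Longrightarrow> ucont (f i)) \<Longrightarrow> ucont (\<lambda>\<omega>. \<Sum>i\<in>I. f i \<omega>)"
  by (induction I rule: infinite_finite_induct) (auto intro: ucont_add ucont_const)

lemma ucont_compose:
  assumes "ucont f" "\<And>l \<omega> \<omega>'. agree2 l \<omega> \<omega>' \<Longrightarrow> agree2 l (h \<omega>) (h \<omega>')"
  shows "ucont (\<lambda>\<omega>. f (h \<omega>))"
  using assms unfolding ucont_def by meson

lemma agree2_splice: "agree2 l \<omega> \<omega>' \<Longrightarrow> agree2 l \<xi> \<xi>' \<Longrightarrow> agree2 l (splice n \<omega> \<xi>) (splice n \<omega>' \<xi>')"
  by (auto simp: agree2_def splice_def)

lemma agree2_refl [simp]: "agree2 l \<omega> \<omega>" by (simp add: agree2_def)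

lemma ucont_splice: "ucont f \<Longrightarrow> ucont (\<lambda>\<xi>. f (splice n \<omega> \<xi>))"
  by (rule ucont_compose) (auto intro: agree2_splice)

text \<open>Selects one point of each cylinder of side \<open>l\<close>. Its finitely many values
  give approximations by simple functions, and its rows are eventually zero, which the
  diagonalization exploits.\<close>

definition trunc :: "nat \<Rightarrow> cantor_seq \<Rightarrow> cantor_seq" where
  "trunc l \<omega> = (\<lambda>i j. i < l \<and> j < l \<and> \<omega> i j)"

lemma agree2_trunc: "agree2 l \<omega> (trunc l \<omega>)" by (simp add: agree2_def trunc_def)

lemma finite_range_trunc: "finite (range (trunc l))"
proof (rule finite_subset)
  show "range (trunc l) \<subseteq> (\<lambda>S i j. (i, j) \<in> S) ` Pow ({..<l} \<times> {..<l})"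
  proof
    fix \<omega> assume "\<omega> \<in> range (trunc l)"
    then obtain \<xi> where "\<omega> = trunc l \<xi>" by blast
    then show "\<omega> \<in> (\<lambda>S i j. (i, j) \<in> S) ` Pow ({..<l} \<times> {..<l})"
      by (intro image_eqI[of _ _ "{(i, j). i < l \<and> j < l \<and> \<xi> i j}"]) (auto simp: trunc_def fun_eq_iff)
  qed
qed simp

lemma measurable_trunc: "trunc l \<in> U \<rightarrow>\<^sub>M count_space (range (trunc l))"
proof (subst measurable_count_space_eq2[OF finite_range_trunc], intro conjI ballI)
  fix \<tau> assume "\<tau> \<in> range (trunc l)"
  then have "trunc l -` {\<tau>} \<inter> space U = {\<omega> \<in> space U. \<forall>i\<in>{..<l}. \<forall>j\<in>{..<l}. \<omega> i j = \<tau> i j}"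
    by (auto simp: trunc_def fun_eq_iff) blast+
  also have "\<dots> \<in> sets U" by measurable
  finally show "trunc l -` {\<tau>} \<inter> space U \<in> sets U" .
qed auto

lemma ucont_bounded:
  assumes "ucont f" shows "\<exists>B. \<forall>\<omega>. \<bar>f \<omega>\<bar> \<le> B"
proof -
  obtain l where l: "\<And>\<omega> \<omega>'. agree2 l \<omega> \<omega>' \<Longrightarrow> \<bar>f \<omega> - f \<omega>'\<bar> \<le> 1" using ucontD[OF assms, of 1] by auto
  have "\<bar>f \<omega>\<bar> \<le> Max ((\<lambda>\<tau>. \<bar>f \<tau>\<bar>) ` range (trunc l)) + 1" for \<omega>
  proof -
    have "\<bar>f (trunc l \<omega>)\<bar> \<le> Max ((\<lambda>\<tau>. \<bar>f \<tau>\<bar>) ` range (trunc l))"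
      by (intro Max_ge finite_imageI finite_range_trunc) auto
    with l[OF agree2_trunc, of \<omega>] show ?thesis by linarith
  qed
  then show ?thesis by blast
qed

lemma ucont_measurable: assumes "ucont f" shows "f \<in> borel_measurable U"
proof (rule borel_measurable_LIMSEQ_real)
  fix \<omega>
  show "(\<lambda>l. f (trunc l \<omega>)) \<longlonglongrightarrow> f \<omega>"
  proof (rule LIMSEQ_I)
    fix r :: real assume "0 < r"
    then obtain k where k: "\<And>\<omega> \<omega>'. agree2 k \<omega> \<omega>' \<Longrightarrow> \<bar>f \<omega> - f \<omega>'\<bar> \<le> r / 2"
      using ucontD[OF assms, of "r / 2"] by auto
    have "\<bar>f \<omega> - f (trunc l \<omega>)\<bar> \<le> r / 2" if "l \<ge> k" for l
      using k[OF agree2_mono[OF agree2_trunc that]] .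
    then show "\<exists>no. \<forall>n\<ge>no. norm (f (trunc n \<omega>) - f \<omega>) < r"
      using \<open>0 < r\<close> by (intro exI[of _ k]) (force simp: abs_minus_commute)
  qed
next
  fix l show "(\<lambda>\<omega>. f (trunc l \<omega>)) \<in> borel_measurable U"
    by (rule measurable_compose[OF measurable_trunc]) simp
qed

lemma ucont_integrable: assumes "ucont f" shows "integrable U f"
proof -
  obtain B where "\<And>\<omega>. \<bar>f \<omega>\<bar> \<le> B" using ucont_bounded[OF assms] by blast
  then show ?thesis using ucont_measurable[OF assms] by (intro U.integrable_const_bound[of _ B]) auto
qed

lemma integral_le: "ucont f \<Longrightarrow> (\<And>\<omega>. f \<omega> \<le> c) \<Longrightarrow> (\<integral>\<omega>. f \<omega> \<partial>U) \<le> c"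
  using integral_mono[OF ucont_integrable, of f "\<lambda>_. c"] U.prob_space by simp

lemma integral_ge: "ucont f \<Longrightarrow> (\<And>\<omega>. c \<le> f \<omega>) \<Longrightarrow> c \<le> (\<integral>\<omega>. f \<omega> \<partial>U)"
  using integral_mono[OF _ ucont_integrable, of "\<lambda>_. c" f] U.prob_space by simp

text \<open>The values at a point and at its flip are, in some order, the values with the bit set to
  either side; flipping preserves the integral.\<close>

lemma integral_split_bit:
  assumes "ucont f"
  shows "(\<integral>\<omega>. f \<omega> \<partial>U) = ((\<integral>\<omega>. f (set_at m i False \<omega>) \<partial>U) + (\<integral>\<omega>. f (set_at m i True \<omega>) \<partial>U)) / 2"
proof -
  have int: "integrable U (\<lambda>\<omega>. f (set_at m i b \<omega>))" for b
    by (intro ucont_integrable ucont_compose[OF assms]) (auto simp: agree2_def set_at_def)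
  have int': "integrable U (\<lambda>\<omega>. f (flip_at m i \<omega>))"
    by (intro ucont_integrable ucont_compose[OF assms]) (auto simp: agree2_def flip_at_def)
  have "(\<integral>\<omega>. f \<omega> \<partial>U) = (\<integral>\<omega>. f \<omega> \<partial>distr U U (flip_at m i))" by (simp add: distr_flip_at)
  also have "\<dots> = (\<integral>\<omega>. f (flip_at m i \<omega>) \<partial>U)"
    by (rule integral_distr[OF measurable_flip_at ucont_measurable[OF assms]])
  finally have "2 * (\<integral>\<omega>. f \<omega> \<partial>U) = (\<integral>\<omega>. f \<omega> + f (flip_at m i \<omega>) \<partial>U)"
    using int' ucont_integrable[OF assms] by simp
  also have "(\<lambda>\<omega>. f \<omega> + f (flip_at m i \<omega>)) = (\<lambda>\<omega>. f (set_at m i False \<omega>) + f (set_at m i True \<omega>))"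
  proof
    fix \<omega>
    have "set_at m i (\<omega> m i) \<omega> = \<omega>" "set_at m i (\<not> \<omega> m i) \<omega> = flip_at m i \<omega>"
      by (auto simp: set_at_def flip_at_def fun_eq_iff)
    then show "f \<omega> + f (flip_at m i \<omega>) = f (set_at m i False \<omega>) + f (set_at m i True \<omega>)"
      by (cases "\<omega> m i") auto
  qed
  also have "(\<integral>\<omega>. f (set_at m i False \<omega>) + f (set_at m i True \<omega>) \<partial>U) =
    (\<integral>\<omega>. f (set_at m i False \<omega>) \<partial>U) + (\<integral>\<omega>. f (set_at m i True \<omega>) \<partial>U)"
    using int by simp
  finally show ?thesis by simp
qed

text \<open>\<open>splice\<close> is \<open>comb_seq\<close>, which maps the product of two copies
  of the measure to the measure itself; the rest is Fubini.\<close>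

lemma integral_cond_expect:
  assumes "ucont f" shows "(\<integral>\<xi>. cond_expect n f \<xi> \<partial>U) = (\<integral>\<xi>. f \<xi> \<partial>U)"
proof -
  interpret sequence_space cantor_measure
    by (simp add: sequence_space_def product_prob_space_def product_prob_space_axioms_def
      product_sigma_finite_def prob_space_cantor_measure prob_space_imp_sigma_finite)
  interpret P: pair_prob_space U U ..
  have U: "U = PiM UNIV (\<lambda>_. cantor_measure)" by (simp add: uniform_seq_measure_def)
  have spl: "(\<lambda>(\<omega>, \<omega>'). splice n \<omega> \<omega>') = (\<lambda>(\<omega>, \<omega>'). comb_seq n \<omega> \<omega>')"
    by (auto simp: fun_eq_iff splice_def comb_seq_def)
  have m: "(\<lambda>(\<omega>, \<omega>'). splice n \<omega> \<omega>') \<in> U \<Otimes>\<^sub>M U \<rightarrow>\<^sub>M U"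
    unfolding spl U by (rule measurable_comb_seq)
  have d: "distr (U \<Otimes>\<^sub>M U) U (\<lambda>(\<omega>, \<omega>'). splice n \<omega> \<omega>') = U"
    unfolding spl U by (rule PiM_comb_seq)
  have "integrable (distr (U \<Otimes>\<^sub>M U) U (\<lambda>(\<omega>, \<omega>'). splice n \<omega> \<omega>')) f"
    using ucont_integrable[OF assms] by (simp add: d)
  then have "integrable (U \<Otimes>\<^sub>M U) (\<lambda>x. f ((\<lambda>(\<omega>, \<omega>'). splice n \<omega> \<omega>') x))"
    by (rule integrable_distr[OF m])
  then have int: "integrable (U \<Otimes>\<^sub>M U) (\<lambda>(\<omega>, \<omega>'). f (splice n \<omega> \<omega>'))"
    by (simp add: case_prod_beta')
  have "(\<integral>\<xi>. f \<xi> \<partial>U) = (\<integral>\<xi>. f \<xi> \<partial>distr (U \<Otimes>\<^sub>M U) U (\<lambda>(\<omega>, \<omega>'). splice n \<omega> \<omega>'))"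
    by (simp add: d)
  also have "\<dots> = (\<integral>x. f ((\<lambda>(\<omega>, \<omega>'). splice n \<omega> \<omega>') x) \<partial>(U \<Otimes>\<^sub>M U))"
    by (rule integral_distr[OF m ucont_measurable[OF assms]])
  also have "\<dots> = (\<integral>\<omega>. (\<integral>\<omega>'. f (splice n \<omega> \<omega>') \<partial>U) \<partial>U)"
    using P.integral_fst'[OF int[unfolded case_prod_beta']] by (simp add: case_prod_beta')
  finally show ?thesis by (simp add: cond_expect_def)
qed

text \<open>Both sides are continuous, and the points where they agree are dense.\<close>

lemma cond_expect_everywhere:
  assumes "ucont f" "ucont g" "AE \<omega> in U. cond_expect n f \<omega> = g \<omega>"
  shows "cond_expect n f \<omega> = g \<omega>"
proof -
  have "\<bar>cond_expect n f \<omega> - g \<omega>\<bar> \<le> e" if "0 < e" for e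
  proof -
    obtain k l where k: "\<And>\<omega> \<omega>'. agree2 k \<omega> \<omega>' \<Longrightarrow> \<bar>f \<omega> - f \<omega>'\<bar> \<le> e / 2"
      and l: "\<And>\<omega> \<omega>'. agree2 l \<omega> \<omega>' \<Longrightarrow> \<bar>g \<omega> - g \<omega>'\<bar> \<le> e / 2"
      using ucontD[OF assms(1), of "e / 2"] ucontD[OF assms(2), of "e / 2"] \<open>0 < e\<close> by auto
    obtain \<tau> where \<tau>: "cond_expect n f \<tau> = g \<tau>" "agree2 (max k l) \<tau> \<omega>"
      using AE_imp_agree2[OF assms(3)] by blast
    have u: "ucont (\<lambda>\<xi>. f (splice n \<tau> \<xi>) - f (splice n \<omega> \<xi>))"
      by (intro ucont_diff ucont_splice assms)
    have pt: "\<bar>f (splice n \<tau> \<xi>) - f (splice n \<omega> \<xi>)\<bar> \<le> e / 2" for \<xi>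
      using \<tau>(2) by (intro k agree2_splice) (auto elim: agree2_mono)
    have "cond_expect n f \<tau> - cond_expect n f \<omega> = (\<integral>\<xi>. f (splice n \<tau> \<xi>) - f (splice n \<omega> \<xi>) \<partial>U)"
      unfolding cond_expect_def
      by (intro Bochner_Integration.integral_diff[symmetric] ucont_integrable ucont_splice assms)
    moreover have "\<dots> \<le> e / 2" 
      by (rule integral_le[OF u], rule abs_le_D1, rule pt)
    moreover have "- (e / 2) \<le> (\<integral>\<xi>. f (splice n \<tau> \<xi>) - f (splice n \<omega> \<xi>) \<partial>U)"
      by (rule integral_ge[OF u]) (use abs_le_D2[OF pt] in \<open>simp only: minus_le_iff\<close>)
    moreover have "\<bar>g \<tau> - g \<omega>\<bar> \<le> e / 2" by (rule l) (use \<tau>(2) in \<open>auto elim: agree2_mono\<close>)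
    ultimately show ?thesis using \<tau>(1) by linarith
  qed
  then show ?thesis using zero_less_abs_iff by (metis dense eq_iff_diff_eq_0 not_le)
qed

section \<open>Compactness and approximable reals\<close>

text \<open>Packs a fixed oracle and a varying argument into one oracle: compactness is applied in
  \<alpha> alone, while moduli remain computable from \<gamma>.\<close>

definition combine :: "cantor \<Rightarrow> cantor \<Rightarrow> cantor" where
  "combine \<gamma> \<alpha> = (\<lambda>i. if even i then \<gamma> (i div 2) else \<alpha> (i div 2))"

definition overwrite :: "bool list \<Rightarrow> cantor \<Rightarrow> cantor" where
  "overwrite \<sigma> \<alpha> = (\<lambda>i. if i < length \<sigma> then \<sigma> ! i else \<alpha> i)"

definition bits :: "nat \<Rightarrow> cantor" where
  "bits t = (\<lambda>i. odd (t div 2 ^ i))"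

definition bit_list :: "nat \<Rightarrow> nat \<Rightarrow> bool list" where
  "bit_list l t = map (bits t) [0..<l]"

lemma agree_combine: "agree l \<alpha> \<beta> \<Longrightarrow> agree (2 * l) (combine \<gamma> \<alpha>) (combine \<gamma> \<beta>)"
  by (auto simp: agree_def combine_def)

lemma agree_overwrite: "agree l \<alpha> \<beta> \<Longrightarrow> agree l (overwrite \<sigma> \<alpha>) (overwrite \<sigma> \<beta>)"
  by (auto simp: agree_def overwrite_def)

text \<open>A position below \<open>l\<close> of the join lies in the square of side
  \<open>l\<close>, because the pairing function dominates both components.\<close>

lemma agree_join: assumes "agree2 l \<omega> \<omega>'" shows "agree l (join \<omega>) (join \<omega>')"
proof -
  have "join \<omega> k = join \<omega>' k" if "k < l" for k
  proof (cases "prod_decode k")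
    case (Pair a b)
    then have "k = pr a b" by (metis prod_decode_inverse)
    then have "a < l" "b < l" using that le_prod_encode_1[of a b] le_prod_encode_2[of b a] by auto
    then show ?thesis using assms Pair by (simp add: join_def agree2_def)
  qed
  then show ?thesis by (simp add: agree_def)
qed

lemma exists_bits_agree: "\<exists>t<2 ^ l. agree l (bits t) \<alpha>"
proof -
  let ?t = "take_bit l (horner_sum of_bool 2 (map \<alpha> [0..<l])) :: nat"
  have "bits ?t i = bit ?t i" for i by (simp add: bits_def bit_iff_odd)
  then have "agree l (bits ?t) \<alpha>"
    by (auto simp: agree_def bit_take_bit_iff bit_horner_sum_bit_iff)
  then show ?thesis by (intro exI[of _ ?t]) (auto simp: take_bit_nat_less_exp)
qed

text \<open>Koenig's lemma. If no \<open>l\<close> served a whole cylinder, the same would hold for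
  one of its two halves; along the resulting path some \<open>Q \<alpha> l\<close> holds, and by
  locality it serves the cylinder of the first \<open>l\<close> bits.\<close>

lemma cantor_compact:
  assumes ex: "\<And>\<alpha>. \<exists>l. Q \<alpha> l"
    and loc: "\<And>\<alpha> \<beta> l. agree l \<alpha> \<beta> \<Longrightarrow> Q \<alpha> l \<Longrightarrow> Q \<beta> l"
    and mono: "\<And>\<alpha> l k. Q \<alpha> l \<Longrightarrow> l \<le> k \<Longrightarrow> Q \<alpha> k"
  shows "\<exists>l. \<forall>\<alpha>. Q \<alpha> l"
proof (rule ccontr)
  assume contr: "\<not> ?thesis"
  define bad where "bad \<sigma> \<longleftrightarrow> (\<forall>l. \<exists>\<alpha>. \<not> Q (overwrite \<sigma> \<alpha>) l)" for \<sigma>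
  have bad0: "bad []" using contr by (simp add: bad_def overwrite_def)
  have step: "\<exists>b. bad (\<sigma> @ [b])" if "bad \<sigma>" for \<sigma>
  proof (rule ccontr)
    assume "\<nexists>b. bad (\<sigma> @ [b])"
    then obtain L where L: "\<And>b \<alpha>. Q (overwrite (\<sigma> @ [b]) \<alpha>) (L b)" unfolding bad_def by metis
    have "Q (overwrite \<sigma> \<alpha>) (max (L True) (L False))" for \<alpha>
    proof -
      have "overwrite \<sigma> \<alpha> = overwrite (\<sigma> @ [\<alpha> (length \<sigma>)]) \<alpha>"
        by (auto simp: overwrite_def fun_eq_iff nth_append less_Suc_eq)
      then show ?thesis using L[of "\<alpha> (length \<sigma>)" \<alpha>]
        by (cases "\<alpha> (length \<sigma>)") (auto elim!: mono)
    qed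
    with that show False unfolding bad_def by blast
  qed
  define s where "s = rec_nat [] (\<lambda>_ \<sigma>. \<sigma> @ [SOME b. bad (\<sigma> @ [b])])"
  have s_Suc: "s (Suc n) = s n @ [SOME b. bad (s n @ [b])]" for n by (simp add: s_def)
  have bad_s: "bad (s n)" for n
    by (induction n) (use bad0 in \<open>simp add: s_def\<close>, unfold s_Suc, rule someI_ex, rule step)
  have len: "length (s n) = n" for n by (induction n) (auto simp: s_Suc, simp add: s_def)
  have nth: "i < n \<Longrightarrow> s n ! i = s (Suc i) ! i" for i n
    by (induction n) (auto simp: s_Suc nth_append len less_Suc_eq)
  define \<alpha> where "\<alpha> i = s (Suc i) ! i" for i
  have \<alpha>: "i < n \<Longrightarrow> s n ! i = \<alpha> i" for i n unfolding \<alpha>_def by (rule nth)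
  obtain l where "Q \<alpha> l" using ex by blast
  have "Q (overwrite (s l) \<beta>) l" for \<beta>
    by (rule loc[OF _ \<open>Q \<alpha> l\<close>]) (simp add: agree_def overwrite_def len \<alpha>)
  with bad_s[of l] show False unfolding bad_def by blast
qed

text \<open>\<open>L\<close> searches for a length at which every finite string already shows a
  halting computation; compactness makes this search total.\<close>

lemma modulus_exists:
  assumes "cf G"
  shows "\<exists>L. cf L \<and> (\<forall>\<gamma> x \<alpha> \<beta>. agree (L \<gamma> x) \<alpha> \<beta> \<longrightarrow> G (combine \<gamma> \<alpha>) x = G (combine \<gamma> \<beta>) x)"
proof -
  obtain \<Psi> where \<Psi>: "bounded_use (\<lambda>\<gamma> x. Some (G \<gamma> x)) \<Psi>"
    using bounded_use_exists assms[unfolded cf_iff] by blast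
  \<comment> \<open>The first \<open>2 * k\<close> positions of \<open>combine\<close> hold
    \<open>k\<close> bits of each part. The search over all \<open>k\<close> up to \<open>l\<close>
    makes \<open>Q\<close> monotone in \<open>l\<close>.\<close>
  define Q where "Q \<gamma> x \<alpha> l \<longleftrightarrow> (\<exists>k<Suc l. \<Psi> (combine \<gamma> \<alpha>) (pr (2 * k) x) \<noteq> 0)" for \<gamma> x \<alpha> l
  define R where "R \<gamma> x l \<longleftrightarrow> (\<forall>t<2 ^ l. Q \<gamma> x (bits t) l)" for \<gamma> x l
  define L where "L \<gamma> x = (LEAST l. R \<gamma> x l)" for \<gamma> x
  have loc: "Q \<gamma> x \<beta> l" if ag: "agree l \<alpha> \<beta>" and Q: "Q \<gamma> x \<alpha> l" for \<gamma> x \<alpha> \<beta> l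
  proof -
    obtain k where k: "k < Suc l" "\<Psi> (combine \<gamma> \<alpha>) (pr (2 * k) x) \<noteq> 0" using Q unfolding Q_def by blast
    have "agree (2 * k) (combine \<gamma> \<alpha>) (combine \<gamma> \<beta>)"
      using k(1) by (intro agree_combine agree_mono[OF ag]) simp
    with k show ?thesis unfolding Q_def using bounded_useD(4)[OF \<Psi>] by metis
  qed
  have exR: "\<exists>l. R \<gamma> x l" for \<gamma> x
  proof -
    have "\<exists>l. \<forall>\<alpha>. Q \<gamma> x \<alpha> l"
    proof (rule cantor_compact)
      fix \<alpha>
      obtain K where "\<forall>l\<ge>K. \<Psi> (combine \<gamma> \<alpha>) (pr l x) = Suc (G (combine \<gamma> \<alpha>) x)"
        using bounded_useD(3)[OF \<Psi> refl] by blast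
      then have "\<Psi> (combine \<gamma> \<alpha>) (pr (2 * K) x) \<noteq> 0" by simp
      then have "Q \<gamma> x \<alpha> K" unfolding Q_def by blast
      then show "\<exists>l. Q \<gamma> x \<alpha> l" ..
    next
      show "\<And>\<alpha> l k. Q \<gamma> x \<alpha> l \<Longrightarrow> l \<le> k \<Longrightarrow> Q \<gamma> x \<alpha> k"
        unfolding Q_def by (meson le_imp_less_Suc less_Suc_eq_le order_trans)
    qed (rule loc)
    then show ?thesis unfolding R_def by blast
  qed
  have "G (combine \<gamma> \<alpha>) x = G (combine \<gamma> \<beta>) x" if "agree (L \<gamma> x) \<alpha> \<beta>" for \<gamma> x \<alpha> \<beta>
  proof -
    have "R \<gamma> x (L \<gamma> x)" unfolding L_def using exR by (rule LeastI_ex)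
    moreover obtain t where "t < 2 ^ L \<gamma> x" "agree (L \<gamma> x) (bits t) \<alpha>" using exists_bits_agree by blast
    ultimately have "Q \<gamma> x \<alpha> (L \<gamma> x)" unfolding R_def using loc by blast
    then obtain k where k: "k \<le> L \<gamma> x" "\<Psi> (combine \<gamma> \<alpha>) (pr (2 * k) x) \<noteq> 0"
      unfolding Q_def by (auto simp: less_Suc_eq_le)
    then obtain y where y: "\<Psi> (combine \<gamma> \<alpha>) (pr (2 * k) x) = Suc y" using not0_implies_Suc by blast
    moreover have "agree (2 * k) (combine \<gamma> \<alpha>) (combine \<gamma> \<beta>)"
      by (rule agree_combine, rule agree_mono[OF that k(1)])
    ultimately have "\<Psi> (combine \<gamma> \<beta>) (pr (2 * k) x) = Suc y" using bounded_useD(4)[OF \<Psi>] by metis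
    from bounded_useD(2)[OF \<Psi> y] bounded_useD(2)[OF \<Psi> this] show ?thesis by simp
  qed
  moreover have "cf L"
  proof -
    let ?P = "\<lambda>\<gamma> z. if even (p2 z) then of_bool (\<gamma> (p2 z div 2)) else of_bool (odd (p1 z div 2 ^ (p2 z div 2))) :: nat"
    have P: "cf ?P" by (intro cf_intros)
    have eq: "(\<lambda>i. ?P \<gamma> (pr t i) \<noteq> 0) = combine \<gamma> (bits t)" for \<gamma> t
      by (auto simp: fun_eq_iff combine_def bits_def)
    have "cf (\<lambda>\<gamma> z. \<Psi> (combine \<gamma> (bits (p1 z))) (p2 z))"
      using cf_substitute[OF bounded_useD(1)[OF \<Psi>] P cf_p1[OF cf_id] cf_p2[OF cf_id]] unfolding eq .
    note sub = cf_curry[where g = "\<lambda>\<gamma> t z. \<Psi> (combine \<gamma> (bits t)) z", OF this]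
    have "cf (\<lambda>\<gamma> z. of_bool (R \<gamma> (p1 z) (p2 z)))"
      unfolding R_def Q_def by (intro cf_intros sub)
    then show ?thesis unfolding L_def by (rule cf_Least_of_bool[OF _ exR])
  qed
  ultimately show ?thesis by blast
qed

section \<open>Arithmetic of computably approximable nonnegative reals\<close>

definition approx :: "nat \<Rightarrow> nat \<Rightarrow> real \<Rightarrow> bool" where
  "approx a k x \<longleftrightarrow> \<bar>real a / 2 ^ k - x\<bar> \<le> 1 / 2 ^ k"

lemma approx_iff: "approx a k x \<longleftrightarrow> real a - 1 \<le> 2 ^ k * x \<and> 2 ^ k * x \<le> real a + 1"
proof -
  have "real a / 2 ^ k - x = (real a - 2 ^ k * x) / 2 ^ k"
    by (simp add: diff_divide_distrib)
  then have "\<bar>real a / 2 ^ k - x\<bar> = \<bar>real a - 2 ^ k * x\<bar> / 2 ^ k"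
    by (simp add: abs_divide)
  then have "approx a k x \<longleftrightarrow> \<bar>real a - 2 ^ k * x\<bar> \<le> 1"
    by (simp add: approx_def divide_le_cancel)
  then show ?thesis by linarith
qed

text \<open>All reals that occur are nonnegative, so natural numerators do, and arithmetic on
  integer codes is avoided.\<close>

definition capprox :: "(cantor \<Rightarrow> nat \<Rightarrow> real) \<Rightarrow> bool" where
  "capprox x \<longleftrightarrow> (\<exists>F. cf F \<and> (\<forall>\<delta> i k. approx (F \<delta> (pr i k)) k (x \<delta> i)))"

text \<open>An error of 4 units at precision \<open>k + 3\<close> is half a unit at precision
  \<open>k\<close>; adding 4 before dividing by 8 rounds to the nearest integer and costs at most
  another half.\<close>

lemma capprox_weak:
  assumes "cf F" "\<And>\<delta> i k. real (F \<delta> (pr i k)) - 4 \<le> 2 ^ k * x \<delta> i"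
    "\<And>\<delta> i k. 2 ^ k * x \<delta> i \<le> real (F \<delta> (pr i k)) + 4"
  shows "capprox x"
  unfolding capprox_def
proof (intro exI conjI allI)
  let ?G = "\<lambda>\<delta> z. (F \<delta> (pr (p1 z) (p2 z + 3)) + 4) div 8"
  show "cf ?G" by (intro cf_intros cf_comp[OF assms(1)])
  fix \<delta> i k
  define A where "A = F \<delta> (pr i (k + 3))"
  define X where "X = 2 ^ k * x \<delta> i"
  have "real A - 4 \<le> 8 * X" "8 * X \<le> real A + 4"
    using assms(2,3)[where \<delta> = \<delta> and i = i and k = "k + 3"] by (simp_all add: A_def X_def power_add)
  moreover have "8 * ((A + 4) div 8) \<le> A + 4" "A + 4 < 8 * ((A + 4) div 8) + 8"
    using div_mult_mod_eq[of "A + 4" 8] mod_less_divisor[of 8 "A + 4"] by linarith+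
  then have "8 * real ((A + 4) div 8) \<le> real A + 4" "real A + 4 \<le> 8 * real ((A + 4) div 8) + 8"
    by linarith+
  ultimately have "real ((A + 4) div 8) - 1 \<le> X" "X \<le> real ((A + 4) div 8) + 1" by linarith+
  then show "approx (?G \<delta> (pr i k)) k (x \<delta> i)"
    by (simp add: approx_iff A_def X_def)
qed

lemma div_bounds:
  fixes a b :: nat assumes "0 < b"
  shows "real (a div b) \<le> real a / real b" "real a / real b \<le> real (a div b) + 1"
proof -
  have "real a = real (a div b * b + a mod b)" by simp
  also have "\<dots> = real (a div b) * real b + real (a mod b)" by (simp only: of_nat_add of_nat_mult)
  finally have "real a = real (a div b) * real b + real (a mod b)" .
  moreover have "real (a mod b) \<le> real b" using assms by (simp add: less_imp_le)
  ultimately show "real (a div b) \<le> real a / real b" "real a / real b \<le> real (a div b) + 1"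
    using assms by (simp_all add: field_simps)
qed

lemma capprox_comp: assumes "capprox x" "cf f" shows "capprox (\<lambda>\<delta> i. x \<delta> (f \<delta> i))"
proof -
  obtain F where F: "cf F" "\<And>\<delta> i k. approx (F \<delta> (pr i k)) k (x \<delta> i)"
    using assms(1) unfolding capprox_def by blast
  have "cf (\<lambda>\<delta> z. F \<delta> (pr (f \<delta> (p1 z)) (p2 z)))"
    by (intro cf_comp[OF F(1)] cf_comp[OF assms(2)] cf_intros)
  with F(2) show ?thesis unfolding capprox_def by (intro exI conjI) auto
qed

lemma capprox_nat: assumes "cf f" shows "capprox (\<lambda>\<delta> i. real (f \<delta> i))"
  unfolding capprox_def
proof (intro exI conjI allI)
  show "cf (\<lambda>\<delta> z. f \<delta> (p1 z) * 2 ^ p2 z)" by (intro cf_intros cf_comp[OF assms])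
qed (simp add: approx_iff)

lemma capprox_add: assumes "capprox x" "capprox y" shows "capprox (\<lambda>\<delta> i. x \<delta> i + y \<delta> i)"
proof -
  obtain F G where F: "cf F" "\<And>\<delta> i k. approx (F \<delta> (pr i k)) k (x \<delta> i)"
    and G: "cf G" "\<And>\<delta> i k. approx (G \<delta> (pr i k)) k (y \<delta> i)"
    using assms unfolding capprox_def by blast
  have "cf (\<lambda>\<delta> z. F \<delta> z + G \<delta> z)" by (intro cf_intros F G)
  then show ?thesis
  proof (rule capprox_weak)
    fix \<delta> i k
    note * = F(2)[of \<delta> i k, unfolded approx_iff] G(2)[of \<delta> i k, unfolded approx_iff]
    from * show "real (F \<delta> (pr i k) + G \<delta> (pr i k)) - 4 \<le> 2 ^ k * (x \<delta> i + y \<delta> i)"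
      unfolding distrib_left by linarith
    from * show "2 ^ k * (x \<delta> i + y \<delta> i) \<le> real (F \<delta> (pr i k) + G \<delta> (pr i k)) + 4"
      unfolding distrib_left by linarith
  qed
qed

text \<open>Where the subtraction of numerators is cut off at 0, the true difference is nonnegative
  by assumption and less than two units.\<close>

lemma capprox_diff:
  assumes "capprox x" "capprox y" "\<And>\<delta> i. y \<delta> i \<le> x \<delta> i"
  shows "capprox (\<lambda>\<delta> i. x \<delta> i - y \<delta> i)"
proof -
  obtain F G where F: "cf F" "\<And>\<delta> i k. approx (F \<delta> (pr i k)) k (x \<delta> i)"
    and G: "cf G" "\<And>\<delta> i k. approx (G \<delta> (pr i k)) k (y \<delta> i)"
    using assms unfolding capprox_def by blast
  have "cf (\<lambda>\<delta> z. F \<delta> z - G \<delta> z)" by (intro cf_intros F G)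
  then show ?thesis
  proof (rule capprox_weak)
    fix \<delta> i k
    note * = F(2)[of \<delta> i k, unfolded approx_iff] G(2)[of \<delta> i k, unfolded approx_iff]
    have le: "2 ^ k * y \<delta> i \<le> 2 ^ k * x \<delta> i" using assms(3) by (intro mult_left_mono) auto
    from * le show "real (F \<delta> (pr i k) - G \<delta> (pr i k)) - 4 \<le> 2 ^ k * (x \<delta> i - y \<delta> i)"
      unfolding right_diff_distrib by linarith
    from * show "2 ^ k * (x \<delta> i - y \<delta> i) \<le> real (F \<delta> (pr i k) - G \<delta> (pr i k)) + 4"
      unfolding right_diff_distrib by linarith
  qed
qed

text \<open>The factors are the possible values of \<open>share\<close>: 0 or an inverse power of
  two, so scaling is an integer division.\<close>

lemma capprox_scale:
  assumes "capprox x" "cf (\<lambda>\<delta> i. of_bool (P \<delta> i))" "cf e"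
  shows "capprox (\<lambda>\<delta> i. (if P \<delta> i then 1 / 2 ^ e \<delta> i else 0) * x \<delta> i)"
proof -
  obtain F where F: "cf F" "\<And>\<delta> i k. approx (F \<delta> (pr i k)) k (x \<delta> i)"
    using assms unfolding capprox_def by blast
  have "cf (\<lambda>\<delta> z. if P \<delta> (p1 z) then F \<delta> z div 2 ^ e \<delta> (p1 z) else 0)"
    by (intro cf_intros cf_comp[OF assms(2)] cf_comp[OF assms(3)] F(1))
  then show ?thesis
  proof (rule capprox_weak)
    fix \<delta> i k
    let ?A = "F \<delta> (pr i k)" and ?e = "e \<delta> i"
    have "real ?A - 1 \<le> 2 ^ k * x \<delta> i \<and> 2 ^ k * x \<delta> i \<le> real ?A + 1"
      using F(2)[of \<delta> i k, unfolded approx_iff] .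
    then have "(real ?A - 1) / 2 ^ ?e \<le> 2 ^ k * x \<delta> i / 2 ^ ?e" "2 ^ k * x \<delta> i / 2 ^ ?e \<le> (real ?A + 1) / 2 ^ ?e"
      by (auto intro: divide_right_mono)
    moreover have "1 / 2 ^ ?e \<le> (1::real)" by simp
    moreover have "real (?A div 2 ^ ?e) \<le> real ?A / 2 ^ ?e" "real ?A / 2 ^ ?e \<le> real (?A div 2 ^ ?e) + 1"
      using div_bounds[of "2 ^ ?e" ?A] by simp_all
    ultimately have *: "real (?A div 2 ^ ?e) - 4 \<le> 2 ^ k * x \<delta> i / 2 ^ ?e"
      "2 ^ k * x \<delta> i / 2 ^ ?e \<le> real (?A div 2 ^ ?e) + 4"
      unfolding diff_divide_distrib add_divide_distrib by linarith+
    then show "real (if P \<delta> (p1 (pr i k)) then F \<delta> (pr i k) div 2 ^ e \<delta> (p1 (pr i k)) else 0) - 4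
        \<le> 2 ^ k * ((if P \<delta> i then 1 / 2 ^ e \<delta> i else 0) * x \<delta> i)"
      "2 ^ k * ((if P \<delta> i then 1 / 2 ^ e \<delta> i else 0) * x \<delta> i)
        \<le> real (if P \<delta> (p1 (pr i k)) then F \<delta> (pr i k) div 2 ^ e \<delta> (p1 (pr i k)) else 0) + 4"
      by auto
  qed
qed

lemma capprox_sum:
  assumes "capprox (\<lambda>\<delta> z. x \<delta> (p1 z) (p2 z))" "cf n"
  shows "capprox (\<lambda>\<delta> i. \<Sum>j<n \<delta> i. x \<delta> i j)"
proof -
  obtain F where F: "cf F" "\<And>\<delta> i k. approx (F \<delta> (pr i k)) k (x \<delta> (p1 i) (p2 i))"
    using assms unfolding capprox_def by blast
  \<comment> \<open>Each summand may be wrong by one unit. With \<open>n\<close> extra bits of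
    precision the total of \<open>n\<close> units is at most \<open>2 ^ n\<close>, that is, one unit
    at precision \<open>k\<close>.\<close>
  have "cf (\<lambda>\<delta> z. (\<Sum>j<n \<delta> (p1 z). F \<delta> (pr (pr (p1 z) j) (p2 z + n \<delta> (p1 z)))) div 2 ^ n \<delta> (p1 z))"
    by (intro cf_intros cf_comp[OF F(1)] cf_comp[OF assms(2)])
  then show ?thesis
  proof (rule capprox_weak)
    fix \<delta> i k
    let ?n = "n \<delta> i"
    let ?f = "\<lambda>j. F \<delta> (pr (pr i j) (k + ?n))"
    let ?S = "\<Sum>j<?n. ?f j" and ?X = "\<Sum>j<?n. x \<delta> i j"
    have *: "real (?f j) - 1 \<le> 2 ^ (k + ?n) * x \<delta> i j \<and> 2 ^ (k + ?n) * x \<delta> i j \<le> real (?f j) + 1" for j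
      using F(2)[of \<delta> "pr i j" "k + ?n"] by (simp add: approx_iff)
    have "(\<Sum>j<?n. real (?f j) - 1) \<le> (\<Sum>j<?n. 2 ^ (k + ?n) * x \<delta> i j)"
      "(\<Sum>j<?n. 2 ^ (k + ?n) * x \<delta> i j) \<le> (\<Sum>j<?n. real (?f j) + 1)"
      using * by (auto intro!: sum_mono)
    then have "real ?S - ?n \<le> 2 ^ (k + ?n) * ?X" "2 ^ (k + ?n) * ?X \<le> real ?S + ?n"
      by (simp_all add: sum_subtractf sum.distrib flip: sum_distrib_left)
    moreover have "real ?n \<le> 2 ^ ?n" using less_exp[of ?n] by (metis less_imp_le of_nat_le_iff of_nat_numeral of_nat_power)
    ultimately have "real ?S - 2 ^ ?n \<le> 2 ^ (k + ?n) * ?X" "2 ^ (k + ?n) * ?X \<le> real ?S + 2 ^ ?n"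
      by linarith+
    from this[THEN divide_right_mono, of "2 ^ ?n"]
    have "(real ?S - 2 ^ ?n) / 2 ^ ?n \<le> 2 ^ (k + ?n) * ?X / 2 ^ ?n"
      "2 ^ (k + ?n) * ?X / 2 ^ ?n \<le> (real ?S + 2 ^ ?n) / 2 ^ ?n"
      by simp_all
    then have "real ?S / 2 ^ ?n - 1 \<le> 2 ^ k * ?X" "2 ^ k * ?X \<le> real ?S / 2 ^ ?n + 1"
      by (simp_all add: power_add diff_divide_distrib add_divide_distrib)
    moreover have "real (?S div 2 ^ ?n) \<le> real ?S / 2 ^ ?n" "real ?S / 2 ^ ?n \<le> real (?S div 2 ^ ?n) + 1"
      using div_bounds[of "2 ^ ?n" ?S] by simp_all
    ultimately have "real (?S div 2 ^ ?n) - 4 \<le> 2 ^ k * ?X" "2 ^ k * ?X \<le> real (?S div 2 ^ ?n) + 4"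
      by linarith+
    then show "real ((\<Sum>j<n \<delta> (p1 (pr i k)). F \<delta> (pr (pr (p1 (pr i k)) j) (p2 (pr i k) + n \<delta> (p1 (pr i k))))) div 2 ^ n \<delta> (p1 (pr i k))) - 4 \<le> 2 ^ k * ?X"
      "2 ^ k * ?X \<le> real ((\<Sum>j<n \<delta> (p1 (pr i k)). F \<delta> (pr (pr (p1 (pr i k)) j) (p2 (pr i k) + n \<delta> (p1 (pr i k))))) div 2 ^ n \<delta> (p1 (pr i k))) + 4"
      by simp_all
  qed
qed

lemma capprox_continuous:
  assumes "capprox x" "0 < e"
  shows "\<exists>l. \<forall>\<alpha> \<beta>. agree l \<alpha> \<beta> \<longrightarrow> \<bar>x (combine \<gamma> \<alpha>) i - x (combine \<gamma> \<beta>) i\<bar> \<le> e"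
proof -
  obtain F where F: "cf F" "\<And>\<delta> i k. approx (F \<delta> (pr i k)) k (x \<delta> i)"
    using assms unfolding capprox_def by blast
  obtain L where L: "\<And>\<gamma> z \<alpha> \<beta>. agree (L \<gamma> z) \<alpha> \<beta> \<Longrightarrow> F (combine \<gamma> \<alpha>) z = F (combine \<gamma> \<beta>) z"
    using modulus_exists[OF F(1)] by blast
  obtain k where k: "2 / e < 2 ^ k" using real_arch_pow[of 2 "2 / e"] by auto
  have "\<bar>x (combine \<gamma> \<alpha>) i - x (combine \<gamma> \<beta>) i\<bar> \<le> e" if "agree (L \<gamma> (pr i k)) \<alpha> \<beta>" for \<alpha> \<beta>
  proof -
    have "\<bar>x (combine \<gamma> \<alpha>) i - x (combine \<gamma> \<beta>) i\<bar> \<le> 1 / 2 ^ k + 1 / 2 ^ k"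
      using F(2)[of "combine \<gamma> \<alpha>" i k] F(2)[of "combine \<gamma> \<beta>" i k]
      unfolding approx_def L[OF that] by linarith
    also have "\<dots> \<le> e" using k assms(2) by (simp add: field_simps)
    finally show ?thesis .
  qed
  then show ?thesis by blast
qed

lemma ucont_capprox:
  assumes "capprox x" shows "ucont (\<lambda>\<xi>. x (combine \<gamma> (overwrite \<sigma> (join \<xi>))) i)"
  unfolding ucont_def
proof (intro allI impI)
  fix e :: real assume "0 < e"
  from capprox_continuous[OF assms this] obtain l where
    l: "\<And>\<alpha> \<beta>. agree l \<alpha> \<beta> \<Longrightarrow> \<bar>x (combine \<gamma> \<alpha>) i - x (combine \<gamma> \<beta>) i\<bar> \<le> e" by blast
  show "\<exists>l. \<forall>\<omega> \<omega>'. agree2 l \<omega> \<omega>' \<longrightarrow>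
      \<bar>x (combine \<gamma> (overwrite \<sigma> (join \<omega>))) i - x (combine \<gamma> (overwrite \<sigma> (join \<omega>'))) i\<bar> \<le> e"
    by (intro exI allI impI l agree_overwrite agree_join)
qed

section \<open>Means over the cylinders of strings\<close>

definition tail_integral :: "(cantor \<Rightarrow> real) \<Rightarrow> bool list \<Rightarrow> real" where
  "tail_integral f \<sigma> = (\<integral>\<xi>. f (overwrite \<sigma> (join \<xi>)) \<partial>U)"

text \<open>Position \<open>length \<sigma>\<close> of the join is a single bit of a single row, so
  this is the splitting of the integral over that bit.\<close>

lemma tail_integral_split:
  assumes "ucont (\<lambda>\<xi>. f (overwrite \<sigma> (join \<xi>)))"
  shows "tail_integral f \<sigma> = (tail_integral f (\<sigma> @ [False]) + tail_integral f (\<sigma> @ [True])) / 2"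
proof -
  obtain m i where mi: "prod_decode (length \<sigma>) = (m, i)" by fastforce
  have "overwrite \<sigma> (join (set_at m i b \<xi>)) = overwrite (\<sigma> @ [b]) (join \<xi>)" for b \<xi>
  proof
    fix k
    have "prod_decode k = (m, i) \<longleftrightarrow> k = length \<sigma>" by (metis mi prod_decode_eq)
    then show "overwrite \<sigma> (join (set_at m i b \<xi>)) k = overwrite (\<sigma> @ [b]) (join \<xi>) k"
      by (cases "prod_decode k") (auto simp: overwrite_def join_def set_at_def nth_append mi)
  qed
  then show ?thesis using integral_split_bit[OF assms, of m i] by (simp add: tail_integral_def)
qed

text \<open>The last entry of \<open>bit_list (Suc l) t\<close> is the top binary digit of
  \<open>t\<close>, so the sum splits at \<open>2 ^ l\<close>.\<close>

lemma sum_bit_list_Suc: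
  "(\<Sum>t<2 ^ Suc l. f (bit_list (Suc l) t)) =
   (\<Sum>t<2 ^ l. f (bit_list l t @ [False]) + f (bit_list l t @ [True]))" for f :: "bool list \<Rightarrow> real"
proof -
  have split: "(\<Sum>t<a + b. g t) = (\<Sum>t<a. g t) + (\<Sum>t<b. g (a + t))" for a b and g :: "nat \<Rightarrow> real"
    by (induction b) (simp_all add: add.assoc)
  have "bits t l = False" if "t < 2 ^ l" for t using that by (simp add: bits_def)
  then have 1: "bit_list (Suc l) t = bit_list l t @ [False]" if "t < 2 ^ l" for t
    using that by (simp add: bit_list_def)
  have b: "bits (2 ^ l + t) i = bits t i" if "i < l" for i t
  proof -
    have "(2::nat) ^ l = 2 ^ (l - i) * 2 ^ i" using that by (simp flip: power_add)
    then have "(2 ^ l + t) div 2 ^ i = t div 2 ^ i + 2 ^ (l - i)" by simp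
    then show ?thesis using that by (simp add: bits_def)
  qed
  have 2: "bit_list (Suc l) (2 ^ l + t) = bit_list l t @ [True]" if "t < 2 ^ l" for t
    using b that by (simp add: bit_list_def bits_def)
  have "(\<Sum>t<2 ^ Suc l. f (bit_list (Suc l) t)) = (\<Sum>t<2 ^ l + 2 ^ l. f (bit_list (Suc l) t))"
    by (simp add: mult_2)
  also have "\<dots> = (\<Sum>t<2 ^ l. f (bit_list (Suc l) t)) + (\<Sum>t<2 ^ l. f (bit_list (Suc l) (2 ^ l + t)))"
    by (rule split)
  finally show ?thesis by (simp add: 1 2 sum.distrib)
qed

lemma tail_integral_average:
  assumes "\<And>\<sigma>. ucont (\<lambda>\<xi>. f (overwrite \<sigma> (join \<xi>)))"
  shows "(\<Sum>t<2 ^ l. tail_integral f (\<sigma> @ bit_list l t)) = 2 ^ l * tail_integral f \<sigma>"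
proof (induction l)
  case (Suc l)
  have *: "tail_integral f ((\<sigma> @ bit_list l t) @ [False]) + tail_integral f ((\<sigma> @ bit_list l t) @ [True])
      = 2 * tail_integral f (\<sigma> @ bit_list l t)" for t
    using tail_integral_split[OF assms, of "\<sigma> @ bit_list l t"] by simp
  have "(\<Sum>t<2 ^ Suc l. tail_integral f (\<sigma> @ bit_list (Suc l) t)) =
    (\<Sum>t<2 ^ l. 2 * tail_integral f (\<sigma> @ bit_list l t))"
    unfolding sum_bit_list_Suc[of "\<lambda>\<tau>. tail_integral f (\<sigma> @ \<tau>)"] using * by simp
  then show ?case using Suc by (simp flip: sum_distrib_left)
qed (simp add: bit_list_def)

definition code_string :: "nat \<Rightarrow> bool list" where
  "code_string c = map (\<lambda>i. code_nth c i \<noteq> 0) [0..<code_length c]"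

lemma code_string_string_code [simp]: "code_string (string_code \<sigma>) = \<sigma>"
  by (rule nth_equalityI) (auto simp: code_string_def)

text \<open>The modulus of \<open>F\<close> at precision \<open>k\<close> cuts the cylinder into
  \<open>2 ^ l\<close> equal pieces on each of which one numerator approximates the integrand
  throughout; the average of these numerators approximates the mean.\<close>

lemma capprox_tail_integral:
  assumes "capprox x"
  shows "capprox (\<lambda>\<gamma> z. tail_integral (\<lambda>\<alpha>. x (combine \<gamma> \<alpha>) (p2 z)) (code_string (p1 z)))"
proof -
  obtain F where F: "cf F" "\<And>\<delta> i k. approx (F \<delta> (pr i k)) k (x \<delta> i)"
    using assms unfolding capprox_def by blast
  obtain L where "cf L" and L: "\<And>\<gamma> z \<alpha> \<beta>. agree (L \<gamma> z) \<alpha> \<beta> \<Longrightarrow> F (combine \<gamma> \<alpha>) z = F (combine \<gamma> \<beta>) z"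
    using modulus_exists[OF F(1)] by blast
  define Orc where "Orc \<gamma> c t = combine \<gamma> (overwrite (code_string c) (\<lambda>j. bits t (j - code_length c)))" for \<gamma> c t
  let ?l = "\<lambda>\<gamma> w. L \<gamma> (pr (p2 (p1 w)) (p2 w))"
  define H where "H \<gamma> w = (\<Sum>t<2 ^ ?l \<gamma> w. F (Orc \<gamma> (p1 (p1 w)) t) (pr (p2 (p1 w)) (p2 w))) div 2 ^ ?l \<gamma> w" for \<gamma> w
  have "cf H"
  proof -
    let ?P = "\<lambda>\<gamma> z. if even (p2 z) then of_bool (\<gamma> (p2 z div 2))
      else if p2 z div 2 < code_length (p1 (p1 z)) then code_nth (p1 (p1 z)) (p2 z div 2)
      else of_bool (odd (p2 (p1 z) div 2 ^ (p2 z div 2 - code_length (p1 (p1 z))))) :: nat"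
    have P: "cf ?P" by (intro cf_intros)
    have eq: "(\<lambda>i. ?P \<gamma> (pr y i) \<noteq> 0) = Orc \<gamma> (p1 y) (p2 y)" for \<gamma> y
      by (auto simp: fun_eq_iff Orc_def combine_def bits_def overwrite_def code_string_def)
    have "cf (\<lambda>\<gamma> z. F (Orc \<gamma> (p1 (p1 z)) (p2 (p1 z))) (p2 z))"
      using cf_substitute[OF F(1) P cf_p1[OF cf_id] cf_p2[OF cf_id]] unfolding eq .
    from cf_curry[where g = "\<lambda>\<gamma> y z. F (Orc \<gamma> (p1 y) (p2 y)) z", OF this]
    have "cf a \<Longrightarrow> cf b \<Longrightarrow> cf c \<Longrightarrow> cf (\<lambda>\<gamma> z. F (Orc \<gamma> (a \<gamma> z) (b \<gamma> z)) (c \<gamma> z))" for a b c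
      using cf_pair[of a b] by fastforce
    note sub = this
    show ?thesis unfolding H_def[abs_def] by (intro cf_intros cf_comp[OF \<open>cf L\<close>] sub)
  qed
  then show ?thesis
  proof (rule capprox_weak)
    fix \<gamma> z k
    let ?c = "p1 z" and ?i = "p2 z"
    let ?f = "\<lambda>\<alpha>. x (combine \<gamma> \<alpha>) ?i" and ?\<sigma> = "code_string ?c"
    let ?l = "L \<gamma> (pr ?i k)"
    let ?A = "\<lambda>t. F (Orc \<gamma> ?c t) (pr ?i k)"
    note uc = ucont_capprox[OF assms]
    have *: "real (?A t) - 1 \<le> 2 ^ k * tail_integral ?f (?\<sigma> @ bit_list ?l t) \<and>
      2 ^ k * tail_integral ?f (?\<sigma> @ bit_list ?l t) \<le> real (?A t) + 1" for t
    proof -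
      have "approx (?A t) k (?f (overwrite (?\<sigma> @ bit_list ?l t) (join \<xi>)))" for \<xi>
      proof -
        \<comment> \<open>The modulus counts positions from 0, so fixing \<open>l\<close> bits
          behind the string fixes at least the first \<open>l\<close> positions.\<close>
        have "agree ?l (overwrite (?\<sigma> @ bit_list ?l t) (join \<xi>)) (overwrite ?\<sigma> (\<lambda>j. bits t (j - code_length ?c)))"
          by (auto simp: agree_def overwrite_def nth_append bit_list_def code_string_def)
        from L[OF this] F(2)[of "combine \<gamma> (overwrite (?\<sigma> @ bit_list ?l t) (join \<xi>))" ?i k]
        show ?thesis by (simp add: Orc_def)
      qed
      then have **: "(real (?A t) - 1) / 2 ^ k \<le> ?f (overwrite (?\<sigma> @ bit_list ?l t) (join \<xi>))"
        "?f (overwrite (?\<sigma> @ bit_list ?l t) (join \<xi>)) \<le> (real (?A t) + 1) / 2 ^ k" for \<xi>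
        by (simp_all add: approx_iff field_simps)
      have "(real (?A t) - 1) / 2 ^ k \<le> tail_integral ?f (?\<sigma> @ bit_list ?l t)"
        "tail_integral ?f (?\<sigma> @ bit_list ?l t) \<le> (real (?A t) + 1) / 2 ^ k"
        unfolding tail_integral_def using ** by (auto intro!: integral_ge integral_le uc)
      then show ?thesis by (simp add: field_simps)
    qed
    let ?S = "\<Sum>t<2 ^ ?l. ?A t" and ?I = "tail_integral ?f ?\<sigma>"
    have "(\<Sum>t<2 ^ ?l. real (?A t) - 1) \<le> (\<Sum>t<2 ^ ?l. 2 ^ k * tail_integral ?f (?\<sigma> @ bit_list ?l t))"
      "(\<Sum>t<2 ^ ?l. 2 ^ k * tail_integral ?f (?\<sigma> @ bit_list ?l t)) \<le> (\<Sum>t<2 ^ ?l. real (?A t) + 1)"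
      using * by (auto intro!: sum_mono)
    then have "real ?S - 2 ^ ?l \<le> 2 ^ k * (2 ^ ?l * ?I)" "2 ^ k * (2 ^ ?l * ?I) \<le> real ?S + 2 ^ ?l"
      by (simp_all add: sum_subtractf sum.distrib tail_integral_average[OF uc] flip: sum_distrib_left)
    from this[THEN divide_right_mono, of "2 ^ ?l"]
    have "(real ?S - 2 ^ ?l) / 2 ^ ?l \<le> 2 ^ k * (2 ^ ?l * ?I) / 2 ^ ?l"
      "2 ^ k * (2 ^ ?l * ?I) / 2 ^ ?l \<le> (real ?S + 2 ^ ?l) / 2 ^ ?l"
      by simp_all
    then have "real ?S / 2 ^ ?l - 1 \<le> 2 ^ k * ?I" "2 ^ k * ?I \<le> real ?S / 2 ^ ?l + 1"
      by (simp_all add: diff_divide_distrib add_divide_distrib)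
    moreover have "real (?S div 2 ^ ?l) \<le> real ?S / 2 ^ ?l" "real ?S / 2 ^ ?l \<le> real (?S div 2 ^ ?l) + 1"
      using div_bounds[of "2 ^ ?l" ?S] by simp_all
    moreover have "H \<gamma> (pr z k) = ?S div 2 ^ ?l" by (simp add: H_def)
    ultimately show "real (H \<gamma> (pr z k)) - 4 \<le> 2 ^ k * ?I" "2 ^ k * ?I \<le> real (H \<gamma> (pr z k)) + 4"
      by linarith+
  qed
qed

section \<open>Trading strategies\<close>

text \<open>A functional determines the process that it names. This gives the dependence of
  \<open>M n\<close> on the first \<open>n\<close> rows everywhere, and the countability of the
  processes to be diagonalized.\<close>

lemma real_name_unique: assumes "real_name p x" "real_name p y" shows "x = y"
proof -
  have "\<bar>x - y\<bar> \<le> 2 / 2 ^ k" for k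
    using assms[unfolded real_name_def, THEN spec[of _ k]] by (simp add: abs_le_iff)
  then have "\<bar>x - y\<bar> \<le> 0 + e" if "0 < e" for e
  proof -
    obtain k where "2 / e < 2 ^ k" using real_arch_pow[of 2 "2 / e"] by auto
    then have "2 / 2 ^ k \<le> e" using that by (simp add: field_simps)
    with \<open>\<bar>x - y\<bar> \<le> 2 / 2 ^ k\<close> show ?thesis by simp
  qed
  then show ?thesis by (metis field_le_epsilon abs_le_zero_iff eq_iff_diff_eq_0)
qed

text \<open>Even codes decode to nonnegative integers. Odd codes decode to negative ones, and
  replacing these by 0 only improves the approximation of a nonnegative real.\<close>

definition nonneg_numerator :: "nat \<Rightarrow> nat" where
  "nonneg_numerator a = (if even a then a div 2 else 0)"

lemma cf_nonneg_numerator [cf_intros]: "cf f \<Longrightarrow> cf (\<lambda>\<gamma> x. nonneg_numerator (f \<gamma> x))"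
  unfolding nonneg_numerator_def by (intro cf_intros)

lemma real_name_approx:
  assumes "real_name p x" "0 \<le> x" shows "approx (nonneg_numerator (p k)) k x"
proof -
  have "real (nonneg_numerator a) = max 0 (of_int (int_decode a))" for a
    by (simp add: nonneg_numerator_def int_decode_def sum_decode_def)
  moreover have "\<bar>of_int (int_decode (p k)) / 2 ^ k - x\<bar> \<le> 1 / 2 ^ k"
    using assms(1) unfolding real_name_def by blast
  moreover have "of_int (int_decode (p k)) / 2 ^ k \<le> (0::real)" if "int_decode (p k) < 0"
    using that by (intro divide_nonpos_pos) auto
  ultimately show ?thesis
    using assms(2) unfolding approx_def by (cases "int_decode (p k) < 0") (simp_all add: max_def abs_le_iff)
qed

lemma int_decode_double [simp]: "int_decode (2 * a) = int a"
  by (simp add: int_decode_def sum_decode_def)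

section \<open>Splitting a sequence at row \<open>n\<close>\<close>

definition rows :: "nat \<Rightarrow> cantor \<Rightarrow> cantor_seq" where
  "rows n \<gamma> = (\<lambda>i j. \<gamma> (j * n + i))"

text \<open>Recovers \<omega> from \<open>combine (tuple_join n \<omega>) (join (tail_from n
  \<omega>))\<close>, the form in which a martingale relative to the first \<open>n\<close> rows
  sees it.\<close>

definition unpack :: "nat \<Rightarrow> cantor \<Rightarrow> cantor_seq" where
  "unpack n \<delta> = splice n (\<lambda>i j. \<delta> (2 * (j * n + i))) (\<lambda>m i. \<delta> (Suc (2 * pr m i)))"

lemma unpack_combine: "unpack n (combine \<gamma> \<alpha>) = splice n (rows n \<gamma>) (\<lambda>m i. \<alpha> (pr m i))"
  by (simp add: unpack_def combine_def rows_def)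

lemma unpack_join [simp]: "unpack 0 (combine \<gamma> (join \<omega>)) = \<omega>"
  by (simp add: unpack_combine splice_def join_def)

lemma splice_rows: "splice n (rows n (tuple_join n \<omega>)) \<xi> = splice n \<omega> \<xi>"
  by (auto simp: splice_def fun_eq_iff rows_def tuple_join_def)

text \<open>The number of rows passed to \<open>F\<close> is part of the input and may exceed
  \<open>n\<close>; the rows from \<open>n\<close> on are then taken from the tail half of the
  oracle.\<close>

lemma cf_unpack:
  assumes "cf F" shows "cf (\<lambda>\<delta> z. F (tuple_join (p1 z) (unpack n \<delta>)) (p2 z))"
proof -
  let ?P = "\<lambda>\<delta> z. of_bool (0 < p1 z \<and> (if p2 z mod p1 z < n
    then \<delta> (2 * (p2 z div p1 z * n + p2 z mod p1 z))
    else \<delta> (Suc (2 * pr (p2 z mod p1 z - n) (p2 z div p1 z))))) :: nat"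
  have P: "cf ?P" by (intro cf_intros)
  have eq: "(\<lambda>i. ?P \<delta> (pr m i) \<noteq> 0) = tuple_join m (unpack n \<delta>)" for \<delta> m
    by (auto simp: fun_eq_iff tuple_join_def unpack_def splice_def)
  show ?thesis
    using cf_substitute[OF assms P cf_p1[OF cf_id] cf_p2[OF cf_id]] unfolding eq .
qed

text \<open>
  Prices are read as integer approximations \<open>x\<close> of \<open>2 ^ k * M\<close>. \<open>Upcross c k\<close> waits for \<open>x \<le> c\<close> in
  even stages, buys one share, sells it once \<open>x \<ge> c + 3\<close>, and gains at least \<open>1 / 2 ^ k\<close> each time; the
  gap \<open>3\<close> absorbs the two approximation errors. \<open>Unbounded c\<close> (where \<open>c\<close> bounds the initial price)
  starts with one share and sells half of its holding whenever the price passes the next power of two.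
  At stage \<open>j\<close> a strategy owns \<open>share p j\<close> shares and at least \<open>cash p j\<close> in cash.
\<close>

datatype strategy = Upcross nat nat | Unbounded nat

instance strategy :: countable by countable_datatype

fun trigger :: "strategy \<Rightarrow> nat \<Rightarrow> nat \<Rightarrow> bool" where
  "trigger (Upcross c k) j x = (if even j then x \<le> c else c + 3 \<le> x)"
| "trigger (Unbounded c) j x = (2 ^ Suc j + 1 \<le> x)"

fun share :: "strategy \<Rightarrow> nat \<Rightarrow> real" where
  "share (Upcross c k) j = of_bool (odd j)"
| "share (Unbounded c) j = 1 / 2 ^ j"

text \<open>A numerator of at most \<open>c\<close> means a price of at most
  \<open>(c + 1) / 2 ^ k\<close>, the reserve held in even stages. \<open>Unbounded\<close> earns at
  least 1 per sale: a share of \<open>1 / 2 ^ Suc j\<close> at a price of at least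
  \<open>2 ^ Suc j\<close>.\<close>

fun cash :: "strategy \<Rightarrow> nat \<Rightarrow> real" where
  "cash (Upcross c k) j = (real (j div 2) + (if even j then real c + 1 else 0)) / 2 ^ k"
| "cash (Unbounded c) j = real j"

text \<open>The cash of \<open>Upcross\<close> drops at each purchase; \<open>level\<close> leaves
  out the reserve and is nondecreasing in the stage.\<close>

fun level :: "strategy \<Rightarrow> nat \<Rightarrow> real" where
  "level (Upcross c k) j = real (j div 2) / 2 ^ k"
| "level (Unbounded c) j = real j"

fun precision :: "strategy \<Rightarrow> nat" where
  "precision (Upcross c k) = k"
| "precision (Unbounded c) = 0"

text \<open>Natural upper bounds for the value of the initial position: the reserve for
  \<open>Upcross\<close>, one share at a price of at most \<open>c\<close> for
  \<open>Unbounded\<close>.\<close>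

fun capital :: "strategy \<Rightarrow> nat" where
  "capital (Upcross c k) = Suc c"
| "capital (Unbounded c) = c"

lemma share_bounds: "0 \<le> share p j" "share p j \<le> 1"
  by (cases p; simp)+

lemma level_le_cash: "level p j \<le> cash p j"
  by (cases p) (simp_all add: divide_right_mono)

lemma level_nonneg: "0 \<le> level p j"
  by (cases p) simp_all

lemma level_mono: "i \<le> j \<Longrightarrow> level p i \<le> level p j"
  by (cases p) (simp_all add: divide_right_mono div_le_mono)

lemma level_unbounded: "\<exists>j. B \<le> level p j"
proof (cases p)
  case (Upcross c k)
  obtain j where "B * 2 ^ k \<le> real j" using real_arch_simple by blast
  then show ?thesis using Upcross by (intro exI[of _ "2 * j"]) (simp add: field_simps)
qed (auto simp: real_arch_simple)

text \<open>In odd stages of \<open>Upcross\<close> the share sells for at least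
  \<open>c + 2\<close> units of \<open>1 / 2 ^ k\<close>: \<open>c + 1\<close> of them restore the
  reserve, and one is the gain.\<close>

lemma trigger_self_financing:
  assumes "trigger p j x" "approx x (precision p) y" "0 \<le> y"
  shows "share p (Suc j) * y + cash p (Suc j) \<le> share p j * y + cash p j"
proof (cases p)
  case (Upcross c k)
  have y: "real x - 1 \<le> 2 ^ k * y" "2 ^ k * y \<le> real x + 1"
    using assms(2) by (auto simp: approx_iff Upcross)
  show ?thesis
  proof (cases "even j")
    case True
    then have "2 ^ k * y \<le> real c + 1" using assms(1) y by (simp add: Upcross)
    then have "y \<le> (real c + 1) / 2 ^ k" by (simp add: field_simps)
    with True show ?thesis by (simp add: Upcross add_divide_distrib)
  next
    case False
    then have "real c + 3 \<le> real x" using assms(1) by (simp add: Upcross)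
    then have "real c + 2 \<le> 2 ^ k * y" using y by linarith
    then have "(real c + 2) / 2 ^ k \<le> y" by (simp add: field_simps)
    moreover have "real (Suc j div 2) = real (j div 2) + 1" using False by (simp add: odd_Suc_div_two)
    ultimately show ?thesis using False by (simp add: Upcross add_divide_distrib) 
  qed
next
  case (Unbounded c)
  have "real x \<le> y + 1" using assms(2) by (auto simp: approx_iff Unbounded)
  moreover have "real (2 ^ Suc j + 1) \<le> real x" using assms(1) by (subst of_nat_le_iff) (simp add: Unbounded)
  ultimately have "2 * 2 ^ j \<le> y" by simp
  then have "1 \<le> y / (2 * 2 ^ j)" by (simp add: field_simps)
  moreover have "share p (Suc j) * y = y / (2 * 2 ^ j)" "share p j * y = 2 * (y / (2 * 2 ^ j))"
    "cash p (Suc j) = cash p j + 1" by (simp_all add: Unbounded)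
  ultimately show ?thesis by linarith
qed

section \<open>Stages and wealth\<close>

definition numerator :: "(cantor \<Rightarrow> nat \<Rightarrow> nat) \<Rightarrow> nat \<Rightarrow> nat \<Rightarrow> cantor_seq \<Rightarrow> nat" where
  "numerator F k m \<omega> = nonneg_numerator (F (tuple_join m \<omega>) (pr m k))"

definition stage :: "strategy \<Rightarrow> (cantor \<Rightarrow> nat \<Rightarrow> nat) \<Rightarrow> nat \<Rightarrow> cantor_seq \<Rightarrow> nat" where
  "stage p F m \<omega> = rec_nat 0 (\<lambda>j r. r + of_bool (trigger p r (numerator F (precision p) j \<omega>))) m"

lemma stage_0 [simp]: "stage p F 0 \<omega> = 0" and
  stage_Suc: "stage p F (Suc m) \<omega> = stage p F m \<omega> + of_bool (trigger p (stage p F m \<omega>) (numerator F (precision p) m \<omega>))"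
  by (simp_all add: stage_def)

text \<open>A martingale transform: the holding from time \<open>j\<close> to \<open>Suc j\<close>
  is given by stage \<open>Suc j\<close>, which has read prices up to time \<open>j\<close> only and
  is therefore predictable.\<close>

definition wealth :: "strategy \<Rightarrow> (cantor \<Rightarrow> nat \<Rightarrow> nat) \<Rightarrow> (nat \<Rightarrow> cantor_seq \<Rightarrow> real) \<Rightarrow> nat \<Rightarrow> cantor_seq \<Rightarrow> real" where
  "wealth p F M m \<omega> = real (capital p) + (\<Sum>j<m. share p (stage p F (Suc j) \<omega>) * (M (Suc j) \<omega> - M j \<omega>))"

lemma stage_mono: "m \<le> n \<Longrightarrow> stage p F m \<omega> \<le> stage p F n \<omega>"
  by (induction n rule: nat_induct) (auto simp: stage_Suc le_Suc_eq)

lemma numerator_rows: "(\<And>i. i < m \<Longrightarrow> \<omega> i = \<omega>' i) \<Longrightarrow> numerator F k m \<omega> = numerator F k m \<omega>'"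
proof -
  assume "\<And>i. i < m \<Longrightarrow> \<omega> i = \<omega>' i"
  then have "tuple_join m \<omega> = tuple_join m \<omega>'" by (auto simp: tuple_join_def fun_eq_iff)
  then show ?thesis by (simp add: numerator_def)
qed

lemma stage_rows: "(\<And>i. Suc i < m \<Longrightarrow> \<omega> i = \<omega>' i) \<Longrightarrow> stage p F m \<omega> = stage p F m \<omega>'"
proof (induction m)
  case (Suc m)
  then have "numerator F (precision p) m \<omega> = numerator F (precision p) m \<omega>'" "stage p F m \<omega> = stage p F m \<omega>'"
    by (auto intro: numerator_rows)
  then show ?case by (simp add: stage_Suc)
qed simp

text \<open>The almost sure conditions are replaced by conditions at every point, which is what
  pointwise diagonalization and arbitrary oracles call for.\<close>

definition continuous_martingale :: "(nat \<Rightarrow> cantor_seq \<Rightarrow> real) \<Rightarrow> bool" where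
  "continuous_martingale N \<longleftrightarrow> (\<forall>n \<omega>. 0 \<le> N n \<omega>) \<and> (\<forall>n. ucont (N n)) \<and>
    (\<forall>n \<omega> \<omega>'. (\<forall>i<n. \<omega> i = \<omega>' i) \<longrightarrow> N n \<omega> = N n \<omega>') \<and>
    (\<forall>n \<omega>. cond_expect n (N (Suc n)) \<omega> = N n \<omega>)"

locale computable_martingale =
  fixes M :: "nat \<Rightarrow> cantor_seq \<Rightarrow> real" and F :: "cantor \<Rightarrow> nat \<Rightarrow> nat"
  assumes doob: "doob_martingale M" and cf_F: "cf F"
    and name: "real_name (\<lambda>k. F (tuple_join n \<omega>) (pr n k)) (M n \<omega>)"
    and nonneg: "0 \<le> M n \<omega>"
begin

lemma approx_numerator: "approx (numerator F k n \<omega>) k (M n \<omega>)"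
  unfolding numerator_def by (rule real_name_approx[OF name nonneg])

lemma M_rows: assumes "\<And>i. i < n \<Longrightarrow> \<omega> i = \<omega>' i" shows "M n \<omega> = M n \<omega>'"
proof -
  have "tuple_join n \<omega> = tuple_join n \<omega>'" using assms by (auto simp: tuple_join_def fun_eq_iff)
  then show ?thesis using name[of n \<omega>] name[of n \<omega>'] by (auto intro: real_name_unique)
qed

lemma cf_numerator: "cf (\<lambda>\<delta> z. numerator F (p2 z) (p1 z) (unpack n \<delta>))"
proof -
  have "cf (\<lambda>\<delta> z. pr (p1 z) (pr (p1 z) (p2 z)))" by (intro cf_intros)
  from cf_comp[OF cf_unpack[OF cf_F, of n] this] show ?thesis
    unfolding numerator_def by (intro cf_intros) simp
qed

lemma cf_stage: "cf (\<lambda>\<delta> m. stage p F m (unpack n \<delta>))"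
proof -
  note num = cf_curry[where g = "\<lambda>\<delta> m k. numerator F k m (unpack n \<delta>)", OF cf_numerator]
  show ?thesis
    unfolding stage_def by (cases p) (simp_all only: trigger.simps, (intro cf_intros num)+)
qed

lemma capprox_M: "capprox (\<lambda>\<delta> m. M m (unpack n \<delta>))"
  unfolding capprox_def
  by (intro exI conjI, rule cf_numerator[of n]) (simp add: approx_numerator)

lemma capprox_share:
  assumes "capprox x" shows "capprox (\<lambda>\<delta> m. share p (stage p F (Suc (p2 m)) (unpack n \<delta>)) * x \<delta> m)"
proof (cases p)
  case (Upcross c k)
  then have "share p j = (if odd j then 1 / 2 ^ 0 else 0)" for j by simp
  then show ?thesis
    by (simp only:) (rule capprox_scale[OF assms]; intro cf_intros cf_comp[OF cf_stage])
next
  case (Unbounded c)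
  then have "share p j = (if True then 1 / 2 ^ j else 0)" for j by simp
  then show ?thesis
    by (simp only:) (rule capprox_scale[OF assms]; intro cf_intros cf_comp[OF cf_stage])
qed

text \<open>With \<open>n = 0\<close> the whole sequence sits in the compact argument of
  \<open>combine\<close>, so approximability yields uniform continuity.\<close>

lemma ucont_M: "ucont (M m)"
  using ucont_capprox[OF capprox_M[of 0], where \<gamma> = "\<lambda>_. False" and \<sigma> = "[]" and i = m] by (simp add: overwrite_def)

lemma stage_local: "\<exists>l. \<forall>\<omega> \<omega>'. agree2 l \<omega> \<omega>' \<longrightarrow> stage p F m \<omega> = stage p F m \<omega>'"
proof -
  obtain L where L: "\<And>\<gamma> x \<alpha> \<beta>. agree (L \<gamma> x) \<alpha> \<beta> \<Longrightarrow>
      stage p F x (unpack 0 (combine \<gamma> \<alpha>)) = stage p F x (unpack 0 (combine \<gamma> \<beta>))"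
    using modulus_exists[OF cf_stage[of p 0]] by blast
  have "stage p F m \<omega> = stage p F m \<omega>'" if "agree2 (L (\<lambda>_. False) m) \<omega> \<omega>'" for \<omega> \<omega>'
    using L[OF agree_join[OF that]] by simp
  then show ?thesis by blast
qed

lemma cond_expect_M: "m \<le> n \<Longrightarrow> cond_expect m (M n) \<omega> = M m \<omega>"
  using doob by (intro cond_expect_everywhere ucont_M) (simp add: doob_martingale_def)

text \<open>Switching stages at the price \<open>M m\<close> requires no new money by
  \<open>trigger_self_financing\<close>, and the move to \<open>M (Suc m)\<close> changes both sides
  by the same amount.\<close>

lemma wealth_ge_cash:
  assumes "share p 0 * M 0 \<omega> + cash p 0 \<le> real (capital p)"
  shows "share p (stage p F m \<omega>) * M m \<omega> + cash p (stage p F m \<omega>) \<le> wealth p F M m \<omega>"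
proof (induction m)
  case 0
  then show ?case using assms by (simp add: wealth_def)
next
  case (Suc m)
  let ?j = "stage p F m \<omega>" and ?j' = "stage p F (Suc m) \<omega>"
  have "share p ?j' * M m \<omega> + cash p ?j' \<le> share p ?j * M m \<omega> + cash p ?j"
    using trigger_self_financing[OF _ approx_numerator nonneg] by (simp add: stage_Suc)
  then have "share p ?j' * M m \<omega> + cash p ?j' \<le> wealth p F M m \<omega>" using Suc by linarith
  then show ?case by (simp add: wealth_def algebra_simps)
qed

lemma wealth_ge_level:
  assumes "share p 0 * M 0 \<omega> + cash p 0 \<le> real (capital p)"
  shows "level p (stage p F m \<omega>) \<le> wealth p F M m \<omega>"
proof -
  have "0 \<le> share p (stage p F m \<omega>) * M m \<omega>" using share_bounds nonneg by simp
  then show ?thesis using wealth_ge_cash[OF assms, of m] level_le_cash[of p "stage p F m \<omega>"] by linarith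
qed

lemma ucont_share:
  assumes "ucont f" shows "ucont (\<lambda>\<omega>. share p (stage p F m \<omega>) * f \<omega>)"
proof -
  obtain l where "\<And>\<omega> \<omega>'. agree2 l \<omega> \<omega>' \<Longrightarrow> stage p F m \<omega> = stage p F m \<omega>'"
    using stage_local by blast
  then have "\<And>\<omega> \<omega>'. agree2 l \<omega> \<omega>' \<Longrightarrow> share p (stage p F m \<omega>) = share p (stage p F m \<omega>')" by metis
  then show ?thesis by (rule ucont_mult[where c = 1]) (use share_bounds assms in auto)
qed

lemma ucont_wealth: "ucont (wealth p F M m)"
  unfolding wealth_def by (intro ucont_add ucont_const ucont_sum ucont_share ucont_diff ucont_M)

lemma wealth_rows:
  assumes "\<And>i. i < m \<Longrightarrow> \<omega> i = \<omega>' i" shows "wealth p F M m \<omega> = wealth p F M m \<omega>'"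
  unfolding wealth_def
proof (intro arg_cong2[where f = "(+)"] sum.cong refl)
  fix j assume "j \<in> {..<m}"
  then have "stage p F (Suc j) \<omega> = stage p F (Suc j) \<omega>'" "M (Suc j) \<omega> = M (Suc j) \<omega>'" "M j \<omega> = M j \<omega>'"
    using assms by (auto intro!: stage_rows M_rows)
  then show "share p (stage p F (Suc j) \<omega>) * (M (Suc j) \<omega> - M j \<omega>) =
    share p (stage p F (Suc j) \<omega>') * (M (Suc j) \<omega>' - M j \<omega>')" by simp
qed

lemma cond_expect_wealth: "cond_expect n (wealth p F M (Suc n)) \<omega> = wealth p F M n \<omega>"
proof -
  let ?s = "share p (stage p F (Suc n) \<omega>)"
  have "wealth p F M (Suc n) (splice n \<omega> \<xi>) =
      wealth p F M n \<omega> + ?s * (M (Suc n) (splice n \<omega> \<xi>) - M n \<omega>)" for \<xi>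
  proof -
    have "wealth p F M n (splice n \<omega> \<xi>) = wealth p F M n \<omega>" "M n (splice n \<omega> \<xi>) = M n \<omega>"
      "stage p F (Suc n) (splice n \<omega> \<xi>) = stage p F (Suc n) \<omega>"
      by (auto intro!: wealth_rows M_rows stage_rows simp: splice_def)
    then show ?thesis by (simp add: wealth_def)
  qed
  then have "cond_expect n (wealth p F M (Suc n)) \<omega> =
      (\<integral>\<xi>. wealth p F M n \<omega> + ?s * (M (Suc n) (splice n \<omega> \<xi>) - M n \<omega>) \<partial>U)"
    by (simp add: cond_expect_def)
  also have "\<dots> = wealth p F M n \<omega> + ?s * (cond_expect n (M (Suc n)) \<omega> - M n \<omega>)"
    using ucont_integrable[OF ucont_splice[OF ucont_M]] U.prob_space by (simp add: cond_expect_def)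
  finally show ?thesis by (simp add: cond_expect_M)
qed

lemma continuous_martingale_wealth:
  assumes "\<And>\<omega>. share p 0 * M 0 \<omega> + cash p 0 \<le> real (capital p)"
  shows "continuous_martingale (wealth p F M)"
  unfolding continuous_martingale_def
  using order_trans[OF level_nonneg wealth_ge_level[OF assms]]
  by (auto intro!: ucont_wealth cond_expect_wealth wealth_rows)

text \<open>Purchases and sales are summed separately, because only nonnegative reals are
  approximated; the difference is nonnegative by the lower bound through
  \<open>level\<close>.\<close>

lemma capprox_wealth:
  assumes "\<And>\<omega>. share p 0 * M 0 \<omega> + cash p 0 \<le> real (capital p)"
  shows "capprox (\<lambda>\<delta> m. wealth p F M m (unpack n \<delta>))"
proof -
  let ?s = "\<lambda>\<delta> j. share p (stage p F (Suc j) (unpack n \<delta>))"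
  let ?a = "\<lambda>\<delta> m. real (capital p) + (\<Sum>j<m. ?s \<delta> j * M (Suc j) (unpack n \<delta>))"
  let ?b = "\<lambda>\<delta> m. \<Sum>j<m. ?s \<delta> j * M j (unpack n \<delta>)"
  have eq: "wealth p F M m (unpack n \<delta>) = ?a \<delta> m - ?b \<delta> m" for m \<delta>
    by (simp add: wealth_def right_diff_distrib sum_subtractf)
  have a: "capprox ?a"
    by (intro capprox_add capprox_nat cf_intros capprox_sum capprox_share capprox_comp[OF capprox_M])
  have b: "capprox ?b"
    by (intro cf_intros capprox_sum capprox_share capprox_comp[OF capprox_M])
  have "?b \<delta> m \<le> ?a \<delta> m" for \<delta> m
    using wealth_ge_level[OF assms, of m "unpack n \<delta>"] level_nonneg[of p] unfolding eq
    by (meson order_trans diff_ge_0_iff_ge)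
  from capprox_diff[OF a b this] show ?thesis unfolding eq .
qed

text \<open>Divergence means that \<open>M\<close> is unbounded along \<omega>, or that it is
  bounded and oscillates across an interval infinitely often. Each case has its strategy, and a
  stage that stopped would contradict it.\<close>

lemma stage_unbounded:
  assumes "\<not> convergent (\<lambda>n. M n \<omega>)"
  shows "\<exists>p. (\<forall>\<xi>. share p 0 * M 0 \<xi> + cash p 0 \<le> real (capital p)) \<and> (\<forall>J. \<exists>m. J \<le> stage p F m \<omega>)"
proof (cases "\<exists>B. \<forall>n. M n \<omega> \<le> B")
  case False
  obtain c where c: "M 0 \<omega> \<le> real c" using real_arch_simple by blast
  \<comment> \<open>\<open>M 0\<close> reads no row, so a bound at \<omega> is a bound
    everywhere.\<close>
  have M0: "M 0 \<xi> \<le> real c" for \<xi> using c M_rows[of 0 \<xi> \<omega>] by simp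
  let ?p = "Unbounded c"
  have "\<exists>m. J \<le> stage ?p F m \<omega>" for J
  proof (induction J)
    case (Suc J)
    then obtain m where m: "J \<le> stage ?p F m \<omega>" by blast
    show ?case
    proof (rule ccontr)
      assume "\<nexists>m. Suc J \<le> stage ?p F m \<omega>"
      then have st: "stage ?p F n \<omega> \<le> J" for n by (simp add: not_less_eq_eq)
      have stJ: "stage ?p F n \<omega> = J" if "m \<le> n" for n
        using st[of n] m stage_mono[OF that, of ?p F \<omega>] by simp
      have "M n \<omega> \<le> 2 ^ Suc J + 2" if "m \<le> n" for n
      proof -
        have "\<not> trigger ?p J (numerator F 0 n \<omega>)"
          using stJ[OF that] stJ[of "Suc n"] that by (simp add: stage_Suc split: if_splits)
        then have "numerator F 0 n \<omega> \<le> 2 ^ Suc J + 1" by simp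
        then have "real (numerator F 0 n \<omega>) \<le> real (2 ^ Suc J + 1)" by (rule of_nat_mono)
        then show ?thesis using approx_numerator[of 0 n \<omega>] by (simp add: approx_iff)
      qed
      moreover have "M n \<omega> \<le> (\<Sum>i<m. M i \<omega>)" if "n < m" for n
        using that nonneg by (intro member_le_sum) auto
      ultimately have "M n \<omega> \<le> max (2 ^ Suc J + 2) (\<Sum>i<m. M i \<omega>)" for n
        by (meson le_max_iff_disj not_le)
      with False show False by blast
    qed
  qed simp
  then show ?thesis using M0 by (intro exI[of _ ?p]) auto
next
  case True
  then obtain B where B: "\<And>n. M n \<omega> \<le> B" by blast
  define l u where "l = liminf (\<lambda>n. ereal (M n \<omega>))" and "u = limsup (\<lambda>n. ereal (M n \<omega>))"
  have l0: "0 \<le> l" unfolding l_def by (intro Liminf_bounded) (simp add: nonneg)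
  have uB: "u \<le> ereal B" unfolding u_def by (intro Limsup_bounded) (simp add: B)
  have lu: "l \<le> u" unfolding l_def u_def by (intro Liminf_le_Limsup) simp
  have "l \<noteq> u"
  proof
    assume "l = u"
    obtain r where r: "u = ereal r" using l0 lu uB by (cases u) auto
    have "(\<lambda>n. ereal (M n \<omega>)) \<longlonglongrightarrow> ereal r"
      using \<open>l = u\<close> r unfolding l_def u_def by (intro Liminf_eq_Limsup) auto
    then have "(\<lambda>n. M n \<omega>) \<longlonglongrightarrow> r" by simp
    with assms show False by (auto simp: convergent_def)
  qed
  with lu have "l < u" by simp
  then obtain a where a: "l < ereal a" "ereal a < u" using ereal_dense2 by blast
  then obtain b where b: "ereal a < ereal b" "ereal b < u" using ereal_dense2 by blast
  have ab: "a < b" using b by simp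
  have fa: "\<exists>n\<ge>m. M n \<omega> < a" for m
  proof (rule ccontr)
    assume "\<not> (\<exists>n\<ge>m. M n \<omega> < a)"
    then have "ereal a \<le> l" unfolding l_def
      by (intro Liminf_bounded eventually_sequentiallyI[of m]) (auto simp: not_less)
    with a show False by simp
  qed
  have fb: "\<exists>n\<ge>m. b < M n \<omega>" for m
  proof (rule ccontr)
    assume "\<not> (\<exists>n\<ge>m. b < M n \<omega>)"
    then have "u \<le> ereal b" unfolding u_def
      by (intro Limsup_bounded eventually_sequentiallyI[of m]) (auto simp: not_less)
    with b show False by simp
  qed
  have "0 < a" using l0 a by (metis ereal_less(2) le_less_trans)
  \<comment> \<open>The scaled gap has to pay for rounding \<open>c\<close> up (1), the gap in the
    trigger (3) and the error of the selling price (1); 6 exceeds the total.\<close>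
  obtain k where k: "6 / (b - a) < 2 ^ k" using real_arch_pow[of 2 "6 / (b - a)"] by auto
  then have k': "6 < 2 ^ k * (b - a)" using ab by (simp add: field_simps)
  \<comment> \<open>Strictly above \<open>2 ^ k * a\<close>: a price below \<open>a\<close> then has
    a numerator below \<open>c + 1\<close>, hence at most \<open>c\<close>.\<close>
  define c where "c = nat \<lfloor>2 ^ k * a\<rfloor> + 1"
  have c: "real c \<le> 2 ^ k * a + 1" "2 ^ k * a < real c"
    using \<open>0 < a\<close> unfolding c_def by (simp_all add: of_nat_nat) linarith+
  let ?p = "Upcross c k"
  have "\<exists>m. J \<le> stage ?p F m \<omega>" for J
  proof (induction J)
    case (Suc J)
    then obtain m where m: "J \<le> stage ?p F m \<omega>" by blast
    have "\<exists>n\<ge>m. trigger ?p J (numerator F k n \<omega>)"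
    proof (cases "even J")
      case True
      obtain n where n: "m \<le> n" "M n \<omega> < a" using fa by blast
      have "real (numerator F k n \<omega>) - 1 \<le> 2 ^ k * M n \<omega>"
        using approx_numerator[of k n \<omega>] by (simp add: approx_iff)
      also have "\<dots> < 2 ^ k * a" using n(2) by simp
      finally have "real (numerator F k n \<omega>) < real c + 1" using c by linarith
      then have "numerator F k n \<omega> \<le> c" by linarith
      then show ?thesis using True n(1) by auto
    next
      case False
      obtain n where n: "m \<le> n" "b < M n \<omega>" using fb by blast
      have "2 ^ k * b < 2 ^ k * M n \<omega>" using n(2) by simp
      also have "\<dots> \<le> real (numerator F k n \<omega>) + 1"
        using approx_numerator[of k n \<omega>] by (simp add: approx_iff)
      finally have "real c + 3 \<le> real (numerator F k n \<omega>)"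
        using c(1) k' unfolding right_diff_distrib by linarith
      then have "c + 3 \<le> numerator F k n \<omega>" by linarith
      then show ?thesis using False n(1) by auto
    qed
    then obtain n where n: "m \<le> n" "trigger ?p J (numerator F k n \<omega>)" by blast
    have "J \<le> stage ?p F n \<omega>" using m stage_mono[OF n(1), of ?p F \<omega>] by simp
    then have "Suc J \<le> stage ?p F (Suc n) \<omega>"
      using n(2) by (cases "stage ?p F n \<omega> = J") (simp_all add: stage_Suc)
    then show ?case by blast
  qed simp
  moreover have "(real c + 1) / 2 ^ k \<le> real c + 1" by (simp add: divide_le_eq)
  ultimately show ?thesis by (intro exI[of _ ?p]) auto
qed

end

section \<open>From Doob martingales to martingales on strings\<close>

lemma limsup_eq_infinity:
  assumes "\<And>B. \<exists>L. \<forall>n\<ge>L. B \<le> f n" shows "limsup (\<lambda>n. ereal (f n)) = \<infinity>"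
proof -
  have "filterlim f at_top sequentially"
    unfolding filterlim_at_top eventually_sequentially using assms by blast
  then have "(\<lambda>n. ereal (f n)) \<longlonglongrightarrow> \<infinity>" by (simp add: tendsto_PInfty_eq_at_top)
  then show ?thesis by (intro lim_imp_Limsup) auto
qed

text \<open>The bits of \<open>\<sigma>\<close> lie in rows below \<open>L\<close>, because \<open>m \<le> prod_encode (m, i)\<close>.\<close>

lemma tail_integral_stable:
  assumes N: "continuous_martingale N" and L: "length \<sigma> \<le> L"
  shows "tail_integral (\<lambda>\<alpha>. N (Suc (n + L)) (unpack n (combine \<gamma> \<alpha>))) \<sigma> =
    tail_integral (\<lambda>\<alpha>. N (n + L) (unpack n (combine \<gamma> \<alpha>))) \<sigma>"
proof -
  define h where "h \<xi> = unpack n (combine \<gamma> (overwrite \<sigma> (join \<xi>)))" for \<xi>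
  have ag: "agree2 l (h \<xi>) (h \<xi>')" if "agree2 l \<xi> \<xi>'" for l \<xi> \<xi>'
    using that by (auto simp: h_def agree2_def unpack_combine splice_def overwrite_def join_def)
  have uc: "ucont (\<lambda>\<xi>. N (Suc (n + L)) (h \<xi>))"
    using N by (intro ucont_compose[OF _ ag]) (simp add: continuous_martingale_def)
  have "h (splice L \<xi> \<xi>') = splice (n + L) (h \<xi>) \<xi>'" for \<xi> \<xi>'
  proof (intro ext)
    fix m i
    have "m - n \<le> pr (m - n) i" by (rule le_prod_encode_1)
    then show "h (splice L \<xi> \<xi>') m i = splice (n + L) (h \<xi>) \<xi>' m i"
      using L by (auto simp: h_def unpack_combine splice_def overwrite_def join_def)
  qed
  then have "cond_expect L (\<lambda>\<xi>. N (Suc (n + L)) (h \<xi>)) \<xi> = N (n + L) (h \<xi>)" for \<xi>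
    using N by (simp add: cond_expect_def continuous_martingale_def)
  then have "(\<integral>\<xi>. N (n + L) (h \<xi>) \<partial>U) = (\<integral>\<xi>. N (Suc (n + L)) (h \<xi>) \<partial>U)"
    using integral_cond_expect[OF uc, of L] by simp
  then show ?thesis by (simp add: tail_integral_def h_def)
qed

lemma ecu_random_imp_doob_random:
  assumes "ecu_random \<omega>" shows "doob_random \<omega>"
  unfolding doob_random_def
proof (intro allI impI, elim conjE, rule ccontr)
  fix M assume M: "computable_doob_martingale M" "\<forall>n \<xi>. 0 \<le> M n \<xi>" and nc: "\<not> convergent (\<lambda>n. M n \<omega>)"
  obtain F where "cf F" "\<forall>n \<omega>. real_name (\<lambda>k. F (tuple_join n \<omega>) (pr n k)) (M n \<omega>)"
    using M(1) unfolding computable_doob_martingale_def by blast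
  then interpret computable_martingale M F
    using M by unfold_locales (auto simp: computable_doob_martingale_def)
  obtain n where n: "computably_random_uniformly_rel (join (tail_from n \<omega>)) (tuple_join n \<omega>)"
    using assms unfolding ecu_random_def by blast
  obtain p where p: "\<And>\<xi>. share p 0 * M 0 \<xi> + cash p 0 \<le> real (capital p)"
    and unb: "\<And>J. \<exists>m. J \<le> stage p F m \<omega>"
    using stage_unbounded[OF nc] by blast
  define N where "N = wealth p F M"
  have N: "continuous_martingale N" unfolding N_def by (rule continuous_martingale_wealth[OF p])
  have ucN: "ucont (\<lambda>\<xi>. N m (unpack n (combine \<gamma> (overwrite \<sigma> (join \<xi>)))))" for m \<gamma> \<sigma>
    unfolding N_def by (rule ucont_capprox[OF capprox_wealth[OF p]])
  \<comment> \<open>The horizon grows with the string. By \<open>tail_integral_stable\<close>,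
    moving it one step further does not change the mean, which reconciles a string with its one-bit
    extensions.\<close>
  define d where "d \<gamma> \<sigma> = tail_integral (\<lambda>\<alpha>. N (n + length \<sigma>) (unpack n (combine \<gamma> \<alpha>))) \<sigma>" for \<gamma> \<sigma>
  have mart: "nonneg_martingale (d \<gamma>)" for \<gamma>
    unfolding nonneg_martingale_def
  proof (intro conjI allI)
    fix \<sigma>
    show "0 \<le> d \<gamma> \<sigma>" unfolding d_def tail_integral_def
      using N by (intro integral_ge ucN) (simp add: continuous_martingale_def)
    show "d \<gamma> \<sigma> = (d \<gamma> (\<sigma> @ [False]) + d \<gamma> (\<sigma> @ [True])) / 2"
      using tail_integral_stable[OF N, of \<sigma> "length \<sigma>" n \<gamma>]
        tail_integral_split[where f = "\<lambda>\<alpha>. N (Suc (n + length \<sigma>)) (unpack n (combine \<gamma> \<alpha>))" and \<sigma> = \<sigma>, OF ucN]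
      by (simp add: d_def)
  qed
  have "cf (\<lambda>\<gamma> c. pr c (n + code_length c))" by (intro cf_intros)
  from capprox_comp[OF capprox_tail_integral[OF capprox_wealth[OF p, of n]] this]
  obtain G where G: "cf G" "\<And>\<gamma> c k. approx (G \<gamma> (pr c k)) k
      (tail_integral (\<lambda>\<alpha>. N (n + code_length c) (unpack n (combine \<gamma> \<alpha>))) (code_string c))"
    unfolding capprox_def N_def by auto
  \<comment> \<open>Doubling turns a natural numerator into its code as an integer.\<close>
  have names: "martingale_name (\<lambda>x. 2 * G \<gamma> x) (d \<gamma>)" for \<gamma>
    unfolding martingale_name_def real_name_def d_def
    using G(2)[of \<gamma> "string_code \<sigma>" for \<sigma>] by (simp add: approx_def)
  have "cf (\<lambda>\<gamma> x. 2 * G \<gamma> x)" by (intro cf_intros G)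
  moreover have "succeeds_on (d (tuple_join n \<omega>)) (join (tail_from n \<omega>))"
    unfolding succeeds_on_def
  proof (rule limsup_eq_infinity)
    fix B
    obtain J where J: "B \<le> level p J" using level_unbounded by blast
    obtain m where m: "J \<le> stage p F m \<omega>" using unb by blast
    obtain l where l: "\<And>\<omega> \<omega>'. agree2 l \<omega> \<omega>' \<Longrightarrow> stage p F m \<omega> = stage p F m \<omega>'"
      using stage_local by blast
    \<comment> \<open>From \<open>K\<close> bits of the join on, the square of side \<open>l\<close>
      that decides the stage at time \<open>m\<close> is fixed, so the whole cylinder shares this
      stage; \<open>m\<close> is added to the bound so that the horizon is not before
      \<open>m\<close>.\<close>
    have "finite (case_prod pr ` ({..<l} \<times> {..<l}))" by simp
    then obtain K where "\<forall>k \<in> case_prod pr ` ({..<l} \<times> {..<l}). k < K"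
      unfolding finite_nat_set_iff_bounded by blast
    then have K: "pr i j < K" if "i < l" "j < l" for i j using that by force
    have "B \<le> d (tuple_join n \<omega>) (initial_segment (join (tail_from n \<omega>)) L)" if L: "max K m \<le> L" for L
    proof -
      let ?\<sigma> = "initial_segment (join (tail_from n \<omega>)) L"
      have len: "length ?\<sigma> = L" by (simp add: initial_segment_def)
      let ?h = "\<lambda>\<xi>. unpack n (combine (tuple_join n \<omega>) (overwrite ?\<sigma> (join \<xi>)))"
      have "B \<le> N (n + L) (?h \<xi>)" for \<xi>
      proof -
        have "agree2 l \<omega> (?h \<xi>)" unfolding agree2_def
        proof (intro allI impI)
          fix i j assume ij: "i < l" "j < l"
          then have "pr (i - n) j < L" using K[of "i - n" j] L by (simp add: less_imp_diff_less)
          then show "\<omega> i j = ?h \<xi> i j"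
            by (simp add: unpack_combine splice_rows) (simp add: splice_def overwrite_def initial_segment_def join_def tail_from_def)
        qed
        from l[OF this] have "J \<le> stage p F m (?h \<xi>)" using m by simp
        also have "\<dots> \<le> stage p F (n + L) (?h \<xi>)" using L by (intro stage_mono) simp
        finally have "level p J \<le> level p (stage p F (n + L) (?h \<xi>))" by (rule level_mono)
        also have "\<dots> \<le> N (n + L) (?h \<xi>)" unfolding N_def by (rule wealth_ge_level[OF p])
        finally show ?thesis using J by simp
      qed
      then show ?thesis unfolding d_def tail_integral_def len by (intro integral_ge ucN)
    qed
    then show "\<exists>L. \<forall>k\<ge>L. B \<le> d (tuple_join n \<omega>) (initial_segment (join (tail_from n \<omega>)) k)" by blast
  qed
  ultimately show False
    using n mart names unfolding computably_random_uniformly_rel_def by blast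
qed

section \<open>Diagonalization\<close>

datatype recursive_code = Zero_code | Succ_code | Left_code | Right_code | Oracle_code
  | Pair_code recursive_code recursive_code | Comp_code recursive_code recursive_code
  | Prec_code recursive_code recursive_code | Mu_code recursive_code

instance recursive_code :: countable by countable_datatype

primrec decode :: "recursive_code \<Rightarrow> cantor \<Rightarrow> nat \<Rightarrow> nat option" where
  "decode Zero_code = (\<lambda>\<gamma> x. Some 0)"
| "decode Succ_code = (\<lambda>\<gamma> x. Some (Suc x))"
| "decode Left_code = (\<lambda>\<gamma> x. Some (fst (prod_decode x)))"
| "decode Right_code = (\<lambda>\<gamma> x. Some (snd (prod_decode x)))"
| "decode Oracle_code = (\<lambda>\<gamma> x. Some (of_bool (\<gamma> x)))"
| "decode (Pair_code c d) = (\<lambda>\<gamma> x.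
     Option.bind (decode c \<gamma> x) (\<lambda>y. Option.bind (decode d \<gamma> x) (\<lambda>z. Some (pr y z))))"
| "decode (Comp_code c d) = (\<lambda>\<gamma> x. Option.bind (decode d \<gamma> x) (decode c \<gamma>))"
| "decode (Prec_code c d) = (\<lambda>\<gamma> x. rec_nat (decode c \<gamma> (p1 x))
     (\<lambda>m r. Option.bind r (\<lambda>y. decode d \<gamma> (pr (p1 x) (pr m y)))) (p2 x))"
| "decode (Mu_code c) = (\<lambda>\<gamma> x.
     if \<exists>n. decode c \<gamma> (pr x n) = Some 0 \<and> (\<forall>m<n. decode c \<gamma> (pr x m) \<noteq> None)
     then Some (LEAST n. decode c \<gamma> (pr x n) = Some 0) else None)"

lemma countable_cf: "countable {F. cf F}"
proof -
  have "\<Phi> \<in> range decode" if "partial_recursive \<Phi>" for \<Phi>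
    using that
  proof (induction rule: partial_recursive.induct)
    case zero show ?case by (rule range_eqI[of _ _ Zero_code]) simp
  next
    case succ show ?case by (rule range_eqI[of _ _ Succ_code]) simp
  next
    case left show ?case by (rule range_eqI[of _ _ Left_code]) simp
  next
    case right show ?case by (rule range_eqI[of _ _ Right_code]) simp
  next
    case orac show ?case by (rule range_eqI[of _ _ Oracle_code]) simp
  next
    case (pair f g)
    then obtain c d where "f = decode c" "g = decode d" by blast
    then show ?case by (intro range_eqI[of _ _ "Pair_code c d"]) simp
  next
    case (comp f g)
    then obtain c d where "f = decode c" "g = decode d" by blast
    then show ?case by (intro range_eqI[of _ _ "Comp_code c d"]) simp
  next
    case (prec f g)
    then obtain c d where "f = decode c" "g = decode d" by blast
    then show ?case by (intro range_eqI[of _ _ "Prec_code c d"]) simp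
  next
    case (mu f)
    then obtain c where "f = decode c" by blast
    then show ?case by (intro range_eqI[of _ _ "Mu_code c"]) (simp only: decode.simps)
  qed
  then have code: "(\<lambda>\<gamma> x. Some (F \<gamma> x)) \<in> range decode" if "cf F" for F
    using that unfolding cf_iff .
  have "{F. cf F} \<subseteq> (\<lambda>\<Phi> \<gamma> x. the (\<Phi> \<gamma> x)) ` range decode"
  proof
    fix F assume "F \<in> {F. cf F}"
    then show "F \<in> (\<lambda>\<Phi> \<gamma> x. the (\<Phi> \<gamma> x)) ` range decode"
      by (intro image_eqI[OF _ code]) simp_all
  qed
  then show ?thesis by (rule countable_subset) simp
qed

text \<open>The empty tuple is coded by the zero oracle, at which a uniform family yields a
  computable martingale.\<close>

lemma computably_random_seq_imp_ecu_random:
  assumes "computably_random_seq \<omega>" shows "ecu_random \<omega>"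
proof -
  have "tuple_join 0 \<omega> = (\<lambda>_. False)" by (simp add: tuple_join_def fun_eq_iff)
  moreover have "computable (F (\<lambda>_. False))" if "cf F" for F
    using that unfolding computable_def computable_functional_def by blast
  ultimately have "computably_random_uniformly_rel (join (tail_from 0 \<omega>)) (tuple_join 0 \<omega>)"
    using assms unfolding computably_random_uniformly_rel_def computably_random_seq_def
      computably_random_def tail_from_def by auto
  then show ?thesis unfolding ecu_random_def by blast
qed

section \<open>Doubling on zeros in row 0\<close>

definition in_row0 :: "nat \<Rightarrow> nat \<Rightarrow> bool" where
  "in_row0 c i \<longleftrightarrow> p1 i = 0 \<and> c \<le> p2 i"

definition row0_hit :: "nat \<Rightarrow> bool list \<Rightarrow> bool" where
  "row0_hit c \<sigma> \<longleftrightarrow> (\<exists>i<length \<sigma>. in_row0 c i \<and> \<sigma> ! i)"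

text \<open>The capital of a gambler who stakes everything on zero at each position of row 0 from
  column \<open>c\<close> on. The values are natural numbers, so exact names are at hand.\<close>

definition row0_bet :: "nat \<Rightarrow> bool list \<Rightarrow> nat" where
  "row0_bet c \<sigma> = (if row0_hit c \<sigma> then 0
     else 2 ^ (\<Sum>i<length \<sigma>. of_bool (in_row0 c i)))"

lemma nonneg_martingale_row0_bet: "nonneg_martingale (\<lambda>\<sigma>. real (row0_bet c \<sigma>))"
proof -
  have "row0_hit c (\<sigma> @ [b]) \<longleftrightarrow> row0_hit c \<sigma> \<or> in_row0 c (length \<sigma>) \<and> b" for \<sigma> b
    unfolding row0_hit_def length_append_singleton Ex_less_Suc by (auto simp: nth_append)
  note hit = this
  have "row0_bet c (\<sigma> @ [b]) = (if in_row0 c (length \<sigma>) then if b then 0 else 2 * row0_bet c \<sigma> else row0_bet c \<sigma>)"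
    for \<sigma> b
    by (simp add: row0_bet_def hit del: sum_of_bool_eq)
  then have "real (row0_bet c \<sigma>) = (real (row0_bet c (\<sigma> @ [False])) + real (row0_bet c (\<sigma> @ [True]))) / 2" for \<sigma>
    by simp
  then show ?thesis unfolding nonneg_martingale_def by auto
qed

lemma row0_bet_name:
  "\<exists>F. cf F \<and> (\<forall>\<gamma>. martingale_name (F \<gamma>) (\<lambda>\<sigma>. real (row0_bet c \<sigma>)))"
proof (intro exI conjI allI)
  define H where "H z = (if \<exists>i<code_length z. in_row0 c i \<and> code_nth z i \<noteq> 0 then 0
      else 2 ^ (\<Sum>i<code_length z. of_bool (in_row0 c i)) :: nat)" for z
  have H: "H (string_code \<sigma>) = row0_bet c \<sigma>" for \<sigma>
  proof -
    have "(\<exists>i<length \<sigma>. in_row0 c i \<and> code_nth (string_code \<sigma>) i \<noteq> 0) \<longleftrightarrow> row0_hit c \<sigma>"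
      by (auto simp: row0_hit_def)
    then show ?thesis by (simp only: H_def row0_bet_def code_length_string)
  qed
  show "cf (\<lambda>\<gamma> x. 2 * (H (p1 x) * 2 ^ p2 x))"
    unfolding H_def in_row0_def by (intro cf_intros)
  show "martingale_name (\<lambda>x. 2 * (H (p1 x) * 2 ^ p2 x)) (\<lambda>\<sigma>. real (row0_bet c \<sigma>))"
    unfolding martingale_name_def real_name_def by (simp add: H)
qed

lemma row0_bet_succeeds:
  assumes "\<And>i. c \<le> i \<Longrightarrow> \<not> \<alpha> (pr 0 i)" shows "succeeds_on (\<lambda>\<sigma>. real (row0_bet c \<sigma>)) \<alpha>"
  unfolding succeeds_on_def
proof (rule limsup_eq_infinity)
  fix B :: real
  obtain j where j: "B \<le> real j" using real_arch_simple by blast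
  let ?A = "(\<lambda>i. pr 0 (c + i)) ` {..<j}"
  obtain K where K: "\<forall>k\<in>?A. k < K" using finite_nat_set_iff_bounded[of ?A] by auto
  have "B \<le> real (row0_bet c (initial_segment \<alpha> n))" if n: "K \<le> n" for n
  proof -
    have An: "k < n" if "k \<in> ?A" for k using K n that by (meson less_le_trans)
    have "\<not> \<alpha> i" if "in_row0 c i" for i
      using assms[of "p2 i"] that by (metis in_row0_def prod.collapse prod_decode_inverse)
    then have "row0_bet c (initial_segment \<alpha> n) = 2 ^ (\<Sum>i<n. of_bool (in_row0 c i))"
      by (auto simp: row0_bet_def row0_hit_def initial_segment_def)
    also have "(\<Sum>i<n. of_bool (in_row0 c i)) = card ({..<n} \<inter> {i. in_row0 c i})" by simp
    also have "card ?A \<le> card ({..<n} \<inter> {i. in_row0 c i})"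
      using An by (intro card_mono) (auto simp: in_row0_def)
    then have "j \<le> card ({..<n} \<inter> {i. in_row0 c i})" by (simp add: card_image inj_on_def)
    then have "(2::nat) ^ j \<le> 2 ^ card ({..<n} \<inter> {i. in_row0 c i})" by (intro power_increasing) auto
    finally have "2 ^ j \<le> row0_bet c (initial_segment \<alpha> n)" .
    then have "j \<le> row0_bet c (initial_segment \<alpha> n)" using less_exp[of j] by linarith
    then show ?thesis using j by linarith
  qed
  then show "\<exists>L. \<forall>n\<ge>L. B \<le> real (row0_bet c (initial_segment \<alpha> n))" by blast
qed

text \<open>Each \<open>N i\<close> joins the weighted sum at step \<open>i\<close> with contribution at most \<open>1 / 2 ^ i\<close>, so the sum
  can be kept below \<open>4\<close>.\<close>

lemma diagonal_sequence:
  fixes N :: "nat \<Rightarrow> 'a list \<Rightarrow> real"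
  assumes nonneg: "\<And>i h. 0 \<le> N i h"
    and ext: "\<And>c h e n. (\<And>i. 0 \<le> c i) \<Longrightarrow> 0 < e \<Longrightarrow>
      \<exists>x. Q x \<and> (\<Sum>i<n. c i * N i (h @ [x])) \<le> (\<Sum>i<n. c i * N i h) + e"
  shows "\<exists>X. (\<forall>n. Q (X n)) \<and> (\<forall>i. \<exists>B. \<forall>n>i. N i (map X [0..<n]) \<le> B)"
proof -
  \<comment> \<open>The weight of \<open>N i\<close> depends on the prefix of length
    \<open>i\<close> alone, so it stays frozen while the list grows.\<close>
  define c where "c h i = 1 / (2 ^ i * (1 + N i (take i h)))" for h i
  define V where "V h = (\<Sum>i<length h. c h i * N i h)" for h
  have pos: "0 < 1 + N i h" for i h using nonneg[of i h] by linarith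
  then have c_pos: "0 < c h i" for h i by (simp add: c_def)
  have "\<exists>x. Q x \<and> V (h @ [x]) \<le> V h + 2 / 2 ^ length h" for h
  proof -
    obtain x where x: "Q x" "(\<Sum>i<Suc (length h). c h i * N i (h @ [x])) \<le>
        (\<Sum>i<Suc (length h). c h i * N i h) + 1 / 2 ^ length h"
      using ext[where c = "c h" and e = "1 / 2 ^ length h" and n = "Suc (length h)" and h = h] c_pos
      by (auto simp: less_imp_le simp del: sum.lessThan_Suc)
    have "V (h @ [x]) = (\<Sum>i<Suc (length h). c h i * N i (h @ [x]))"
      unfolding V_def by (intro sum.cong) (auto simp: c_def)
    also note x(2)
    also have "(\<Sum>i<Suc (length h). c h i * N i h) = V h + c h (length h) * N (length h) h"
      by (simp add: V_def)
    also have "c h (length h) * N (length h) h = N (length h) h / (1 + N (length h) h) / 2 ^ length h"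
      by (simp add: c_def)
    also have "\<dots> \<le> 1 / 2 ^ length h"
      using pos[of "length h" h] by (intro divide_right_mono) simp_all
    finally have "V (h @ [x]) \<le> V h + 2 / 2 ^ length h" by simp
    with x(1) show ?thesis by blast
  qed
  then obtain next_elem where ne: "\<And>h. Q (next_elem h)"
    "\<And>h. V (h @ [next_elem h]) \<le> V h + 2 / 2 ^ length h" by metis
  define H where "H = rec_nat [] (\<lambda>_ h. h @ [next_elem h])"
  define X where "X n = next_elem (H n)" for n
  have H: "H n = map X [0..<n]" for n
    by (induction n) (simp_all add: H_def X_def)
  \<comment> \<open>A step from length \<open>n\<close> adds at most \<open>1 / 2 ^ n\<close> for
    the newcomer and \<open>1 / 2 ^ n\<close> for the inexact extension; these increments add up to
    \<open>4 - 4 / 2 ^ n\<close>.\<close>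
  have V: "V (H n) \<le> 4 - 4 / 2 ^ n" for n
  proof (induction n)
    case 0
    show ?case by (simp add: H V_def)
  next
    case (Suc n)
    have "V (H (Suc n)) \<le> V (H n) + 2 / 2 ^ n"
      using ne(2)[of "H n"] by (simp add: H X_def)
    with Suc show ?case by (simp add: field_simps)
  qed
  have "N i (H n) \<le> 4 / c (H i) i" if "i < n" for i n
  proof -
    have "take i (H n) = H i" using that by (simp add: H take_map)
    moreover have "take i (H i) = H i" by (simp add: H)
    ultimately have "c (H n) i = c (H i) i" by (simp add: c_def)
    have "c (H n) i * N i (H n) \<le> V (H n)"
      unfolding V_def using that c_pos nonneg by (intro member_le_sum) (auto simp: H less_imp_le)
    also have "\<dots> \<le> 4" using V[of n] by (smt (verit) divide_nonneg_nonneg zero_le_power)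
    finally show ?thesis using c_pos[of "H i" i] \<open>c (H n) i = c (H i) i\<close>
      by (simp add: pos_le_divide_eq mult.commute)
  qed
  moreover have "Q (X n)" for n unfolding X_def by (rule ne)
  ultimately show ?thesis by (intro exI[of _ X]) (auto simp: H)
qed

text \<open>Countably many martingales have a name computable from the zero oracle. The mean of a
  weighted sum over the two next bits is its present value, so one of the bits does not increase
  it.\<close>

lemma exists_computably_random_rel_zero:
  "\<exists>\<alpha>. computably_random_uniformly_rel \<alpha> (\<lambda>_. False)"
proof -
  let ?z = "\<lambda>_. False"
  define S where "S = {d. nonneg_martingale d \<and> (\<exists>F. cf F \<and> martingale_name (F ?z) d)}"
  have uniq: "d = d'" if "martingale_name p d" "martingale_name p d'" for p d d'
    using that unfolding martingale_name_def by (blast intro: real_name_unique)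
  have "S \<subseteq> (\<lambda>F. THE d. martingale_name (F ?z) d) ` {F. cf F}"
  proof
    fix d assume "d \<in> S"
    then obtain F where F: "cf F" "martingale_name (F ?z) d" unfolding S_def by blast
    then have "(THE d. martingale_name (F ?z) d) = d" by (intro the_equality) (auto intro: uniq)
    with F show "d \<in> (\<lambda>F. THE d. martingale_name (F ?z) d) ` {F. cf F}" by force
  qed
  then have S: "countable S" by (rule countable_subset) (simp add: countable_cf)
  have "(\<lambda>\<sigma>. real (row0_bet 0 \<sigma>)) \<in> S"
    unfolding S_def using nonneg_martingale_row0_bet[of 0] row0_bet_name[of 0] by blast
  then have "S \<noteq> {}" by blast
  define N where "N = from_nat_into S"
  have N: "nonneg_martingale (N i)" for i
    using from_nat_into[OF \<open>S \<noteq> {}\<close>, of i] unfolding N_def S_def by blast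
  have "\<exists>x. True \<and> (\<Sum>i<n. c i * N i (h @ [x])) \<le> (\<Sum>i<n. c i * N i h) + e"
    if "0 < e" for c h e n
  proof (rule ccontr)
    assume "\<nexists>x. True \<and> (\<Sum>i<n. c i * N i (h @ [x])) \<le> (\<Sum>i<n. c i * N i h) + e"
    then have *: "(\<Sum>i<n. c i * N i h) + e < (\<Sum>i<n. c i * N i (h @ [x]))" for x
      by (simp add: not_le)
    have "2 * (c i * N i h) = c i * N i (h @ [False]) + c i * N i (h @ [True])" for i
      using N[of i, unfolded nonneg_martingale_def] by (metis distrib_left field_sum_of_halves mult.left_commute mult_2 nonzero_mult_div_cancel_left times_divide_eq_right zero_neq_numeral)
    then have "2 * (\<Sum>i<n. c i * N i h) = (\<Sum>i<n. c i * N i (h @ [False])) + (\<Sum>i<n. c i * N i (h @ [True]))"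
      by (simp add: sum_distrib_left flip: sum.distrib)
    then show False using *[of False] *[of True] \<open>0 < e\<close> by linarith
  qed
  from diagonal_sequence[where Q = "\<lambda>_. True" and N = N, OF _ this]
  obtain \<alpha> where \<alpha>: "\<And>i. \<exists>B. \<forall>n>i. N i (initial_segment \<alpha> n) \<le> B"
    using N unfolding nonneg_martingale_def initial_segment_def by blast
  have "\<not> succeeds_on d \<alpha>" if d: "d \<in> S" for d
  proof -
    obtain i where i: "d = N i" unfolding N_def using from_nat_into_surj[OF S d] by blast
    obtain B where B: "\<And>n. i < n \<Longrightarrow> d (initial_segment \<alpha> n) \<le> B" using \<alpha>[of i] i by blast
    have "limsup (\<lambda>n. ereal (d (initial_segment \<alpha> n))) \<le> ereal B"
      by (intro Limsup_bounded eventually_sequentiallyI[of "Suc i"]) (simp add: B)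
    then show ?thesis unfolding succeeds_on_def by auto
  qed
  then have "computably_random_uniformly_rel \<alpha> ?z"
    unfolding computably_random_uniformly_rel_def S_def by blast
  then show ?thesis by blast
qed

lemma exists_ecu_random_not_computably_random:
  "\<exists>\<omega>. ecu_random \<omega> \<and> \<not> computably_random_seq \<omega>"
proof -
  obtain \<alpha> where \<alpha>: "computably_random_uniformly_rel \<alpha> (\<lambda>_. False)"
    using exists_computably_random_rel_zero by blast
  define \<omega> :: cantor_seq where "\<omega> = case_nat (\<lambda>_. False) (\<lambda>m i. \<alpha> (pr m i))"
  have "join (tail_from 1 \<omega>) = \<alpha>" "tuple_join 1 \<omega> = (\<lambda>_. False)"
    by (auto simp: \<omega>_def join_def tail_from_def tuple_join_def fun_eq_iff case_prod_unfold)
  then have "ecu_random \<omega>" using \<alpha> unfolding ecu_random_def by metis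
  moreover have "succeeds_on (\<lambda>\<sigma>. real (row0_bet 0 \<sigma>)) (join \<omega>)"
    by (rule row0_bet_succeeds) (simp add: join_def \<omega>_def)
  moreover obtain F where F: "cf F" "\<forall>\<gamma>. martingale_name (F \<gamma>) (\<lambda>\<sigma>. real (row0_bet 0 \<sigma>))"
    using row0_bet_name by blast
  moreover have "computable (F (\<lambda>_. False))"
    using F(1) unfolding computable_def computable_functional_def by blast
  ultimately show ?thesis
    using nonneg_martingale_row0_bet unfolding computably_random_seq_def computably_random_def by blast
qed

section \<open>Doob random sequences with eventually zero rows\<close>

definition pad :: "cantor list \<Rightarrow> cantor_seq" where
  "pad h = (\<lambda>i. if i < length h then h ! i else (\<lambda>_. False))"

text \<open>The mean over the next row is the present value of the sum. If every eventually zero row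
  exceeded it by \<open>e\<close>, continuity would put every row at least \<open>e / 2\<close>
  above it, contradicting the mean.\<close>

lemma extend_by_eventually_zero_row:
  fixes E :: "nat \<Rightarrow> nat \<Rightarrow> cantor_seq \<Rightarrow> real"
  assumes E: "\<And>i. continuous_martingale (E i)" and e: "0 < e"
  shows "\<exists>x. (\<exists>b. \<forall>i\<ge>b. \<not> x i) \<and> (\<Sum>i<n. c i * E i (length (h @ [x])) (pad (h @ [x])))
    \<le> (\<Sum>i<n. c i * E i (length h) (pad h)) + e"
proof (rule ccontr)
  let ?K = "length h"
  define f where "f \<omega> = (\<Sum>i<n. c i * E i (Suc ?K) \<omega>)" for \<omega>
  define I where "I = (\<Sum>i<n. c i * E i ?K (pad h))"
  assume "\<not> ?thesis"
  then have gt: "I + e < f (pad (h @ [x]))" if "\<forall>i\<ge>b. \<not> x i" for x b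
    using that by (auto simp: I_def f_def not_le)
  have uE: "ucont (E i m)" for i m using E by (simp add: continuous_martingale_def)
  have uf: "ucont f" unfolding f_def by (intro ucont_sum ucont_cmult uE)
  have "(\<integral>\<xi>. f (splice ?K (pad h) \<xi>) \<partial>U) =
      (\<Sum>i<n. c i * (\<integral>\<xi>. E i (Suc ?K) (splice ?K (pad h) \<xi>) \<partial>U))"
    unfolding f_def using ucont_integrable[OF ucont_splice[OF uE]] by (subst Bochner_Integration.integral_sum) auto
  also have "\<dots> = I"
    using E unfolding I_def by (simp add: continuous_martingale_def cond_expect_def)
  finally have int: "(\<integral>\<xi>. f (splice ?K (pad h) \<xi>) \<partial>U) = I" .
  obtain l where l: "\<And>\<omega> \<omega>'. agree2 l \<omega> \<omega>' \<Longrightarrow> \<bar>f \<omega> - f \<omega>'\<bar> \<le> e / 2"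
    using ucontD[OF uf, of "e / 2"] e by auto
  have "I + e / 2 \<le> f (splice ?K (pad h) \<xi>)" for \<xi>
  proof -
    \<comment> \<open>Row 0 of \<xi> is spliced in directly behind \<open>h\<close>; its truncation
      is an eventually zero candidate for the new row.\<close>
    let ?x = "trunc l \<xi> 0"
    have "f (splice ?K (pad h) (trunc l \<xi>)) = f (pad (h @ [?x]))"
      unfolding f_def
    proof (intro sum.cong refl arg_cong2[where f = "(*)"])
      fix i
      have "\<forall>j<Suc ?K. splice ?K (pad h) (trunc l \<xi>) j = pad (h @ [?x]) j"
        by (auto simp: splice_def pad_def nth_append less_Suc_eq)
      then show "E i (Suc ?K) (splice ?K (pad h) (trunc l \<xi>)) = E i (Suc ?K) (pad (h @ [?x]))"
        using E[of i] unfolding continuous_martingale_def by blast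
    qed
    moreover have "I + e < f (pad (h @ [?x]))" by (rule gt[of l]) (simp add: trunc_def)
    moreover have "\<bar>f (splice ?K (pad h) \<xi>) - f (splice ?K (pad h) (trunc l \<xi>))\<bar> \<le> e / 2"
      by (intro l agree2_splice agree2_trunc) simp
    ultimately show ?thesis by linarith
  qed
  then have "I + e / 2 \<le> I" using integral_ge[OF ucont_splice[OF uf]] int by metis
  with e show False by simp
qed

lemma exists_doob_random_eventually_zero_rows:
  "\<exists>\<omega>. doob_random \<omega> \<and> (\<forall>m. \<exists>b. \<forall>i\<ge>b. \<not> \<omega> m i)"
proof -
  \<comment> \<open>A strategy with too little capital may run into debt, so only the wealth
    processes that are nonnegative martingales are kept.\<close>
  define S where "S = {N. continuous_martingale N \<and> (\<exists>F p M. computable_martingale M F \<and> N = wealth p F M)}"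
  have uniq: "M = M'" if "computable_martingale M F" "computable_martingale M' F" for M M' F
    using computable_martingale.name[OF that(1)] computable_martingale.name[OF that(2)]
    by (blast intro: real_name_unique)
  \<comment> \<open>\<open>F\<close> determines \<open>M\<close>, and strategies form a countable
    type, so the pairs of functional and strategy exhaust \<open>S\<close>.\<close>
  let ?W = "\<lambda>(F, p). wealth p F (THE M. computable_martingale M F)"
  have "S \<subseteq> ?W ` ({F. cf F} \<times> UNIV)"
  proof
    fix N assume "N \<in> S"
    then obtain F p M where M: "computable_martingale M F" "N = wealth p F M" unfolding S_def by blast
    then have "(THE M. computable_martingale M F) = M" by (intro the_equality) (auto intro: uniq)
    with M computable_martingale.cf_F[OF M(1)] show "N \<in> ?W ` ({F. cf F} \<times> UNIV)"
      by (intro image_eqI[of _ _ "(F, p)"]) auto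
  qed
  then have "countable S" by (rule countable_subset) (intro countable_image countable_SIGMA countable_cf, simp)
  \<comment> \<open>The zero process makes the enumerated set nonempty.\<close>
  define E where "E = from_nat_into (insert (\<lambda>_ _. 0) S)"
  have zero: "continuous_martingale (\<lambda>_ _. 0)"
    by (simp add: continuous_martingale_def ucont_const cond_expect_def)
  have E: "continuous_martingale (E i)" for i
    using from_nat_into[of "insert (\<lambda>_ _. 0) S" i] zero unfolding E_def S_def by auto
  have "\<exists>X. (\<forall>n. \<exists>b. \<forall>i\<ge>b. \<not> X n i) \<and>
      (\<forall>i. \<exists>B. \<forall>n>i. E i (length (map X [0..<n])) (pad (map X [0..<n])) \<le> B)"
    using E by (intro diagonal_sequence extend_by_eventually_zero_row) (auto simp: continuous_martingale_def)
  then obtain \<omega> where rows: "\<And>n. \<exists>b. \<forall>i\<ge>b. \<not> \<omega> n i"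
    and "\<And>i. \<exists>B. \<forall>n>i. E i n (pad (map \<omega> [0..<n])) \<le> B" by auto
  moreover have "E i n (pad (map \<omega> [0..<n])) = E i n \<omega>" for i n
  proof -
    have "\<forall>j<n. pad (map \<omega> [0..<n]) j = \<omega> j" by (simp add: pad_def)
    then show ?thesis using E[of i] unfolding continuous_martingale_def by blast
  qed
  ultimately have bd: "\<exists>B. \<forall>n>i. E i n \<omega> \<le> B" for i by simp
  have "doob_random \<omega>"
    unfolding doob_random_def
  proof (intro allI impI, elim conjE, rule ccontr)
    fix M assume M: "computable_doob_martingale M" "\<forall>n \<xi>. 0 \<le> M n \<xi>" and nc: "\<not> convergent (\<lambda>n. M n \<omega>)"
    obtain F where "cf F" "\<forall>n \<omega>. real_name (\<lambda>k. F (tuple_join n \<omega>) (pr n k)) (M n \<omega>)"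
      using M(1) unfolding computable_doob_martingale_def by blast
    then interpret computable_martingale M F
      using M by unfold_locales (auto simp: computable_doob_martingale_def)
    obtain p where p: "\<And>\<xi>. share p 0 * M 0 \<xi> + cash p 0 \<le> real (capital p)"
      and unb: "\<And>J. \<exists>m. J \<le> stage p F m \<omega>"
      using stage_unbounded[OF nc] by blast
    have "wealth p F M \<in> S"
      unfolding S_def using continuous_martingale_wealth[OF p] computable_martingale_axioms by blast
    then obtain i where i: "E i = wealth p F M"
      unfolding E_def using from_nat_into_surj[of "insert (\<lambda>_ _. 0) S"] \<open>countable S\<close> by auto
    obtain B where B: "\<And>n. i < n \<Longrightarrow> wealth p F M n \<omega> \<le> B" using bd[of i] i by auto
    obtain j where j: "B + 1 \<le> level p j" using level_unbounded by blast
    obtain m where m: "j \<le> stage p F m \<omega>" using unb by blast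
    let ?n = "max m (Suc i)"
    have "j \<le> stage p F ?n \<omega>" using m stage_mono[of m ?n p F \<omega>] by simp
    then have "B + 1 \<le> level p (stage p F ?n \<omega>)" using j level_mono[of j _ p] by fastforce
    also have "\<dots> \<le> wealth p F M ?n \<omega>" by (rule wealth_ge_level[OF p])
    also have "\<dots> \<le> B" by (rule B) simp
    finally show False by simp
  qed
  with rows show ?thesis by blast
qed

text \<open>Row \<open>n\<close> of \<omega> is row 0 of the tail. The column from which it vanishes
  is hard-wired after \<open>n\<close> is fixed, so it need not be computable from
  \<open>n\<close>.\<close>

lemma eventually_zero_rows_imp_not_ecu_random:
  assumes "\<And>m. \<exists>b. \<forall>i\<ge>b. \<not> \<omega> m i" shows "\<not> ecu_random \<omega>"
proof
  assume "ecu_random \<omega>"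
  then obtain n where n: "computably_random_uniformly_rel (join (tail_from n \<omega>)) (tuple_join n \<omega>)"
    unfolding ecu_random_def by blast
  obtain b where b: "\<And>i. b \<le> i \<Longrightarrow> \<not> \<omega> n i" using assms by blast
  obtain F where F: "cf F" "\<forall>\<gamma>. martingale_name (F \<gamma>) (\<lambda>\<sigma>. real (row0_bet b \<sigma>))"
    using row0_bet_name by blast
  have "succeeds_on (\<lambda>\<sigma>. real (row0_bet b \<sigma>)) (join (tail_from n \<omega>))"
    by (rule row0_bet_succeeds) (simp add: join_def tail_from_def b)
  then have "\<exists>F d. cf F \<and> (\<forall>\<gamma>. nonneg_martingale (d \<gamma>) \<and> martingale_name (F \<gamma>) (d \<gamma>)) \<and>
      succeeds_on (d (tuple_join n \<omega>)) (join (tail_from n \<omega>))"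
    using F nonneg_martingale_row0_bet[of b]
    by (intro exI[of _ F] exI[of _ "\<lambda>_ \<sigma>. real (row0_bet b \<sigma>)"]) blast
  with n show False unfolding computably_random_uniformly_rel_def by blast
qed

theorem theorem5p13:
  shows "(\<forall>\<omega> :: nat \<Rightarrow> nat \<Rightarrow> bool. computably_random_seq \<omega> \<longrightarrow> ecu_random \<omega>) \<and>
         (\<forall>\<omega> :: nat \<Rightarrow> nat \<Rightarrow> bool. ecu_random \<omega> \<longrightarrow> doob_random \<omega>) \<and>
         (\<exists>\<omega> :: nat \<Rightarrow> nat \<Rightarrow> bool. ecu_random \<omega> \<and> \<not> computably_random_seq \<omega>) \<and>
         (\<exists>\<omega> :: nat \<Rightarrow> nat \<Rightarrow> bool. doob_random \<omega> \<and> \<not> ecu_random \<omega>)"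
  using computably_random_seq_imp_ecu_random ecu_random_imp_doob_random
    exists_ecu_random_not_computably_random exists_doob_random_eventually_zero_rows
    eventually_zero_rows_imp_not_ecu_random
  by blast

end
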